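(* Let $N$ be even, $M>N$, and let $S$ be a real Wishart matrix in the class $W_{\mathbb{R}}(\Sigma,M)$ where the $N\times N$ covariance matrix $\Sigma$ has one eigenvalue equal to $1+\tau$ and all its other $N-1$ eigenvalues equal to $1$. Then the joint probability density function of the eigenvalues $\lambda_1,\ldots,\lambda_N$ of $S$ is given by $$P(\lambda)=\tilde{Z}_{M,N}^{-1}\int_{\Gamma}|\Delta(\lambda)|\,e^{Mt}\prod_{j=1}^N e^{-\frac{M}{2}\lambda_j}\lambda_j^{\frac{M-N-1}{2}}\left(t-\frac{\tau}{2(1+\tau)}\lambda_j\right)^{-\frac12}dt,$$ where $\Gamma$ is a closed contour, oriented counter-clockwise, that encloses all the points $\frac{\tau}{2(1+\tau)}\lambda_1,\ldots,\frac{\tau}{2(1+\tau)}\lambda_N$, and $\tilde{Z}_{M,N}$ is a normalization constant (independent of $\lambda$). The branch cut of each square root $\left(t-\frac{\tau}{2(1+\tau)}\lambda_j\right)^{-\frac12}$ is the line $\arg\left(t-\frac{\tau}{2(1+\tau)}\lambda_j\right)=\pi$.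
   Context: $M,N$ are positive integers. $X$ is an $N\times M$ real random matrix whose columns are independent, identically distributed $N$-variate normal vectors with mean zero and positive definite covariance matrix $\Sigma$ (so $1+\tau>0$). The matrix $S=\frac1M XX^T$ is said to be a real Wishart matrix in the class $W_{\mathbb{R}}(\Sigma,M)$. $\Delta(\lambda)=\prod_{1\le i<j\le N}(\lambda_j-\lambda_i)$ is the Vandermonde determinant. The density is with respect to Lebesgue measure on the eigenvalues $\lambda_j>0$.
   Formalization: The contour Γ is additionally required not to meet the real segment spanned by the points τλ_j/(2(1+τ)), because with the stated branch cuts an enclosing contour that crosses between two of these points can give a different value. *)

theory Defs
  imports "HOL-Probability.Probability" "HOL-Complex_Analysis.Complex_Analysis"
begin

definition charpoly :: "real ^ 'n ^ 'n \<Rightarrow> real poly" where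
  "charpoly A = det (mat [:0, 1:] - (\<chi> i j. [:A $ i $ j:]))"

(* The real eigenvalues, each repeated according to its algebraic multiplicity. *)
definition eigenvalues :: "real ^ 'n ^ 'n \<Rightarrow> real multiset" where
  "eigenvalues A = proots (charpoly A)"

definition positive_definite :: "real ^ 'n ^ 'n \<Rightarrow> bool" where
  "positive_definite A \<longleftrightarrow> transpose A = A \<and> (\<forall>x. x \<noteq> 0 \<longrightarrow> x \<bullet> (A *v x) > 0)"

(* Meant for positive definite C only. *)
definition multivariate_normal_density ::
    "real ^ 'n \<Rightarrow> real ^ 'n ^ 'n \<Rightarrow> real ^ 'n \<Rightarrow> real" where
  "multivariate_normal_density \<mu> C x =
     exp (- ((x - \<mu>) \<bullet> (matrix_inv C *v (x - \<mu>))) / 2) / sqrt ((2 * pi) ^ CARD('n) * det C)"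

(* X is an N x M matrix (type real ^ 'm ^ 'n, so N = CARD('n) rows and M = CARD('m) columns)
   whose columns are independent N(0, C) vectors, and S = X X^T / M. *)
definition real_wishart ::
    "'a measure \<Rightarrow> real ^ 'n ^ 'n \<Rightarrow> ('a \<Rightarrow> real ^ 'm ^ 'n) \<Rightarrow> ('a \<Rightarrow> real ^ 'n ^ 'n) \<Rightarrow> bool" where
  "real_wishart \<Omega> C X S \<longleftrightarrow>
     prob_space \<Omega> \<and>
     prob_space.indep_vars \<Omega> (\<lambda>_. borel) (\<lambda>k \<omega>. column k (X \<omega>)) UNIV \<and>
     (\<forall>k. distributed \<Omega> lborel (\<lambda>\<omega>. column k (X \<omega>))
            (\<lambda>x. ennreal (multivariate_normal_density 0 C x))) \<and>
     (\<forall>\<omega>\<in>space \<Omega>. S \<omega> = (1 / real CARD('m)) *\<^sub>R (X \<omega> ** transpose (X \<omega>)))"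

(* Joint density of the unlabelled eigenvalues: a symmetric function P on R^N whose integral
   over any permutation-invariant Borel set A is the probability that the eigenvalues,
   in one (equivalently, every) labelling, form a point of A. *)
definition joint_eigenvalue_density ::
    "'a measure \<Rightarrow> ('a \<Rightarrow> real ^ 'n ^ 'n) \<Rightarrow> (real ^ 'n \<Rightarrow> real) \<Rightarrow> bool" where
  "joint_eigenvalue_density \<Omega> S P \<longleftrightarrow>
     P \<in> borel_measurable borel \<and>
     (\<forall>x. P x \<ge> 0) \<and>
     (\<forall>\<sigma> x. bij \<sigma> \<longrightarrow> P (\<chi> i. x $ \<sigma> i) = P x) \<and>
     (\<forall>A\<in>sets borel. (\<forall>\<sigma> x. bij \<sigma> \<longrightarrow> x \<in> A \<longrightarrow> (\<chi> i. x $ \<sigma> i) \<in> A) \<longrightarrow>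
        (let E = {\<omega> \<in> space \<Omega>. \<exists>x\<in>A. eigenvalues (S \<omega>) = image_mset (\<lambda>i. x $ i) (mset_set UNIV)}
         in E \<in> sets \<Omega> \<and> emeasure \<Omega> E = (\<integral>\<^sup>+ x\<in>A. ennreal (P x) \<partial>lborel)))"

definition vandermonde :: "real ^ 'n::{finite,linorder} \<Rightarrow> real" where
  "vandermonde x = (\<Prod>(i, j)\<in>{(i, j). i < j}. x $ j - x $ i)"

(* Closed contour going once counter-clockwise around the points of A. For collinear A the
   convex hull is the segment spanned by A; keeping the contour off that segment, and not only
   off A, keeps it off the branch cuts joining points of A. *)
definition encloses_ccw :: "(real \<Rightarrow> complex) \<Rightarrow> complex set \<Rightarrow> bool" where
  "encloses_ccw \<gamma> A \<longleftrightarrow>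
     valid_path \<gamma> \<and> pathfinish \<gamma> = pathstart \<gamma> \<and>
     path_image \<gamma> \<inter> convex hull A = {} \<and>
     (\<forall>a\<in>A. winding_number \<gamma> a = 1)"

end

theory Submission
  imports Defs
begin

text \<open>Write \<open>N\<close> and \<open>M\<close> for the numbers of rows and columns, \<open>p\<^sub>k\<close> for the \<open>k\<close>-th power sum of the
eigenvalues, and \<open>c = \<tau> / (2 (1 + \<tau>))\<close>. After rescaling the data matrix by \<open>1 / sqrt M\<close> the Wishart
matrix is \<open>Y Y\<^sup>T\<close>, and \<open>Y\<close> has a density proportional to
\<open>exp (- M/2 tr (Y Y\<^sup>T) + M c (v \<bullet> Y Y\<^sup>T v))\<close>, where \<open>v\<close> is a unit eigenvector of the covariance matrix for
the eigenvalue \<open>1 + \<tau>\<close>. Only the second summand is not a function of the eigenvalues. The proof therefore has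
three parts.

The first part finds the law of the eigenvalues of \<open>Y Y\<^sup>T\<close> when \<open>Y\<close> is distributed by Lebesgue measure: it has
density \<open>C \<bar>\<Delta>(\<lambda>)\<bar> \<Prod>\<^sub>j \<lambda>\<^sub>j powr ((M - N - 1) / 2)\<close> (\<open>gram_eigenvalue_law\<close>). Instead of computing the Jacobian of
the spectral decomposition, one compares moments. Integrating by parts against a Gaussian along the vector fields
\<open>Y \<mapsto> (Y Y\<^sup>T)\<^sup>k Y\<close>, and against the claimed density along \<open>\<lambda>\<^sub>i ^ (k+1) \<partial>\<^sub>i\<close>, gives the same recursion for the
expectations of products of power sums (\<open>gauss_loop_equations\<close>, \<open>laguerre_loop_equations\<close>), and this recursion determines
all of them up to one factor (\<open>loop_equations_unique\<close>). The factor is the same for all Gaussian widths because both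
total masses are homogeneous of the same degree. So the functions \<open>exp (- s p\<^sub>1) \<Prod> p\<^sub>k\<close> have the same integrals for both
laws, and these functions separate points of a compactification of the set of sorted vectors; the
Stone-Weierstrass theorem makes the laws equal (\<open>measure_eqI_shrink\<close>).

The second part averages the remaining factor over the direction \<open>v\<close>. Lebesgue measure is invariant under \<open>Y \<mapsto> Q Y\<close>
for orthogonal \<open>Q\<close>, so \<open>v\<close> may be replaced by a Gaussian vector, power by power in the exponential series, at the
price of dividing by the moments of its length (\<open>spike_direction_average\<close>). What remains is a series in the moments of
the quadratic form \<open>\<Sum>\<^sub>j b\<^sub>j w\<^sub>j\<^sup>2\<close> of a standard Gaussian vector \<open>w\<close>. The \<open>b\<^sub>j\<close> are the numbers \<open>c \<lambda>\<^sub>j\<close>, shifted by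
\<open>\<bar>c\<bar> p\<^sub>1\<close> so as to be nonnegative whatever the sign of \<open>\<tau>\<close>; every series then has nonnegative terms and may be
integrated termwise.

The third part recognises this series as the contour integral (\<open>contour_spike_terms\<close>). The generating function of the
Gaussian moments is \<open>\<Prod>\<^sub>j (1 - 2 z b\<^sub>j) powr (- 1/2)\<close>, so on a large circle the product of inverse square roots has a Laurent
expansion with these moments as coefficients, and integrating it against \<open>exp (M t)\<close> divides the \<open>k\<close>-th coefficient by
a factorial, which up to a geometric factor is the moment of the length of \<open>w\<close>. It is here that \<open>N\<close> has to be even: the
branch cuts to the left of all branch points cancel in pairs (\<open>inv_sqrt_prod_holomorphic\<close>), so that the contour may be
deformed to the circle.\<close>

section \<open>Products of power sums and loop equations\<close>

definition prod_over :: "(nat \<Rightarrow> real) \<Rightarrow> nat list \<Rightarrow> real" where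
  "prod_over T ks = prod_list (map T ks)"

lemma prod_over_simps[simp]: "prod_over T [] = 1" "prod_over T (k # ks) = T k * prod_over T ks"
  by (simp_all add: prod_over_def)

primrec prod_over_deriv :: "(nat \<Rightarrow> real) \<Rightarrow> (nat \<Rightarrow> real) \<Rightarrow> nat list \<Rightarrow> real" where
  "prod_over_deriv T d [] = 0"
| "prod_over_deriv T d (m # ks) = d m * prod_over T ks + T m * prod_over_deriv T d ks"

text \<open>The value of the derivation that sends \<open>T m\<close> to \<open>m T (k + m - 1)\<close> on a product of the \<open>T m\<close>. It is kept as a list
of coefficients and index lists, so that a linear functional can be applied to each product
(\<open>prod_over_deriv_shifted_terms\<close>).\<close>
primrec shifted_terms :: "nat \<Rightarrow> nat list \<Rightarrow> (real \<times> nat list) list" where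
  "shifted_terms k [] = []"
| "shifted_terms k (m # ks) =
    (if m = 0 then [] else [(real m, (k + m - 1) # ks)]) @ map (map_prod id ((#) m)) (shifted_terms k ks)"

lemma has_real_derivative_prod_over:
  assumes "\<And>m. ((\<lambda>s. T s m) has_real_derivative d m) (at t)"
  shows "((\<lambda>s. prod_over (T s) ks) has_real_derivative prod_over_deriv (T t) d ks) (at t)"
proof (induction ks)
  case (Cons m ks)
  show ?case using DERIV_mult[OF assms[of m] Cons.IH] by (simp add: mult.commute add.commute)
qed simp

lemma prod_over_deriv_sum: "(\<Sum>i\<in>I. v i * prod_over_deriv T (d i) ks) = prod_over_deriv T (\<lambda>m. \<Sum>i\<in>I. v i * d i m) ks"
proof (induction ks)
  case (Cons m ks)
  have "(\<Sum>i\<in>I. v i * prod_over_deriv T (d i) (m # ks))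
      = (\<Sum>i\<in>I. v i * d i m) * prod_over T ks + T m * (\<Sum>i\<in>I. v i * prod_over_deriv T (d i) ks)"
    unfolding sum_distrib_left sum_distrib_right sum.distrib[symmetric]
    by (intro sum.cong) (simp_all add: algebra_simps)
  then show ?case using Cons by simp
qed simp

lemma prod_over_deriv_cmult: "c * prod_over_deriv T d ks = prod_over_deriv T (\<lambda>m. c * d m) ks"
  by (induction ks) (simp_all add: algebra_simps)

lemma prod_over_deriv_shifted_terms:
  "prod_over_deriv T (\<lambda>m. real m * T (k + m - 1)) ks = (\<Sum>(q, l)\<leftarrow>shifted_terms k ks. q * prod_over T l)"
proof (induction ks)
  case (Cons m ks)
  have "(\<Sum>(q, l)\<leftarrow>map (map_prod id ((#) m)) xs. q * prod_over T l) = T m * (\<Sum>(q, l)\<leftarrow>xs. q * prod_over T l)" for xs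
    by (induction xs) (auto simp: algebra_simps)
  then show ?case using Cons by simp
qed simp

lemma shifted_terms_weight:
  "(q, l) \<in> set (shifted_terms (Suc k) ks) \<Longrightarrow> sum_list l = k + sum_list ks"
  by (induction ks arbitrary: q l) (auto split: if_splits)

lemma real_polynomial_prod_over:
  assumes "\<And>k. real_polynomial_function (T k)"
  shows "real_polynomial_function (\<lambda>x. prod_over (\<lambda>k. T k x) ks)"
  by (induction ks) (auto intro!: assms real_polynomial_function.intros(2-4))

lemma real_polynomial_prod_over_deriv:
  assumes "\<And>k. real_polynomial_function (T k)" "\<And>k. real_polynomial_function (d k)"
  shows "real_polynomial_function (\<lambda>x. prod_over_deriv (\<lambda>k. T k x) (\<lambda>k. d k x) ks)"
  by (induction ks) (auto intro!: assms real_polynomial_function.intros(2-4) real_polynomial_prod_over)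

text \<open>The Schwinger-Dyson or loop equations of random matrix theory, for \<open>E ks\<close> the expectation of
\<open>\<Prod>k\<leftarrow>ks. tr (S\<^sup>k)\<close>, where \<open>S\<close> is a Wishart matrix of size \<open>n\<close> with \<open>n + c\<close> degrees of freedom.\<close>
definition loop_equations :: "real \<Rightarrow> real \<Rightarrow> real \<Rightarrow> (nat list \<Rightarrow> real) \<Rightarrow> bool" where
  "loop_equations n c b E \<longleftrightarrow>
     (\<forall>ks. E (0 # ks) = n * E ks) \<and>
     (\<forall>k ks. b * E (Suc k # ks) = (real k + c) * E (k # ks) + (\<Sum>r\<le>k. E (r # (k - r) # ks))
         + 2 * (\<Sum>(q, l)\<leftarrow>shifted_terms (Suc k) ks. q * E l))"

text \<open>The loop equations express the value at an index list through values at lists with a smaller sum; lists of equal sum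
are only compared to drop zeros. So they determine \<open>E\<close> up to the value \<open>E []\<close>.\<close>
lemma loop_equations_unique:
  assumes E1: "loop_equations n c b E1" and E2: "loop_equations n c b E2" and b: "b \<noteq> 0"
  shows "E1 ks * E2 [] = E2 ks * E1 []"
proof (induction ks rule: wf_induct_rule[OF wf_measures[of "[sum_list, length]"]])
  case (1 ks)
  then have IH: "E1 l * E2 [] = E2 l * E1 []"
    if "sum_list l < sum_list ks \<or> sum_list l = sum_list ks \<and> length l < length ks" for l
    using that by simp
  show ?case
  proof (cases ks)
    case (Cons m ks')
    show ?thesis
    proof (cases m)
      case 0
      then show ?thesis
        using IH[of ks'] E1 E2 Cons by (simp add: loop_equations_def)
    next
      case (Suc k)
      have s: "sum_list ks = Suc k + sum_list ks'" using Cons Suc by simp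
      have "E1 (k # ks') * E2 [] = E2 (k # ks') * E1 []" by (rule IH) (simp add: s)
      moreover have "(\<Sum>r\<le>k. E1 (r # (k - r) # ks')) * E2 [] = (\<Sum>r\<le>k. E2 (r # (k - r) # ks')) * E1 []"
        unfolding sum_distrib_right by (intro sum.cong refl IH) (simp add: s)
      moreover have "(\<Sum>(q, l)\<leftarrow>xs. q * E1 l) * E2 [] = (\<Sum>(q, l)\<leftarrow>xs. q * E2 l) * E1 []"
        if "set xs \<subseteq> set (shifted_terms (Suc k) ks')" for xs
        using that
      proof (induction xs)
        case (Cons p xs)
        obtain q l where p: "p = (q, l)" by (cases p)
        have "E1 l * E2 [] = E2 l * E1 []"
          using Cons.prems shifted_terms_weight[of q l k ks'] by (intro IH) (simp add: s p)
        then show ?case using Cons by (simp add: p algebra_simps)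
      qed simp
      from this[OF order_refl] have "(\<Sum>(q, l)\<leftarrow>shifted_terms (Suc k) ks'. q * E1 l) * E2 [] =
        (\<Sum>(q, l)\<leftarrow>shifted_terms (Suc k) ks'. q * E2 l) * E1 []" .
      ultimately have "(b * E1 (Suc k # ks')) * E2 [] = (b * E2 (Suc k # ks')) * E1 []"
        using E1 E2 unfolding loop_equations_def
        by (simp add: distrib_right) (simp add: mult.assoc)
      then show ?thesis using b Cons Suc by simp
    qed
  qed simp
qed

text \<open>A single vanishing integral for each \<open>k\<close> and \<open>ks\<close> is what integration by parts delivers.\<close>
lemma loop_equationsI:
  fixes T :: "'x \<Rightarrow> nat \<Rightarrow> real" and w :: "'x \<Rightarrow> real"
  assumes int: "\<And>ks. integrable M (\<lambda>x. prod_over (T x) ks * w x)" and T0: "\<And>x. T x 0 = n"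
    and zero: "\<And>k ks. integral\<^sup>L M (\<lambda>x. ((real k + c) * prod_over (T x) (k # ks) + (\<Sum>r\<le>k. prod_over (T x) (r # (k - r) # ks))
       + 2 * (\<Sum>(q, l)\<leftarrow>shifted_terms (Suc k) ks. q * prod_over (T x) l) - b * prod_over (T x) (Suc k # ks)) * w x) = 0"
  shows "loop_equations n c b (\<lambda>ks. integral\<^sup>L M (\<lambda>x. prod_over (T x) ks * w x))"
  unfolding loop_equations_def
proof (intro conjI allI)
  let ?E = "\<lambda>ks. integral\<^sup>L M (\<lambda>x. prod_over (T x) ks * w x)"
  show "?E (0 # ks) = n * ?E ks" for ks
    by (simp add: T0 mult.assoc)
  fix k ks
  have sl: "integrable M (\<lambda>x. (\<Sum>(q, l)\<leftarrow>xs. q * prod_over (T x) l) * w x) \<and>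
      integral\<^sup>L M (\<lambda>x. (\<Sum>(q, l)\<leftarrow>xs. q * prod_over (T x) l) * w x) = (\<Sum>(q, l)\<leftarrow>xs. q * ?E l)" for xs
  proof (induction xs)
    case (Cons p xs)
    then show ?case using int[of "snd p"] by (cases p) (simp add: distrib_right mult.assoc)
  qed simp
  have expand: "((real k + c) * prod_over (T x) (k # ks) + (\<Sum>r\<le>k. prod_over (T x) (r # (k - r) # ks))
       + 2 * (\<Sum>(q, l)\<leftarrow>shifted_terms (Suc k) ks. q * prod_over (T x) l) - b * prod_over (T x) (Suc k # ks)) * w x
     = (real k + c) * (prod_over (T x) (k # ks) * w x) + (\<Sum>r\<le>k. prod_over (T x) (r # (k - r) # ks) * w x)
       + 2 * ((\<Sum>(q, l)\<leftarrow>shifted_terms (Suc k) ks. q * prod_over (T x) l) * w x) - b * (prod_over (T x) (Suc k # ks) * w x)" for x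
    by (simp add: sum_distrib_right[symmetric] sum_distrib_left[symmetric] algebra_simps del: prod_over_simps)
  show "b * ?E (Suc k # ks) = (real k + c) * ?E (k # ks) + (\<Sum>r\<le>k. ?E (r # (k - r) # ks))
     + 2 * (\<Sum>(q, l)\<leftarrow>shifted_terms (Suc k) ks. q * ?E l)"
    using zero[of k ks] int sl unfolding expand
    by (simp add: Bochner_Integration.integral_sum del: prod_over_simps)
qed

section \<open>The spectral theorem for real symmetric matrices\<close>

definition diag_mat :: "real^'n \<Rightarrow> real^'n^'n" where
  "diag_mat d = (\<chi> i j. if i = j then d $ i else 0)"

primrec matpow :: "real^'n^'n \<Rightarrow> nat \<Rightarrow> real^'n^'n" where
  "matpow A 0 = mat 1"
| "matpow A (Suc k) = A ** matpow A k"

definition power_sum :: "nat \<Rightarrow> real^'n \<Rightarrow> real" where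
  "power_sum k x = (\<Sum>i\<in>UNIV. (x $ i) ^ k)"

definition entries :: "real^'n \<Rightarrow> real multiset" where
  "entries x = image_mset (\<lambda>i. x $ i) (mset_set UNIV)"

definition sorted_vec :: "real^'n::{finite,linorder} \<Rightarrow> bool" where
  "sorted_vec x \<longleftrightarrow> (\<forall>i j. i \<le> j \<longrightarrow> x $ i \<le> x $ j)"

text \<open>Meaningful for symmetric matrices, for which such a vector exists and is unique.\<close>
definition spectrum :: "real^'n::{finite,linorder}^'n::{finite,linorder} \<Rightarrow> real^'n::{finite,linorder}" where
  "spectrum A = (SOME x. sorted_vec x \<and> eigenvalues A = entries x)"

lemma linear_coeff_eq_0:
  fixes b c :: real
  assumes "\<And>t. 2 * t * b + t^2 * c \<le> 0"
  shows "b = 0"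
proof (rule ccontr)
  assume b: "b \<noteq> 0"
  \<comment> \<open>At this \<open>t\<close> the linear term exceeds the quadratic one.\<close>
  define t where "t = b / (\<bar>c\<bar> + 1)"
  have p: "\<bar>c\<bar> + 1 > 0" by simp
  have tb: "b = t * (\<bar>c\<bar> + 1)" using p by (simp add: t_def)
  have "t \<noteq> 0" using b tb by auto
  have "2 * t * b + t^2 * c = t^2 * (2 * \<bar>c\<bar> + 2 + c)"
    by (subst tb) (simp add: power2_eq_square algebra_simps)
  moreover have "t^2 * (2 * \<bar>c\<bar> + 2 + c) > 0" using \<open>t \<noteq> 0\<close> by (intro mult_pos_pos) auto
  ultimately show False using assms[of t] by simp
qed

lemma inner_matrix_vector: "x \<bullet> (A *v y) = (transpose A *v x) \<bullet> y"
  for A :: "real^'n^'m"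
  by (metis dot_lmul_matrix transpose_matrix_vector)

lemma symmetric_inner: "transpose A = A \<Longrightarrow> x \<bullet> (A *v y) = (A *v x) \<bullet> y"
  for A :: "real^'n^'n"
  by (metis inner_matrix_vector)

text \<open>A maximiser \<open>u\<close> of \<open>x \<bullet> A x\<close> on the unit sphere of \<open>V\<close> is an eigenvector, because the first variation in every direction
orthogonal to \<open>u\<close> vanishes; the orthogonal complement of \<open>u\<close> in \<open>V\<close> is again invariant and has smaller dimension.\<close>
lemma symmetric_eigenbasis:
  fixes A :: "real^'n^'n"
  assumes sym: "transpose A = A" and V: "subspace V" and inv: "\<And>x. x \<in> V \<Longrightarrow> A *v x \<in> V"
  shows "\<exists>B. B \<subseteq> V \<and> pairwise orthogonal B \<and> (\<forall>u\<in>B. norm u = 1 \<and> (\<exists>l. A *v u = l *\<^sub>R u)) \<and> span B = V"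
  using V inv
proof (induction "dim V" arbitrary: V rule: less_induct)
  case less
  show ?case
  proof (cases "V = {0}")
    case True
    then show ?thesis by (intro exI[of _ "{}"]) auto
  next
    case False
    then obtain z where z: "z \<in> V" "z \<noteq> 0" using subspace_0[OF less.prems(1)] by blast
    let ?K = "sphere 0 1 \<inter> V"
    have "compact ?K" using closed_subspace[OF less.prems(1)] by (intro compact_Int_closed) auto
    moreover have "(1 / norm z) *\<^sub>R z \<in> ?K" using z less.prems(1) by (auto simp: subspace_scale)
    moreover have "continuous_on ?K (\<lambda>x. x \<bullet> (A *v x))"
      by (intro continuous_intros matrix_vector_mult_linear_continuous_on)
    ultimately obtain u where u: "u \<in> ?K" "\<And>y. y \<in> ?K \<Longrightarrow> y \<bullet> (A *v y) \<le> u \<bullet> (A *v u)"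
      using continuous_attains_sup[of ?K "\<lambda>x. x \<bullet> (A *v x)"] by blast
    define l where "l = u \<bullet> (A *v u)"
    have u1: "norm u = 1" "u \<in> V" "u \<bullet> u = 1" using u(1) by (auto simp: norm_eq_1)
    have max: "y \<bullet> (A *v y) \<le> l * (y \<bullet> y)" if "y \<in> V" for y
    proof (cases "y = 0")
      case False
      have "(1 / norm y) *\<^sub>R y \<in> ?K" using False that less.prems(1) by (auto simp: subspace_scale)
      from u(2)[OF this] have "(y \<bullet> (A *v y)) / (norm y)^2 \<le> l"
        by (simp add: matrix_vector_mult_scaleR l_def power2_eq_square)
      then show ?thesis using False by (simp add: divide_le_eq power2_norm_eq_inner)
    qed simp
    have ortho: "u \<bullet> (A *v w) = 0" if w: "w \<in> V" "u \<bullet> w = 0" for w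
    proof (rule linear_coeff_eq_0)
      fix t :: real
      have sc: "A *v (t *\<^sub>R w) = t *\<^sub>R (A *v w)" by (simp add: matrix_vector_mult_scaleR)
      have "u + t *\<^sub>R w \<in> V" using u1 w less.prems(1) by (simp add: subspace_add subspace_scale)
      from max[OF this] have "l + 2 * t * (u \<bullet> (A *v w)) + t^2 * (w \<bullet> (A *v w)) \<le> l * (1 + t^2 * (w \<bullet> w))"
        using symmetric_inner[OF sym, of w u] w(2) u1(3)
        by (simp add: matrix_vector_right_distrib sc inner_add inner_commute l_def power2_eq_square algebra_simps)
      then show "2 * t * (u \<bullet> (A *v w)) + t^2 * (w \<bullet> (A *v w) - l * (w \<bullet> w)) \<le> 0"
        by (simp add: algebra_simps)
    qed
    have Au: "A *v u = l *\<^sub>R u"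
    proof -
      define r where "r = A *v u - l *\<^sub>R u"
      have rV: "r \<in> V" using less.prems u1 by (simp add: r_def subspace_diff subspace_scale)
      have ru: "u \<bullet> r = 0" using u1 by (simp add: r_def inner_diff_right l_def)
      have "r \<bullet> r = (A *v u - l *\<^sub>R u) \<bullet> r" by (simp only: r_def[symmetric])
      then have "r \<bullet> r = (A *v u) \<bullet> r" using ru by (simp add: inner_diff_left)
      also have "(A *v u) \<bullet> r = u \<bullet> (A *v r)" using symmetric_inner[OF sym] by simp
      also have "\<dots> = 0" using ortho[OF rV ru] .
      finally show ?thesis by (simp add: r_def)
    qed
    define W where "W = V \<inter> {w. u \<bullet> w = 0}"
    have W: "subspace W" unfolding W_def by (intro subspace_inter less.prems subspace_hyperplane)
    have WA: "A *v x \<in> W" if "x \<in> W" for x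
      using that less.prems(2) ortho by (auto simp: W_def)
    have "u \<notin> W" using u1 by (simp add: W_def)
    then have "W \<subset> V" using u1(2) unfolding W_def by blast
    then have "span W \<subset> span V" using W less.prems(1) by (simp add: span_eq_iff[THEN iffD2])
    then have "dim W < dim V" by (rule dim_psubset)
    from less.hyps[OF this W WA] obtain B where
      B: "B \<subseteq> W" "pairwise orthogonal B" "\<And>u. u\<in>B \<Longrightarrow> norm u = 1 \<and> (\<exists>l. A *v u = l *\<^sub>R u)" "span B = W"
      by blast
    show ?thesis
    proof (intro exI[of _ "insert u B"] conjI ballI)
      show "insert u B \<subseteq> V" using B(1) u1 by (auto simp: W_def)
      show "pairwise orthogonal (insert u B)"
        using B(1,2) by (auto simp: pairwise_insert orthogonal_def W_def inner_commute)
      show "norm v = 1" "\<exists>l. A *v v = l *\<^sub>R v" if "v \<in> insert u B" for v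
        using that B(3) u1 Au by auto
      show "span (insert u B) = V"
      proof
        show "span (insert u B) \<subseteq> V" using B(1) u1 less.prems(1) by (intro span_minimal) (auto simp: W_def)
        show "V \<subseteq> span (insert u B)"
        proof
          fix x assume x: "x \<in> V"
          have "x - (u \<bullet> x) *\<^sub>R u \<in> W"
            using x u1 less.prems(1) by (auto simp: W_def subspace_diff subspace_scale inner_diff_right)
          then show "x \<in> span (insert u B)" using B(4) by (auto simp: span_insert)
        qed
      qed
    qed
  qed
qed

lemma spectral_theorem:
  fixes A :: "real^'n^'n"
  assumes sym: "transpose A = A"
  obtains Q d where "orthogonal_matrix Q" "A = Q ** diag_mat d ** transpose Q"
proof -
  obtain B where B: "pairwise orthogonal B" "\<And>u. u\<in>B \<Longrightarrow> norm u = 1" "\<And>u. u\<in>B \<Longrightarrow> \<exists>l. A *v u = l *\<^sub>R u" "span B = UNIV"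
    using symmetric_eigenbasis[OF sym subspace_UNIV] by auto
  have "0 \<notin> B" using B(2) by force
  then have "independent B" using B(1) by (intro pairwise_orthogonal_independent)
  then have "finite B" "card B = CARD('n)"
    using B(4) by (auto simp: independent_bound dim_eq_card[of B UNIV, symmetric] independent_imp_finite)
  then obtain f :: "'n \<Rightarrow> real^'n" where f: "bij_betw f UNIV B"
    by (metis finite_same_card_bij finite_class.finite_UNIV)
  obtain l where l: "\<And>u. u \<in> B \<Longrightarrow> A *v u = l u *\<^sub>R u" using B(3) by metis
  have fB: "f i \<in> B" for i using f by (auto simp: bij_betw_def)
  define Q :: "real^'n^'n" where "Q = (\<chi> i j. f j $ i)"
  define d :: "real^'n" where "d = (\<chi> i. l (f i))"
  have ff: "f i \<bullet> f j = (if i = j then 1 else 0)" for i j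
  proof (cases "i = j")
    case True then show ?thesis using B(2)[OF fB] by (simp add: norm_eq_1)
  next
    case False
    then have "f i \<noteq> f j" using f by (auto simp: bij_betw_def inj_on_def)
    then show ?thesis using B(1) fB False by (auto simp: pairwise_def orthogonal_def)
  qed
  have Q: "orthogonal_matrix Q"
    unfolding orthogonal_matrix
    using ff by (simp add: vec_eq_iff matrix_matrix_mult_def transpose_def Q_def mat_def inner_vec_def)
  have "A ** Q = Q ** diag_mat d"
  proof -
    have "(A ** Q) $ i $ j = (Q ** diag_mat d) $ i $ j" for i j
    proof -
      have "(A ** Q) $ i $ j = (A *v f j) $ i" by (simp add: matrix_matrix_mult_def matrix_vector_mult_def Q_def)
      also have "\<dots> = l (f j) * f j $ i" using l[OF fB] by simp
      also have "\<dots> = (Q ** diag_mat d) $ i $ j"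
        by (simp add: matrix_matrix_mult_def Q_def diag_mat_def d_def mult_delta_right mult.commute)
      finally show ?thesis .
    qed
    then show ?thesis by (simp add: vec_eq_iff)
  qed
  then have "A ** Q ** transpose Q = Q ** diag_mat d ** transpose Q" by simp
  then have "A = Q ** diag_mat d ** transpose Q"
    using Q by (simp add: matrix_mul_assoc[symmetric] orthogonal_matrix_def)
  with Q that show ?thesis by blast
qed

lemma charpoly_diag_mat:
  fixes d :: "real^'n"
  shows "charpoly (diag_mat d) = (\<Prod>i\<in>UNIV. [: - d $ i, 1:])"
proof -
  have "(mat [:0, 1:] - (\<chi> i j. [:diag_mat d $ i $ j:]) :: real poly^'n^'n)
     = (\<chi> i j. if i = j then [: - d $ i, 1:] else 0)"
    by (auto simp: vec_eq_iff mat_def diag_mat_def)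
  then show ?thesis unfolding charpoly_def by (subst det_diagonal) auto
qed

lemma matrix_diff:
  fixes A B :: "'a::comm_ring_1^'n^'m"
  shows "(A - B) ** C = A ** C - B ** C" and "D ** (A - B) = D ** A - D ** B"
  by (simp_all add: matrix_matrix_mult_def vec_eq_iff left_diff_distrib right_diff_distrib sum_subtractf)

text \<open>The characteristic polynomial is a determinant over the ring of polynomials, where \<open>Q\<close> and its transpose, read as
constant matrices, are still inverse to each other.\<close>
lemma eigenvalues_orthogonal_similar:
  fixes D :: "real^'n^'n"
  assumes Q: "orthogonal_matrix Q"
  shows "eigenvalues (Q ** D ** transpose Q) = eigenvalues D"
proof -
  define C :: "real^'n^'n \<Rightarrow> real poly^'n^'n" where "C = (\<lambda>A. \<chi> i j. [:A $ i $ j:])"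
  have Csum: "[:sum f S:] = (\<Sum>k\<in>S. [:f k:])" for f :: "'n \<Rightarrow> real" and S
    by (simp add: poly_eq_iff coeff_sum coeff_pCons split: nat.splits)
  have Cmult: "C (A ** B) = C A ** C B" for A B
    by (simp add: C_def vec_eq_iff matrix_matrix_mult_def Csum mult.commute)
  have C1: "C (mat 1) = mat 1" by (simp add: C_def vec_eq_iff mat_def)
  have QQ: "C Q ** C (transpose Q) = mat 1"
    using Q by (simp add: Cmult[symmetric] orthogonal_matrix_def C1)
  have comm: "C Q ** mat x = mat x ** C Q" for x
    by (simp add: vec_eq_iff matrix_matrix_mult_def mat_def mult_delta_left mult_delta_right mult.commute)
  have X: "mat [:0,1:] = C Q ** mat [:0,1:] ** C (transpose Q)"
    by (simp add: comm QQ matrix_mul_assoc[symmetric])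
  have "charpoly (Q ** D ** transpose Q) = det (mat [:0,1:] - C Q ** C D ** C (transpose Q))"
    by (simp add: charpoly_def C_def[symmetric] Cmult[symmetric]) (simp add: C_def)
  also have "mat [:0,1:] - C Q ** C D ** C (transpose Q) = C Q ** (mat [:0,1:] - C D) ** C (transpose Q)"
    by (subst X) (simp add: matrix_diff)
  also have "det \<dots> = det (C Q ** C (transpose Q)) * det (mat [:0,1:] - C D)"
    by (simp add: det_mul)
  also have "\<dots> = charpoly D" unfolding QQ by (simp add: charpoly_def C_def)
  finally show ?thesis by (simp add: eigenvalues_def)
qed

lemma eigenvalues_diag: "eigenvalues (diag_mat d) = entries d"
  unfolding eigenvalues_def charpoly_diag_mat entries_def
  by (subst proots_prod) (auto simp: sum_unfold_sum_mset)

lemma diag_mat_mult: "diag_mat x ** diag_mat y = diag_mat (\<chi> i. x $ i * y $ i)"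
  by (auto simp: vec_eq_iff matrix_matrix_mult_def diag_mat_def mult_delta_left mult_delta_right)

lemma matpow_diag: "matpow (diag_mat d) k = diag_mat (\<chi> i. d $ i ^ k)"
  by (induction k) (auto simp: diag_mat_mult, auto simp: diag_mat_def mat_def vec_eq_iff)

lemma matpow_similar:
  assumes Q: "orthogonal_matrix Q"
  shows "matpow (Q ** D ** transpose Q) k = Q ** matpow D k ** transpose Q"
proof (induction k)
  case 0 then show ?case using Q by (simp add: orthogonal_matrix_def)
next
  case (Suc k)
  have "matpow (Q ** D ** transpose Q) (Suc k) = Q ** D ** (transpose Q ** Q) ** matpow D k ** transpose Q"
    by (simp only: matpow.simps Suc matrix_mul_assoc)
  moreover have "transpose Q ** Q = mat 1" using Q by (simp add: orthogonal_matrix_def)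
  ultimately show ?case by (simp add: matrix_mul_assoc)
qed

lemma trace_similar:
  fixes D :: "real^'n^'n"
  assumes Q: "orthogonal_matrix Q"
  shows "trace (Q ** D ** transpose Q) = trace D"
proof -
  have "trace (Q ** D ** transpose Q) = trace (transpose Q ** (Q ** D))" by (rule trace_mul_sym)
  then show ?thesis using Q by (simp add: orthogonal_matrix_def matrix_mul_assoc)
qed

lemma power_sum_entries: "power_sum k x = sum_mset (image_mset (\<lambda>t. t ^ k) (entries x))"
  by (simp add: power_sum_def entries_def sum_unfold_sum_mset image_mset.compositionality o_def)

lemma trace_matpow_eigenvalues:
  assumes "transpose A = A"
  shows "trace (matpow A k) = sum_mset (image_mset (\<lambda>t. t ^ k) (eigenvalues A))"
proof -
  obtain Q d where Q: "orthogonal_matrix Q" and A: "A = Q ** diag_mat d ** transpose Q"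
    using spectral_theorem[OF assms] .
  have "trace (matpow A k) = power_sum k d"
    unfolding A matpow_similar[OF Q] trace_similar[OF Q] matpow_diag
    by (simp add: trace_def diag_mat_def power_sum_def)
  moreover have "eigenvalues A = entries d"
    unfolding A eigenvalues_orthogonal_similar[OF Q] by (rule eigenvalues_diag)
  ultimately show ?thesis by (simp add: power_sum_entries)
qed

section \<open>Power sums determine the entries\<close>

text \<open>Power sums are the values \<open>\<Sum>\<^sub>i q(x\<^sub>i)\<close> for monomials \<open>q\<close>, hence determine these sums for all polynomials. A polynomial
that vanishes at all entries of \<open>x\<close> and \<open>y\<close> except \<open>a\<close> counts the multiplicity of \<open>a\<close>.\<close>
lemma entries_eqI:
  fixes x y :: "real^'n"
  assumes "\<And>k. power_sum k x = power_sum k y"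
  shows "entries x = entries y"
proof (rule multiset_eqI)
  fix a
  have poly: "(\<Sum>i\<in>UNIV. poly q (x $ i)) = (\<Sum>i\<in>UNIV. poly q (y $ i))" for q
  proof -
    have "(\<Sum>i\<in>UNIV. poly q (z $ i)) = (\<Sum>k\<le>degree q. coeff q k * power_sum k z)" for z :: "real^'n"
      unfolding poly_altdef power_sum_def sum_distrib_left by (rule sum.swap)
    then show ?thesis using assms by simp
  qed
  define R where "R = (range (($) x) \<union> range (($) y)) - {a}"
  have fR: "finite R" by (simp add: R_def)
  \<comment> \<open>Only entries equal to \<open>a\<close> contribute to the sum of the values of \<open>q\<close>.\<close>
  define q where "q = (\<Prod>b\<in>R. [:-b, 1:])"
  have qa: "poly q a \<noteq> 0" using fR by (auto simp: q_def poly_prod R_def)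
  have q0: "poly q b = 0" if "b \<in> R" for b using that fR by (auto simp: q_def poly_prod)
  have cnt: "(\<Sum>i\<in>UNIV. poly q (z $ i)) = real (count (entries z) a) * poly q a"
    if "range (($) z) \<subseteq> R \<union> {a}" for z :: "real^'n"
  proof -
    have "(\<Sum>i\<in>UNIV. poly q (z $ i)) = (\<Sum>i\<in>UNIV. if z $ i = a then poly q a else 0)"
      using that q0 by (intro sum.cong) auto
    also have "\<dots> = real (card {i. z $ i = a}) * poly q a" by (simp add: sum.If_cases)
    also have "card {i. z $ i = a} = count (entries z) a"
      by (simp add: entries_def count_image_mset vimage_def)
    finally show ?thesis .
  qed
  have sub: "range (($) x) \<subseteq> R \<union> {a}" "range (($) y) \<subseteq> R \<union> {a}" by (auto simp: R_def)
  have "real (count (entries x) a) * poly q a = real (count (entries y) a) * poly q a"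
    using poly[of q] cnt[of x, OF sub(1)] cnt[of y, OF sub(2)] by simp
  then show "count (entries x) a = count (entries y) a" using qa by simp
qed

lemma entries_permute:
  fixes x :: "real^'n" and \<sigma> :: "'n \<Rightarrow> 'n"
  assumes "bij \<sigma>" shows "entries (\<chi> i. x $ \<sigma> i) = entries x"
proof (rule entries_eqI)
  show "power_sum k (\<chi> i. x $ \<sigma> i) = power_sum k x" for k
    using sum.reindex_bij_betw[OF assms, of "\<lambda>i. (x $ i) ^ k"] by (simp add: power_sum_def)
qed

lemma entries_eq_permute:
  fixes x y :: "real^'n"
  assumes "entries x = entries y"
  obtains \<sigma> where "bij \<sigma>" "y = (\<chi> i. x $ \<sigma> i)"
proof -
  obtain p where "p permutes UNIV" "\<And>i. y $ i = x $ p i"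
    using image_mset_eq_implies_permutes[of "UNIV::'n set" "\<lambda>i. y $ i" "\<lambda>i. x $ i"] assms
    by (auto simp: entries_def)
  then show ?thesis using that[of p] by (auto simp: vec_eq_iff permutes_bij)
qed

lemma sorted_vec_exists:
  fixes x :: "real^'n::{finite,linorder}"
  shows "\<exists>y::real^'n::{finite,linorder}. sorted_vec y \<and> entries y = entries x"
proof -
  define ns where "ns = sorted_list_of_set (UNIV :: 'n set)"
  define xs where "xs = sort_key (\<lambda>i. x $ i) ns"
  let ?N = "{..<CARD('n)}"
  have ns: "distinct ns" "set ns = UNIV" "sorted ns" "length ns = CARD('n)" by (auto simp: ns_def)
  have xs: "distinct xs" "set xs = UNIV" "sorted (map (\<lambda>i. x $ i) xs)" "length xs = CARD('n)"
    using ns by (auto simp: xs_def)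
  have b1: "bij_betw ((!) ns) ?N UNIV" using ns bij_betw_nth[of ns ?N UNIV] by auto
  have b2: "bij_betw ((!) xs) ?N UNIV" using xs bij_betw_nth[of xs ?N UNIV] by auto
  define idx where "idx = inv_into ?N ((!) ns)"
  have b3: "bij_betw idx UNIV ?N" unfolding idx_def by (rule bij_betw_inv_into[OF b1])
  have idx: "ns ! idx i = i" "idx i < CARD('n)" for i
    using b1 b3 by (auto simp: idx_def bij_betw_inv_into_right bij_betw_def)
  define \<sigma> where "\<sigma> = (!) xs \<circ> idx"
  have "bij \<sigma>" unfolding \<sigma>_def by (rule bij_betw_trans[OF b3 b2])
  moreover have "sorted_vec (\<chi> i. x $ \<sigma> i)"
    unfolding sorted_vec_def
  proof (intro allI impI)
    fix i j :: 'n assume ij: "i \<le> j"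
    have "idx i \<le> idx j"
    proof (rule ccontr)
      assume gt: "\<not> ?thesis"
      then have "j \<le> i" using sorted_nth_mono[OF ns(3), of "idx j" "idx i"] idx ns by simp
      then show False using ij gt by simp
    qed
    then show "(\<chi> i. x $ \<sigma> i) $ i \<le> (\<chi> i. x $ \<sigma> i) $ j"
      using sorted_nth_mono[OF xs(3), of "idx i" "idx j"] idx xs by (simp add: \<sigma>_def)
  qed
  ultimately have "sorted_vec (\<chi> i. x $ \<sigma> i) \<and> entries (\<chi> i. x $ \<sigma> i) = entries x"
    using entries_permute by simp
  then show ?thesis ..
qed

lemma sorted_vec_unique:
  fixes x y :: "real^'n::{finite,linorder}"
  assumes "sorted_vec x" "sorted_vec y" "entries x = entries y"
  shows "x = y"
proof -
  define ns where "ns = sorted_list_of_set (UNIV :: 'n set)"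
  have ns: "distinct ns" "set ns = UNIV" "sorted ns" by (auto simp: ns_def)
  have mns: "mset ns = mset_set UNIV" using ns mset_set_set by metis
  have s: "sorted (map (\<lambda>i. z $ i) ns)" if "sorted_vec z" for z
    using that ns(3) by (auto simp: sorted_map sorted_vec_def intro: sorted_wrt_mono_rel)
  have "mset (map (\<lambda>i. x $ i) ns) = mset (map (\<lambda>i. y $ i) ns)"
    using assms(3) mns by (simp add: entries_def)
  then have "map (\<lambda>i. x $ i) ns = map (\<lambda>i. y $ i) ns"
    using s assms by (metis properties_for_sort)
  then show ?thesis using ns(2) by (simp add: vec_eq_iff)
qed

section \<open>The sorted eigenvalue vector\<close>

lemma spectrum:
  fixes A :: "real^'n::{finite,linorder}^'n::{finite,linorder}"
  assumes "transpose A = A"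
  shows "sorted_vec (spectrum A)" "eigenvalues A = entries (spectrum A)"
proof -
  obtain Q d where Q: "orthogonal_matrix Q" and A: "A = Q ** diag_mat d ** transpose Q"
    using spectral_theorem[OF assms] .
  have "eigenvalues A = entries d"
    unfolding A eigenvalues_orthogonal_similar[OF Q] by (rule eigenvalues_diag)
  then have "\<exists>x::real^'n::{finite,linorder}. sorted_vec x \<and> eigenvalues A = entries x" using sorted_vec_exists[of d] by auto
  from someI_ex[OF this] show "sorted_vec (spectrum A)" "eigenvalues A = entries (spectrum A)"
    by (auto simp: spectrum_def)
qed

lemma power_sum_spectrum: "transpose A = A \<Longrightarrow> power_sum k (spectrum A) = trace (matpow A k)"
  by (simp add: trace_matpow_eigenvalues spectrum power_sum_entries)

lemma spectrum_eqI:
  assumes "transpose A = A" "sorted_vec x" "\<And>k. power_sum k x = trace (matpow A k)"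
  shows "spectrum A = x"
  using assms by (intro sorted_vec_unique entries_eqI) (auto simp: spectrum power_sum_spectrum)

lemma continuous_matrix_mult[continuous_intros]:
  fixes f :: "'a::topological_space \<Rightarrow> real^'n^'m" and g :: "'a \<Rightarrow> real^'k^'n"
  assumes "continuous_on S f" "continuous_on S g"
  shows "continuous_on S (\<lambda>x. f x ** g x)"
  unfolding matrix_matrix_mult_def using assms
  by (intro continuous_on_vec_lambda continuous_intros)

lemma continuous_matpow[continuous_intros]:
  "continuous_on S f \<Longrightarrow> continuous_on S (\<lambda>x. matpow (f x) k)"
  by (induction k) (auto intro: continuous_intros)

lemma continuous_trace[continuous_intros]:
  fixes f :: "'a::topological_space \<Rightarrow> real^'n^'n"
  shows "continuous_on S f \<Longrightarrow> continuous_on S (\<lambda>x. trace (f x))"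
  unfolding trace_def by (intro continuous_intros)

lemma continuous_power_sum[continuous_intros]:
  "continuous_on S f \<Longrightarrow> continuous_on S (\<lambda>x. power_sum k (f x))"
  unfolding power_sum_def by (intro continuous_intros)

lemma closed_sorted_vec: "closed {x :: 'a::topological_space. sorted_vec (f x)}" if "continuous_on UNIV f"
  unfolding sorted_vec_def using that
  by (intro closed_Collect_all closed_Collect_imp closed_Collect_le continuous_intros) auto

lemma power_sum_2_norm: "power_sum 2 x = (norm x)^2"
  unfolding power2_norm_eq_inner by (simp add: power_sum_def inner_vec_def power2_eq_square)

text \<open>The graph of the sorted eigenvalue vector is closed, since it is cut out by the closed conditions of being sorted and
having the traces of the matrix powers as power sums; the eigenvalues are locally bounded by the trace of the square.\<close>
lemma continuous_spectrum:
  fixes g :: "'a::euclidean_space \<Rightarrow> real^'n::{finite,linorder}^'n::{finite,linorder}"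
  assumes g: "continuous_on UNIV g" and sym: "\<And>y. transpose (g y) = g y"
  shows "continuous_on UNIV (\<lambda>y. spectrum (g y))"
proof -
  let ?t = "\<lambda>y. trace (matpow (g y) 2)"
  define U where "U R = {y. ?t y < R}" for R :: real
  have "continuous_on (U R) (\<lambda>y. spectrum (g y))" for R
  proof (rule continuous_on_subset[of "{y. ?t y \<le> R}"])
    show "U R \<subseteq> {y. ?t y \<le> R}" by (auto simp: U_def)
    show "continuous_on {y. ?t y \<le> R} (\<lambda>y. spectrum (g y))"
    proof (rule continuous_from_closed_graph)
      show "compact (cball (0::real^'n::{finite,linorder}) (sqrt R))" by simp
      show "(\<lambda>y. spectrum (g y)) \<in> {y. ?t y \<le> R} \<rightarrow> cball 0 (sqrt R)"
        using power_sum_spectrum[OF sym, of 2] by (intro funcsetI) (simp add: power_sum_2_norm real_le_rsqrt)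
      have "((\<lambda>y. (y, spectrum (g y))) ` {y. ?t y \<le> R}) =
        {p. ?t (fst p) \<le> R \<and> sorted_vec (snd p) \<and> (\<forall>k. power_sum k (snd p) = trace (matpow (g (fst p)) k))}"
        using spectrum[OF sym] power_sum_spectrum[OF sym] spectrum_eqI[OF sym] by (fastforce simp: image_iff)
      also have "closed \<dots>"
        by (intro closed_Collect_conj closed_Collect_all closed_Collect_le closed_Collect_eq closed_sorted_vec
           continuous_intros continuous_on_compose2[OF g]) auto
      finally show "closed ((\<lambda>y. (y, spectrum (g y))) ` {y. ?t y \<le> R})" .
    qed
  qed
  moreover have "open (U R)" for R unfolding U_def
    by (intro open_Collect_less continuous_intros g)
  ultimately have "continuous_on (\<Union>R\<in>UNIV. U R) (\<lambda>y. spectrum (g y))"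
    by (intro continuous_on_open_UN) auto
  moreover have "(\<Union>R\<in>UNIV. U R) = UNIV" by (auto simp: U_def intro: gt_ex)
  ultimately show ?thesis by simp
qed

lemma spectrum_nonneg:
  assumes "transpose A = A" and psd: "\<And>x. x \<bullet> (A *v x) \<ge> 0"
  shows "spectrum A $ i \<ge> 0"
proof -
  obtain Q d where Q: "orthogonal_matrix Q" and A: "A = Q ** diag_mat d ** transpose Q"
    using spectral_theorem[OF assms(1)] .
  have "d $ j \<ge> 0" for j
  proof -
    have "transpose Q *v (Q *v axis j 1) = axis j 1"
      using Q by (simp add: matrix_vector_mul_assoc orthogonal_matrix_def)
    then have "A *v (Q *v axis j 1) = Q *v (diag_mat d *v axis j 1)"
      by (simp add: A matrix_vector_mul_assoc[symmetric])
    also have "diag_mat d *v axis j 1 = d $ j *\<^sub>R axis j 1"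
      by (simp add: vec_eq_iff diag_mat_def matrix_vector_mult_def axis_def mult_delta_left mult_delta_right)
    finally have "(Q *v axis j 1) \<bullet> (A *v (Q *v axis j 1)) = d $ j * ((Q *v axis j 1) \<bullet> (Q *v axis j 1))"
      by (simp add: matrix_vector_mult_scaleR)
    also have "(Q *v axis j 1) \<bullet> (Q *v axis j 1) = (1::real)"
      unfolding inner_matrix_vector \<open>transpose Q *v (Q *v axis j 1) = axis j 1\<close> by (simp add: inner_axis_axis)
    finally show ?thesis using psd[of "Q *v axis j 1"] by simp
  qed
  moreover have "entries (spectrum A) = entries d"
    unfolding spectrum(2)[OF assms(1), symmetric]
    unfolding A eigenvalues_orthogonal_similar[OF Q] by (rule eigenvalues_diag)
  then obtain \<sigma> where "spectrum A = (\<chi> i. d $ \<sigma> i)" using entries_eq_permute by metis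
  ultimately show ?thesis by simp
qed

section \<open>Integration by parts and Gaussian integrals\<close>

text \<open>Integrating the derivative over a unit step in direction \<open>b\<close> gives \<open>H (y + b) - H y\<close>, whose integral is zero by
translation invariance. Finitely many exceptional points on each line are allowed because the absolute value of the
Vandermonde determinant is not differentiable where two entries meet.\<close>
lemma integral_directional_derivative_eq_0:
  fixes H D :: "'a::euclidean_space \<Rightarrow> real"
  assumes intH: "integrable lborel H" and intD: "integrable lborel D"
    and cont: "\<And>y. continuous_on UNIV (\<lambda>s. H (y + s *\<^sub>R b))"
    and deriv: "\<And>y. \<exists>F. finite F \<and> (\<forall>s. s \<notin> F \<longrightarrow>
      ((\<lambda>s. H (y + s *\<^sub>R b)) has_real_derivative D (y + s *\<^sub>R b)) (at s))"
  shows "integral\<^sup>L lborel D = 0"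
proof -
  have mD[measurable]: "D \<in> borel_measurable borel" and mH[measurable]: "H \<in> borel_measurable borel"
    using intD intH by auto
  have shift: "integrable lborel (\<lambda>y. f (y + c))" "(\<integral>y. f (y + c) \<partial>lborel) = integral\<^sup>L lborel f"
    if f: "integrable lborel f" for f :: "'a \<Rightarrow> real" and c
  proof -
    have [measurable]: "f \<in> borel_measurable borel" using f by auto
    have "integrable (distr lborel borel ((+) c)) f"
      using f by (simp add: lborel_distr_plus)
    then show "integrable lborel (\<lambda>y. f (y + c))"
      by (subst (asm) integrable_distr_eq) (auto simp: add.commute)
    have "integral\<^sup>L lborel f = integral\<^sup>L (distr lborel borel ((+) c)) f"
      by (simp add: lborel_distr_plus)
    also have "\<dots> = (\<integral>y. f (y + c) \<partial>lborel)"
      using integral_distr[of "(+) c" lborel borel f] by (simp add: add.commute)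
    finally show "(\<integral>y. f (y + c) \<partial>lborel) = integral\<^sup>L lborel f" by simp
  qed
  \<comment> \<open>Integrating over \<open>y\<close> first gives the integral of \<open>D\<close>, integrating over \<open>s\<close> first gives \<open>H (y + b) - H y\<close>.\<close>
  define G where "G = (\<lambda>(s::real, y). indicator {0..1} s * D (y + s *\<^sub>R b))"
  have [measurable]: "G \<in> borel_measurable (lborel \<Otimes>\<^sub>M lborel)"
    unfolding G_def by measurable
  have G1: "integrable lborel (\<lambda>y. G (s, y))" for s
    unfolding G_def by (auto intro: shift intD)
  have G2: "(\<integral>y. norm (G (s, y)) \<partial>lborel) = indicator {0..1} s * (\<integral>y. norm (D y) \<partial>lborel)" for s
    using shift(2)[of "\<lambda>y. norm (D y)" "s *\<^sub>R b"] intD by (simp add: G_def abs_mult)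
  have G3: "(\<integral>y. G (s, y) \<partial>lborel) = indicator {0..1} s * integral\<^sup>L lborel D" for s
    using shift(2)[OF intD, of "s *\<^sub>R b"] by (simp add: G_def)
  have "integrable lborel (\<lambda>s::real. indicator {0..1} s * (\<integral>y. norm (D y) \<partial>lborel))"
    by simp
  then have intG: "integrable (lborel \<Otimes>\<^sub>M lborel) G"
    by (intro lborel_pair.Fubini_integrable) (auto simp: G2 G1 simp del: real_norm_def)
  have G4: "AE y in lborel. integrable lborel (\<lambda>s. G (s, y))"
    using lborel_pair.AE_integrable_snd[OF intG[unfolded G_def]] by (simp add: G_def)
  have G5: "(\<integral>s. G (s, y) \<partial>lborel) = H (y + b) - H y" if "integrable lborel (\<lambda>s. G (s, y))" for y
  proof -
    obtain F where F: "finite F" "\<And>s. s \<notin> F \<Longrightarrow>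
      ((\<lambda>s. H (y + s *\<^sub>R b)) has_real_derivative D (y + s *\<^sub>R b)) (at s)"
      using deriv[of y] by blast
    have "((\<lambda>s. D (y + s *\<^sub>R b)) has_integral (H (y + 1 *\<^sub>R b) - H (y + 0 *\<^sub>R b))) {0..1}"
    proof (rule fundamental_theorem_of_calculus_interior_strong[OF F(1)])
      show "continuous_on {0..1} (\<lambda>s. H (y + s *\<^sub>R b))"
        using cont continuous_on_subset by blast
    qed (auto intro: F(2) simp flip: has_real_derivative_iff_has_vector_derivative)
    moreover have "((\<lambda>s. D (y + s *\<^sub>R b)) has_integral (\<integral>s. G (s, y) \<partial>lborel)) {0..1}"
    proof (subst has_integral_restrict_UNIV[symmetric])
      have "(\<lambda>s. if s \<in> {0..1} then D (y + s *\<^sub>R b) else 0) = (\<lambda>s. G (s, y))"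
        by (auto simp: G_def)
      then show "((\<lambda>s. if s \<in> {0..1} then D (y + s *\<^sub>R b) else 0) has_integral (\<integral>s. G (s, y) \<partial>lborel)) UNIV"
        by (simp only: has_integral_integral_lborel[OF that])
    qed
    ultimately have "H (y + 1 *\<^sub>R b) - H (y + 0 *\<^sub>R b) = (\<integral>s. G (s, y) \<partial>lborel)"
      by (rule has_integral_unique)
    then show ?thesis by simp
  qed
  have "integral\<^sup>L lborel D = integral\<^sup>L lborel (\<lambda>s::real. indicator {0..1} s * integral\<^sup>L lborel D)"
    by simp
  also have "\<dots> = (\<integral>s. (\<integral>y. G (s, y) \<partial>lborel) \<partial>lborel)"
    by (simp add: G3)
  also have "\<dots> = (\<integral>y. (\<integral>s. G (s, y) \<partial>lborel) \<partial>lborel)"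
    using lborel_pair.Fubini_integral[of "\<lambda>s y. G (s, y)"] intG by simp
  also have "\<dots> = (\<integral>y. H (y + b) - H y \<partial>lborel)"
    using G4 by (intro integral_cong_AE) (auto simp: G5)
  also have "\<dots> = 0"
    using shift[OF intH, of b] intH by (simp add: Bochner_Integration.integral_diff)
  finally show ?thesis .
qed

text \<open>The gauge \<open>W\<close> is the squared norm for Gaussian weights and the sum of the absolute values for exponential weights.\<close>
lemma real_polynomial_function_bound:
  fixes p :: "'a::real_normed_vector \<Rightarrow> real"
  assumes "real_polynomial_function p"
    and W: "\<And>e. e > 0 \<Longrightarrow> \<exists>C. \<forall>x. norm x \<le> C * exp (e * W x)" and W0: "\<And>x. 0 \<le> W x"
    and "e > 0"
  shows "\<exists>C. \<forall>x. \<bar>p x\<bar> \<le> C * exp (e * W x)"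
  using assms(1) \<open>e > 0\<close>
proof (induction arbitrary: e)
  case (linear f)
  obtain B where B: "B > 0" "\<And>x. norm (f x) \<le> norm x * B"
    using bounded_linear.pos_bounded[OF linear(1)] by blast
  obtain C where C: "\<And>x. norm x \<le> C * exp (e * W x)" using W[OF linear(2)] by blast
  have "\<bar>f x\<bar> \<le> (C * B) * exp (e * W x)" for x
    using B(2)[of x] mult_right_mono[OF C[of x], of B] B(1)
    by (auto simp: mult_ac intro: order_trans)
  then show ?case by blast
next
  case (const c)
  have "\<bar>c\<bar> \<le> \<bar>c\<bar> * exp (e * W x)" for x
    using const W0[of x] by (simp add: mult_left_le[of "\<bar>c\<bar>"] mult_le_cancel_left1)
  then show ?case by blast
next
  case (add f g)
  obtain C1 C2 where "\<And>x. \<bar>f x\<bar> \<le> C1 * exp (e * W x)" "\<And>x. \<bar>g x\<bar> \<le> C2 * exp (e * W x)"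
    using add by metis
  then have "\<bar>f x + g x\<bar> \<le> (C1 + C2) * exp (e * W x)" for x
    by (smt (verit, ccfv_SIG) distrib_right)
  then show ?case by blast
next
  case (mult f g)
  obtain C1 C2 where *: "\<And>x. \<bar>f x\<bar> \<le> C1 * exp (e/2 * W x)" "\<And>x. \<bar>g x\<bar> \<le> C2 * exp (e/2 * W x)"
    using mult by (metis half_gt_zero)
  have "\<bar>f x * g x\<bar> \<le> (C1 * exp (e/2 * W x)) * (C2 * exp (e/2 * W x))" for x
    unfolding abs_mult using *(1)[of x] *(2)[of x] by (intro mult_mono) (auto intro: order_trans[OF abs_ge_zero])
  moreover have "(C1 * exp (e/2 * W x)) * (C2 * exp (e/2 * W x)) = (C1 * C2) * exp (e * W x)" for x
    by (simp add: mult_ac flip: exp_add)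
  ultimately show ?case by metis
qed

lemma lborel_product_integral:
  fixes f :: "'a::euclidean_space \<Rightarrow> real \<Rightarrow> real"
  assumes "\<And>b. b \<in> Basis \<Longrightarrow> integrable lborel (f b)"
  shows "integrable lborel (\<lambda>x. \<Prod>b\<in>Basis. f b (x \<bullet> b))"
    and "(\<integral>x. (\<Prod>b\<in>Basis. f b (x \<bullet> b)) \<partial>lborel) = (\<Prod>b\<in>Basis. integral\<^sup>L lborel (f b))"
proof -
  interpret product_sigma_finite "\<lambda>_::'a. lborel :: real measure" ..
  have lb: "(lborel :: 'a measure) = distr (\<Pi>\<^sub>M b\<in>Basis. lborel) borel (\<lambda>f. \<Sum>b\<in>Basis. f b *\<^sub>R b)"
    by (rule lborel_eq)
  have [measurable]: "b \<in> Basis \<Longrightarrow> f b \<in> borel_measurable borel" for b using assms by auto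
  have eq: "(\<Prod>b\<in>Basis. f b ((\<Sum>b\<in>Basis. w b *\<^sub>R b) \<bullet> b)) = (\<Prod>b\<in>Basis. f b (w b))" for w
    by (intro prod.cong) auto
  show "integrable lborel (\<lambda>x. \<Prod>b\<in>Basis. f b (x \<bullet> b))"
    unfolding lb by (subst integrable_distr_eq) (auto simp: eq intro!: product_integrable_prod assms)
  show "(\<integral>x. (\<Prod>b\<in>Basis. f b (x \<bullet> b)) \<partial>lborel) = (\<Prod>b\<in>Basis. integral\<^sup>L lborel (f b))"
    unfolding lb by (subst integral_distr) (auto simp: eq intro!: product_integral_prod assms)
qed

lemma gaussian_integral_1:
  fixes \<beta> :: real assumes "\<beta> > 0"
  shows "integrable lborel (\<lambda>x::real. exp (- \<beta> * x^2))"
    and "(\<integral>x. exp (- \<beta> * x^2) \<partial>lborel) = sqrt (pi / \<beta>)"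
proof -
  define s where "s = sqrt (1 / (2 * \<beta>))"
  have s: "s > 0" "s^2 = 1/(2*\<beta>)" using assms by (auto simp: s_def)
  have eq: "exp (- \<beta> * x^2) = sqrt (pi / \<beta>) * normal_density 0 s x" for x
    using assms by (simp add: normal_density_def s(2) real_sqrt_divide)
  show "integrable lborel (\<lambda>x::real. exp (- \<beta> * x^2))"
    unfolding eq by (intro integrable_mult_right integrable_normal_density s)
  show "(\<integral>x. exp (- \<beta> * x^2) \<partial>lborel) = sqrt (pi / \<beta>)"
    unfolding eq using integral_normal_density[OF s(1)] by simp
qed

lemma gaussian_prod: "exp (- \<beta> * (x \<bullet> x)) = (\<Prod>b\<in>Basis. exp (- \<beta> * (x \<bullet> b)^2))"
  for x :: "'a::euclidean_space"
  by (subst euclidean_inner) (simp add: exp_sum[symmetric] sum_distrib_left power2_eq_square sum_negf)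

lemma gaussian_integral:
  fixes \<beta> :: real assumes "\<beta> > 0"
  shows "integrable lborel (\<lambda>x::'a::euclidean_space. exp (- \<beta> * (x \<bullet> x)))"
    and "integral\<^sup>L lborel (\<lambda>x::'a. exp (- \<beta> * (x \<bullet> x))) = sqrt (pi / \<beta>) ^ DIM('a)"
  unfolding gaussian_prod
  using lborel_product_integral[of "\<lambda>_::'a. \<lambda>x. exp (- \<beta> * x^2)"] gaussian_integral_1[OF assms]
  by auto

lemma gaussian_polynomial_integrable:
  fixes p :: "'a::euclidean_space \<Rightarrow> real"
  assumes p: "real_polynomial_function p" and "\<beta> > 0"
  shows "integrable lborel (\<lambda>x. p x * exp (- \<beta> * (x \<bullet> x)))"
proof -
  have W: "\<exists>C. \<forall>x::'a. norm x \<le> C * exp (e * (x \<bullet> x))" if "e > 0" for e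
  proof -
    have "norm x \<le> (1 + 1/e) * exp (e * (x \<bullet> x))" for x :: 'a
    proof -
      have "norm x \<le> 1 + x \<bullet> x"
      proof -
        have "2 * norm x \<le> 1 + (norm x)\<^sup>2"
          using zero_le_power2[of "norm x - 1"] unfolding power2_diff by simp
        moreover have "norm x \<le> 2 * norm x" by simp
        ultimately show ?thesis unfolding power2_norm_eq_inner[symmetric] by linarith
      qed
      also have "\<dots> \<le> exp (e * (x \<bullet> x)) + (1/e) * exp (e * (x \<bullet> x))"
      proof (rule add_mono)
        show "1 \<le> exp (e * (x \<bullet> x))" using that by simp
        have "e * (x \<bullet> x) \<le> exp (e * (x \<bullet> x))" using exp_ge_add_one_self[of "e * (x \<bullet> x)"] by linarith
        then show "x \<bullet> x \<le> (1/e) * exp (e * (x \<bullet> x))" using that by (simp add: field_simps)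
      qed
      finally show ?thesis by (simp add: algebra_simps)
    qed
    then show ?thesis by blast
  qed
  obtain C where C: "\<And>x. \<bar>p x\<bar> \<le> C * exp (\<beta>/2 * (x \<bullet> x))"
    using real_polynomial_function_bound[OF p, of "\<lambda>x. x \<bullet> x" "\<beta>/2"] W \<open>\<beta> > 0\<close> by auto
  have [measurable]: "p \<in> borel_measurable borel"
    using p by (intro borel_measurable_continuous_onI continuous_on_polymonial_function)
       (simp add: real_polynomial_function_eq)
  show ?thesis
  proof (rule Bochner_Integration.integrable_bound)
    show "integrable lborel (\<lambda>x::'a. C * exp (- (\<beta>/2) * (x \<bullet> x)))"
      by (intro integrable_mult_right gaussian_integral) (use \<open>\<beta> > 0\<close> in auto)
    have "\<bar>p x\<bar> * exp (- \<beta> * (x \<bullet> x)) \<le> C * exp (- (\<beta>/2) * (x \<bullet> x))" for x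
    proof -
      have "\<bar>p x\<bar> * exp (- \<beta> * (x \<bullet> x)) \<le> C * exp (\<beta>/2 * (x \<bullet> x)) * exp (- \<beta> * (x \<bullet> x))"
        by (intro mult_right_mono C) auto
      also have "\<dots> = C * exp (- (\<beta>/2) * (x \<bullet> x))" by (simp add: field_simps flip: exp_add)
      finally show ?thesis .
    qed
    then show "AE x in lborel. norm (p x * exp (- \<beta> * (x \<bullet> x))) \<le> norm (C * exp (- (\<beta>/2) * (x \<bullet> x)))"
      by (intro AE_I2) (simp add: abs_mult, metis abs_ge_self abs_mult abs_exp_cancel order_trans)
  qed simp
qed

section \<open>Loop equations for a Gaussian matrix\<close>

definition has_matrix_derivative :: "(real \<Rightarrow> real^'n^'m) \<Rightarrow> real^'n^'m \<Rightarrow> real \<Rightarrow> bool" where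
  "has_matrix_derivative f f' s \<longleftrightarrow> (\<forall>i j. ((\<lambda>s. f s $ i $ j) has_real_derivative f' $ i $ j) (at s))"

definition matrix_polynomial :: "('a::real_normed_vector \<Rightarrow> real^'n^'m) \<Rightarrow> bool" where
  "matrix_polynomial f \<longleftrightarrow> (\<forall>i j. real_polynomial_function (\<lambda>x. f x $ i $ j))"

lemma has_matrix_derivative_mult:
  assumes "has_matrix_derivative f f' s" "has_matrix_derivative g g' s"
  shows "has_matrix_derivative (\<lambda>s. f s ** g s) (f' ** g s + f s ** g') s"
  unfolding has_matrix_derivative_def
proof (intro allI)
  fix i j
  have "((\<lambda>s. \<Sum>k\<in>UNIV. f s $ i $ k * g s $ k $ j) has_real_derivative
     (\<Sum>k\<in>UNIV. f' $ i $ k * g s $ k $ j + g' $ k $ j * f s $ i $ k)) (at s)"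
    using assms by (intro DERIV_sum DERIV_mult) (auto simp: has_matrix_derivative_def)
  then show "((\<lambda>s. (f s ** g s) $ i $ j) has_real_derivative (f' ** g s + f s ** g') $ i $ j) (at s)"
    by (simp add: matrix_matrix_mult_def sum.distrib mult.commute)
qed

lemma has_matrix_derivative_transpose:
  "has_matrix_derivative f f' s \<Longrightarrow> has_matrix_derivative (\<lambda>s. transpose (f s)) (transpose f') s"
  by (simp add: has_matrix_derivative_def transpose_def)

lemma has_derivative_trace:
  "has_matrix_derivative f f' s \<Longrightarrow> ((\<lambda>s. trace (f s)) has_real_derivative trace f') (at s)"
  unfolding trace_def by (intro DERIV_sum) (simp add: has_matrix_derivative_def)

text \<open>The derivative of the \<open>k\<close>-th matrix power at \<open>A\<close> in direction \<open>H\<close>.\<close>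
primrec matpow_deriv :: "real^'n^'n \<Rightarrow> real^'n^'n \<Rightarrow> nat \<Rightarrow> real^'n^'n" where
  "matpow_deriv A H 0 = 0"
| "matpow_deriv A H (Suc k) = H ** matpow A k + A ** matpow_deriv A H k"

lemma has_matrix_derivative_matpow:
  assumes "has_matrix_derivative f H s"
  shows "has_matrix_derivative (\<lambda>s. matpow (f s) k) (matpow_deriv (f s) H k) s"
proof (induction k)
  case 0 then show ?case by (simp add: has_matrix_derivative_def)
next
  case (Suc k) then show ?case using has_matrix_derivative_mult[OF assms Suc] by simp
qed

lemma matrix_add_mult_distrib: "(A + B) ** C = A ** C + B ** C" for A B :: "real^'n^'m" and C :: "real^'k^'n"
  by (simp add: matrix_matrix_mult_def vec_eq_iff distrib_right sum.distrib)

lemma matrix_sum_right: "A ** (\<Sum>a\<in>I. F a) = (\<Sum>a\<in>I. A ** F a)" for A :: "real^'n^'m" and F :: "'b \<Rightarrow> real^'k^'n"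
  by (induction I rule: infinite_finite_induct) (auto simp: matrix_add_ldistrib)

lemma matrix_sum_left: "(\<Sum>a\<in>I. F a) ** A = (\<Sum>a\<in>I. F a ** A)" for A :: "real^'n^'m" and F :: "'b \<Rightarrow> real^'m^'k"
  by (induction I rule: infinite_finite_induct) (auto simp: matrix_add_mult_distrib)

lemma matpow_add: "matpow A a ** matpow A b = matpow A (a + b)"
  by (induction a) (simp_all add: matrix_mul_assoc[symmetric])

lemma matpow_deriv_eq: "matpow_deriv A H k = (\<Sum>a<k. matpow A a ** H ** matpow A (k - Suc a))"
proof (induction k)
  case (Suc k)
  have "matpow_deriv A H (Suc k) = H ** matpow A k + (\<Sum>a<k. matpow A (Suc a) ** H ** matpow A (Suc k - Suc (Suc a)))"
    by (simp add: Suc matrix_sum_right matrix_mul_assoc)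
  also have "\<dots> = (\<Sum>a<Suc k. matpow A a ** H ** matpow A (Suc k - Suc a))"
    by (subst sum.lessThan_Suc_shift) simp
  finally show ?case .
qed simp

lemma trace_sum: "trace (\<Sum>a\<in>I. F a) = (\<Sum>a\<in>I. trace (F a))" for F :: "'b \<Rightarrow> real^'n^'n"
  by (induction I rule: infinite_finite_induct) (auto simp: trace_add trace_0[simplified])

lemma trace_matpow_deriv: "trace (matpow_deriv A H k) = real k * trace (matpow A (k - 1) ** H)" for H :: "real^'n^'n"
proof -
  have "trace (matpow A a ** H ** matpow A (k - Suc a)) = trace (matpow A (k - 1) ** H)" if "a < k" for a
  proof -
    have "trace (matpow A a ** H ** matpow A (k - Suc a)) = trace (matpow A (k - Suc a) ** (matpow A a ** H))"
      by (rule trace_mul_sym)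
    also have "\<dots> = trace (matpow A (k - 1) ** H)"
      using that by (simp add: matrix_mul_assoc matpow_add)
    finally show ?thesis .
  qed
  then show ?thesis by (simp add: matpow_deriv_eq trace_sum)
qed

lemma matrix_unit_right:
  fixes U :: "real^'n^'p"
  shows "(U ** axis i (axis j 1)) $ p $ l = (if l = j then U $ p $ i else 0)"
  by (simp add: matrix_matrix_mult_def axis_def if_distrib[of "\<lambda>z. z $ l"] mult_delta_right cong: if_cong)

lemma matrix_unit_sandwich:
  fixes U :: "real^'n^'p" and V :: "real^'q^'m"
  shows "(U ** axis i (axis j 1) ** V) $ p $ q = U $ p $ i * V $ j $ q"
  by (subst matrix_matrix_mult_def) (simp add: matrix_unit_right mult_delta_left)

lemma transpose_matrix_unit: "transpose (axis i (axis j 1) :: real^'m^'n) = axis j (axis i 1)"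
  by (auto simp: vec_eq_iff transpose_def axis_def)

lemma trace_inner: "(\<Sum>i\<in>UNIV. \<Sum>j\<in>UNIV. U $ i $ j * V $ i $ j) = trace (U ** transpose V)"
  by (simp add: trace_def matrix_matrix_mult_def transpose_def)

lemma transpose_matpow: "transpose A = A \<Longrightarrow> transpose (matpow A k) = matpow A k"
proof (induction k)
  case (Suc k)
  have "matpow A k ** A = A ** matpow A k" using matpow_add[of A k 1] matpow_add[of A 1 k] by simp
  then show ?case using Suc by (simp add: matrix_transpose_mul)
qed (simp add: transpose_mat)

abbreviation gram :: "real^'m^'n \<Rightarrow> real^'n^'n" where
  "gram X \<equiv> X ** transpose X"

lemma transpose_gram[simp]: "transpose (gram X) = gram X"
  by (simp add: matrix_transpose_mul)

text \<open>The derivative of \<open>gram\<close> in the direction of the matrix unit at \<open>(i, j)\<close>.\<close>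
abbreviation gram_dir :: "real^'m^'n \<Rightarrow> 'n \<Rightarrow> 'm \<Rightarrow> real^'n^'n" where
  "gram_dir X i j \<equiv> axis i (axis j 1) ** transpose X + X ** axis j (axis i 1)"

lemma sum_matpow_inner:
  "(\<Sum>i\<in>UNIV. \<Sum>j\<in>UNIV. (matpow (gram X) a ** X) $ i $ j * (matpow (gram X) c ** X) $ i $ j) = trace (matpow (gram X) (Suc (a + c)))"
proof -
  have "trace (matpow (gram X) a ** X ** transpose (matpow (gram X) c ** X)) = trace (matpow (gram X) a ** matpow (gram X) 1 ** matpow (gram X) c)"
    by (simp add: matrix_transpose_mul transpose_matpow matrix_mul_assoc)
  then show ?thesis unfolding trace_inner matpow_add by simp
qed

text \<open>The left side is the divergence of the vector field \<open>X \<mapsto> (X X\<^sup>T)\<^sup>k X\<close>. Each of the \<open>k\<close> factors \<open>X X\<^sup>T\<close> is differentiated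
in two places, which produces a product of two traces from the factor \<open>X\<close> and a single trace from the factor
\<open>X\<^sup>T\<close>; differentiating the last factor \<open>X\<close> contributes the number of columns.\<close>
lemma sum_matpow_deriv_diag:
  fixes X :: "real^'m^'n"
  shows "(\<Sum>i\<in>UNIV. \<Sum>j\<in>UNIV. (matpow_deriv (gram X) (gram_dir X i j) k ** X + matpow (gram X) k ** axis i (axis j 1)) $ i $ j)
   = (real k + (real CARD('m) - real CARD('n))) * trace (matpow (gram X) k)
     + (\<Sum>r\<le>k. trace (matpow (gram X) r) * trace (matpow (gram X) (k - r)))"
proof -
  let ?A = "gram X" and ?t = "\<lambda>r. trace (matpow (gram X) r)"
  have comp: "(matpow ?A a ** gram_dir X i j ** matpow ?A c ** X) $ i $ j =
     matpow ?A a $ i $ i * (transpose X ** matpow ?A c ** X) $ j $ j + (matpow ?A a ** X) $ i $ j * (matpow ?A c ** X) $ i $ j" for a c i j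
  proof -
    have "matpow ?A a ** gram_dir X i j ** matpow ?A c ** X =
      matpow ?A a ** axis i (axis j 1) ** (transpose X ** matpow ?A c ** X) + matpow ?A a ** X ** axis j (axis i 1) ** (matpow ?A c ** X)"
      by (simp add: matrix_add_ldistrib matrix_add_mult_distrib matrix_mul_assoc)
    then show ?thesis by (simp add: matrix_unit_sandwich)
  qed
  have 1: "(\<Sum>i\<in>UNIV. \<Sum>j\<in>UNIV. (matpow ?A a ** gram_dir X i j ** matpow ?A (k - Suc a) ** X) $ i $ j) = ?t a * ?t (k - a) + ?t k"
    if "a < k" for a
  proof -
    have "trace (transpose X ** matpow ?A (k - Suc a) ** X) = trace (X ** (transpose X ** matpow ?A (k - Suc a)))"
      by (rule trace_mul_sym)
    also have "\<dots> = trace (matpow ?A (Suc (k - Suc a)))" by (simp add: matrix_mul_assoc)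
    finally have "(\<Sum>i\<in>UNIV. \<Sum>j\<in>UNIV. matpow ?A a $ i $ i * (transpose X ** matpow ?A (k - Suc a) ** X) $ j $ j) = ?t a * ?t (k - a)"
      using that by (simp add: trace_def[of "matpow ?A a"] trace_def[of "transpose X ** matpow ?A (k - Suc a) ** X", symmetric]
         sum_distrib_left[symmetric] sum_distrib_right[symmetric] Suc_diff_Suc del: matpow.simps)
    then show ?thesis unfolding comp sum.distrib sum_matpow_inner using that by simp
  qed
  have "(\<Sum>i\<in>UNIV. \<Sum>j\<in>UNIV. (matpow_deriv ?A (gram_dir X i j) k ** X) $ i $ j) =
     (\<Sum>i\<in>UNIV. \<Sum>j\<in>UNIV. \<Sum>a<k. (matpow ?A a ** gram_dir X i j ** matpow ?A (k - Suc a) ** X) $ i $ j)"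
    by (simp add: matpow_deriv_eq matrix_sum_left)
  also have "\<dots> = (\<Sum>i\<in>UNIV. \<Sum>a<k. \<Sum>j\<in>UNIV. (matpow ?A a ** gram_dir X i j ** matpow ?A (k - Suc a) ** X) $ i $ j)"
    by (intro sum.cong refl sum.swap)
  also have "\<dots> = (\<Sum>a<k. \<Sum>i\<in>UNIV. \<Sum>j\<in>UNIV. (matpow ?A a ** gram_dir X i j ** matpow ?A (k - Suc a) ** X) $ i $ j)"
    by (rule sum.swap)
  also have "\<dots> = (\<Sum>a<k. ?t a * ?t (k - a)) + real k * ?t k"
    using 1 by (simp add: sum.distrib)
  finally have 2: "(\<Sum>i\<in>UNIV. \<Sum>j\<in>UNIV. (matpow_deriv ?A (gram_dir X i j) k ** X) $ i $ j) = (\<Sum>a<k. ?t a * ?t (k - a)) + real k * ?t k" .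
  have "(matpow ?A k ** axis i (axis j 1)) $ i $ j = matpow ?A k $ i $ i" for i and j :: 'm
    by (simp add: matrix_unit_right)
  then have 3: "(\<Sum>i\<in>UNIV. \<Sum>j\<in>(UNIV::'m set). (matpow ?A k ** axis i (axis j 1)) $ i $ j) = real CARD('m) * ?t k"
    by (simp add: trace_def sum_distrib_left)
  have "(\<Sum>r\<le>k. ?t r * ?t (k - r)) = (\<Sum>a<k. ?t a * ?t (k - a)) + ?t k * real CARD('n)"
    by (simp add: lessThan_Suc_atMost[symmetric] trace_I)
  then show ?thesis using 2 3 by (simp add: sum.distrib algebra_simps)
qed

lemma matrix_polynomial_mult: "matrix_polynomial f \<Longrightarrow> matrix_polynomial g \<Longrightarrow> matrix_polynomial (\<lambda>x. f x ** g x)"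
  by (auto simp: matrix_polynomial_def matrix_matrix_mult_def
      intro!: real_polynomial_function_sum real_polynomial_function.intros(4))

lemma matrix_polynomial_add: "matrix_polynomial f \<Longrightarrow> matrix_polynomial g \<Longrightarrow> matrix_polynomial (\<lambda>x. f x + g x)"
  by (auto simp: matrix_polynomial_def intro!: real_polynomial_function.intros(3))

lemma matrix_polynomial_const: "matrix_polynomial (\<lambda>x. C)"
  by (auto simp: matrix_polynomial_def)

lemma matrix_polynomial_id: "matrix_polynomial (\<lambda>x::real^'m^'n. x)"
  by (auto simp: matrix_polynomial_def intro!: real_polynomial_function.intros(1) bounded_linear_vec_nth
       bounded_linear_compose[OF bounded_linear_vec_nth])

lemma matrix_polynomial_transpose: "matrix_polynomial f \<Longrightarrow> matrix_polynomial (\<lambda>x. transpose (f x))"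
  by (simp add: matrix_polynomial_def transpose_def)

lemma matrix_polynomial_matpow: "matrix_polynomial f \<Longrightarrow> matrix_polynomial (\<lambda>x. matpow (f x) k)"
  by (induction k) (auto intro: matrix_polynomial_mult matrix_polynomial_const)

lemma matrix_polynomial_matpow_deriv:
  "matrix_polynomial f \<Longrightarrow> matrix_polynomial h \<Longrightarrow> matrix_polynomial (\<lambda>x. matpow_deriv (f x) (h x) k)"
  by (induction k) (auto intro!: matrix_polynomial_mult matrix_polynomial_const matrix_polynomial_add matrix_polynomial_matpow)

lemma real_polynomial_trace: "matrix_polynomial f \<Longrightarrow> real_polynomial_function (\<lambda>x. trace (f x))"
  unfolding trace_def by (auto simp: matrix_polynomial_def intro!: real_polynomial_function_sum)

lemma real_polynomial_entry: "matrix_polynomial f \<Longrightarrow> real_polynomial_function (\<lambda>x. f x $ i $ j)"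
  by (simp add: matrix_polynomial_def)

lemmas polynomial_intros =
  matrix_polynomial_mult matrix_polynomial_const matrix_polynomial_add matrix_polynomial_matpow
  matrix_polynomial_id matrix_polynomial_transpose matrix_polynomial_matpow_deriv real_polynomial_trace real_polynomial_entry
  real_polynomial_function.intros(2-4) real_polynomial_function_power real_polynomial_function_diff real_polynomial_function_sum

text \<open>The coordinate \<open>(i, j)\<close> of the vector field \<open>X \<mapsto> (X X\<^sup>T)\<^sup>k X\<close>, multiplied by a product of traces and a Gaussian.\<close>
lemma gaussian_integration_by_parts:
  fixes ks :: "nat list" and k :: nat and i :: "'n::finite" and j :: "'m::finite"
  assumes \<beta>: "\<beta> > 0"
  defines "P \<equiv> \<lambda>X::real^'m^'n. prod_over (\<lambda>m. trace (matpow (gram X) m)) ks"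
    and "dP \<equiv> \<lambda>X::real^'m^'n. prod_over_deriv (\<lambda>m. trace (matpow (gram X) m)) (\<lambda>m. trace (matpow_deriv (gram X) (gram_dir X i j) m)) ks"
  defines "D \<equiv> \<lambda>X. ((matpow_deriv (gram X) (gram_dir X i j) k ** X + matpow (gram X) k ** axis i (axis j 1)) $ i $ j * P X
       + (matpow (gram X) k ** X) $ i $ j * dP X - 2 * \<beta> * X $ i $ j * (matpow (gram X) k ** X) $ i $ j * P X) * exp (- \<beta> * (X \<bullet> X))"
  shows "integrable lborel D" "integral\<^sup>L lborel D = 0"
proof -
  have polyP: "real_polynomial_function P" unfolding P_def by (intro real_polynomial_prod_over polynomial_intros)
  have polydP: "real_polynomial_function dP" unfolding dP_def by (intro real_polynomial_prod_over_deriv polynomial_intros)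
  show "integrable lborel D"
    unfolding D_def by (intro gaussian_polynomial_integrable polynomial_intros \<beta> polyP polydP)
  let ?E = "axis i (axis j 1) :: real^'m^'n"
  let ?H = "\<lambda>X. ((matpow (gram X) k ** X) $ i $ j * P X) * exp (- \<beta> * (X \<bullet> X))"
  have der: "((\<lambda>s. ?H (Y + s *\<^sub>R ?E)) has_real_derivative D (Y + s *\<^sub>R ?E)) (at s)" for Y s
  proof -
    let ?Z = "\<lambda>s. Y + s *\<^sub>R ?E"
    define X where X: "X = ?Z s"
    have Z: "has_matrix_derivative ?Z ?E s"
      unfolding has_matrix_derivative_def by (auto intro!: derivative_eq_intros)
    have G: "has_matrix_derivative (\<lambda>s. gram (?Z s)) (gram_dir X i j) s"
      using has_matrix_derivative_mult[OF Z has_matrix_derivative_transpose[OF Z]]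
      by (simp add: X transpose_matrix_unit)
    note G' = has_matrix_derivative_matpow[OF G, folded X]
    have 1: "((\<lambda>s. (matpow (gram (?Z s)) k ** ?Z s) $ i $ j) has_real_derivative
        (matpow_deriv (gram X) (gram_dir X i j) k ** X + matpow (gram X) k ** ?E) $ i $ j) (at s)"
      using has_matrix_derivative_mult[OF G' Z] by (simp only: has_matrix_derivative_def X)
    have 2: "((\<lambda>s. P (?Z s)) has_real_derivative dP X) (at s)"
      unfolding P_def dP_def X by (rule has_real_derivative_prod_over) (rule has_derivative_trace[OF G'[unfolded X]])
    have "((\<lambda>s. (?Z s \<bullet> ?Z s)) has_real_derivative 2 * X $ i $ j) (at s)"
      by (auto intro!: derivative_eq_intros simp: X inner_add inner_axis inner_axis' algebra_simps inner_commute)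
    then have 3: "((\<lambda>s. exp (- \<beta> * (?Z s \<bullet> ?Z s))) has_real_derivative exp (- \<beta> * (X \<bullet> X)) * (- \<beta> * (2 * X $ i $ j))) (at s)"
      unfolding X by (intro DERIV_fun_exp DERIV_cmult)
    show ?thesis
      using DERIV_mult[OF DERIV_mult[OF 1 2] 3] by (simp add: D_def X algebra_simps)
  qed
  show "integral\<^sup>L lborel D = 0"
  proof (rule integral_directional_derivative_eq_0[where b="?E" and H="?H"])
    show "integrable lborel ?H"
      by (intro gaussian_polynomial_integrable polynomial_intros \<beta> polyP)
    show "integrable lborel D" by fact
    fix Y
    show "continuous_on UNIV (\<lambda>s. ?H (Y + s *\<^sub>R ?E))"
      using der by (intro continuous_at_imp_continuous_on) (blast intro: DERIV_isCont)
    show "\<exists>F. finite F \<and> (\<forall>s. s \<notin> F \<longrightarrow> ((\<lambda>s. ?H (Y + s *\<^sub>R ?E)) has_real_derivative D (Y + s *\<^sub>R ?E)) (at s))"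
      using der by (intro exI[of _ "{}"]) auto
  qed
qed

definition gauss_moment :: "'m::finite itself \<Rightarrow> 'n::finite itself \<Rightarrow> real \<Rightarrow> nat list \<Rightarrow> real" where
  "gauss_moment TM TN \<beta> ks = integral\<^sup>L lborel (\<lambda>X::real^'m::finite^'n::finite. prod_over (\<lambda>m. trace (matpow (gram X) m)) ks * exp (- \<beta> * (X \<bullet> X)))"

lemma real_polynomial_prod_over_gram: "real_polynomial_function (\<lambda>X. prod_over (\<lambda>m. trace (matpow (gram X) m)) ks)"
  by (intro real_polynomial_prod_over polynomial_intros)

text \<open>Summation over all coordinates turns the three terms of the integration by parts into the divergence of the vector field, the derivative of
the product of traces along it, and the trace of the next power, which comes from the Gaussian.\<close>
lemma gauss_loop_equations:
  assumes \<beta>: "\<beta> > 0"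
  shows "loop_equations (real CARD('n)) (real CARD('m) - real CARD('n)) (2 * \<beta>) (gauss_moment TYPE('m::finite) TYPE('n::finite) \<beta>)"
proof -
  let ?T = "\<lambda>(X::real^'m^'n) m. trace (matpow (gram X) m)"
  have "loop_equations (real CARD('n)) (real CARD('m) - real CARD('n)) (2 * \<beta>)
    (\<lambda>ks. integral\<^sup>L lborel (\<lambda>X::real^'m^'n. prod_over (?T X) ks * exp (- \<beta> * (X \<bullet> X))))"
  proof (rule loop_equationsI)
    show "integrable lborel (\<lambda>X::real^'m^'n. prod_over (?T X) ks * exp (- \<beta> * (X \<bullet> X)))" for ks
      by (intro gaussian_polynomial_integrable real_polynomial_prod_over_gram \<beta>)
    show "?T X 0 = real CARD('n)" for X by (simp add: trace_I)
    fix k ks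
    define D where "D i j X = ((matpow_deriv (gram X) (gram_dir X i j) k ** X + matpow (gram X) k ** axis i (axis j 1)) $ i $ j * prod_over (?T X) ks
         + (matpow (gram X) k ** X) $ i $ j * prod_over_deriv (?T X) (\<lambda>m. trace (matpow_deriv (gram X) (gram_dir X i j) m)) ks
         - 2 * \<beta> * X $ i $ j * (matpow (gram X) k ** X) $ i $ j * prod_over (?T X) ks) * exp (- \<beta> * (X \<bullet> X))" for i :: 'n and j :: 'm and X
    have D: "integrable lborel (D i j)" "integral\<^sup>L lborel (D i j) = 0" for i j
      using gaussian_integration_by_parts[OF \<beta>, where k=k and i=i and j=j and ks=ks] by (simp_all add: D_def[abs_def])
    define R where "R X = ((real k + (real CARD('m) - real CARD('n))) * prod_over (?T X) (k # ks) + (\<Sum>r\<le>k. prod_over (?T X) (r # (k - r) # ks))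
       + 2 * (\<Sum>(q, l)\<leftarrow>shifted_terms (Suc k) ks. q * prod_over (?T X) l) - 2 * \<beta> * prod_over (?T X) (Suc k # ks)) * exp (- \<beta> * (X \<bullet> X))" for X :: "real^'m^'n"
    have DR: "(\<Sum>i\<in>UNIV. \<Sum>j\<in>UNIV. D i j X) = R X" for X
    proof -
      let ?A = "matpow (gram X) k ** X"
      have tr: "trace (matpow_deriv (gram X) (gram_dir X i j) m) = 2 * real m * (matpow (gram X) (m - 1) ** X) $ i $ j" for i j m
      proof -
        have a: "trace (matpow (gram X) l ** axis i (axis j 1) ** transpose X) = (matpow (gram X) l ** X) $ i $ j" for l
        proof -
          have "trace (matpow (gram X) l ** axis i (axis j 1) ** transpose X) = (\<Sum>p\<in>UNIV. X $ p $ j * matpow (gram X) l $ p $ i)"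
            by (simp add: trace_def matrix_unit_sandwich transpose_def mult.commute)
          also have "\<dots> = (transpose (matpow (gram X) l) ** X) $ i $ j"
            by (simp add: matrix_matrix_mult_def transpose_def mult.commute)
          finally show ?thesis by (simp add: transpose_matpow)
        qed
        have b: "trace (matpow (gram X) l ** X ** axis j (axis i 1)) = (matpow (gram X) l ** X) $ i $ j" for l
          by (simp add: trace_def matrix_unit_right)
        show ?thesis
          unfolding trace_matpow_deriv matrix_add_ldistrib trace_add matrix_mul_assoc a b by simp
      qed
      have 1: "(\<Sum>i\<in>UNIV. \<Sum>j\<in>UNIV. ?A $ i $ j * prod_over_deriv (?T X) (\<lambda>m. trace (matpow_deriv (gram X) (gram_dir X i j) m)) ks)
         = 2 * (\<Sum>(q, l)\<leftarrow>shifted_terms (Suc k) ks. q * prod_over (?T X) l)"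
      proof -
        have s: "(\<Sum>p\<in>UNIV \<times> UNIV. ?A $ fst p $ snd p * (2 * real m * (matpow (gram X) (m - 1) ** X) $ fst p $ snd p)) =
            2 * (real m * ?T X (Suc k + m - 1))" for m
        proof -
          have "(\<Sum>p\<in>UNIV \<times> UNIV. ?A $ fst p $ snd p * (2 * real m * (matpow (gram X) (m - 1) ** X) $ fst p $ snd p)) =
            2 * real m * (\<Sum>i\<in>UNIV. \<Sum>j\<in>UNIV. ?A $ i $ j * (matpow (gram X) (m - 1) ** X) $ i $ j)"
            unfolding sum.cartesian_product sum_distrib_left by (intro sum.cong) auto
          also have "\<dots> = 2 * (real m * ?T X (Suc k + m - 1))"
            unfolding sum_matpow_inner by (cases m) auto
          finally show ?thesis .
        qed
        have "(\<Sum>i\<in>UNIV. \<Sum>j\<in>UNIV. ?A $ i $ j * prod_over_deriv (?T X) (\<lambda>m. trace (matpow_deriv (gram X) (gram_dir X i j) m)) ks)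
          = (\<Sum>p\<in>UNIV \<times> UNIV. ?A $ fst p $ snd p * prod_over_deriv (?T X) (\<lambda>m. 2 * real m * (matpow (gram X) (m - 1) ** X) $ fst p $ snd p) ks)"
          unfolding tr sum.cartesian_product by (intro sum.cong) auto
        also have "\<dots> = prod_over_deriv (?T X) (\<lambda>m. 2 * (real m * ?T X (Suc k + m - 1))) ks"
          unfolding prod_over_deriv_sum s ..
        finally show ?thesis unfolding prod_over_deriv_cmult[symmetric] prod_over_deriv_shifted_terms[of "?T X" "Suc k" ks] .
      qed
      have 2: "(\<Sum>i\<in>UNIV. \<Sum>j\<in>UNIV. X $ i $ j * ?A $ i $ j) = ?T X (Suc k)"
        using sum_matpow_inner[of X 0 k] by simp
      have 4: "(\<Sum>r\<le>k. prod_over (?T X) (r # (k - r) # ks)) = (\<Sum>r\<le>k. ?T X r * ?T X (k - r)) * prod_over (?T X) ks"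
        by (simp add: sum_distrib_right mult.assoc)
      have "(\<Sum>i\<in>UNIV. \<Sum>j\<in>UNIV. D i j X) =
        ((\<Sum>i\<in>UNIV. \<Sum>j\<in>UNIV. (matpow_deriv (gram X) (gram_dir X i j) k ** X + matpow (gram X) k ** axis i (axis j 1)) $ i $ j) * prod_over (?T X) ks
         + (\<Sum>i\<in>UNIV. \<Sum>j\<in>UNIV. ?A $ i $ j * prod_over_deriv (?T X) (\<lambda>m. trace (matpow_deriv (gram X) (gram_dir X i j) m)) ks)
         - 2 * \<beta> * (\<Sum>i\<in>UNIV. \<Sum>j\<in>UNIV. X $ i $ j * ?A $ i $ j) * prod_over (?T X) ks) * exp (- \<beta> * (X \<bullet> X))"
        unfolding D_def sum_distrib_left sum_distrib_right sum.distrib[symmetric] sum_subtractf[symmetric]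
        by (intro sum.cong refl) (simp add: algebra_simps)
      also have "\<dots> = R X"
        unfolding 1 2 sum_matpow_deriv_diag R_def 4 by (simp add: algebra_simps)
      finally show ?thesis .
    qed
    have "integral\<^sup>L lborel R = (\<Sum>i\<in>UNIV. \<Sum>j\<in>UNIV. integral\<^sup>L lborel (D i j))"
      unfolding DR[symmetric] using D(1) by (simp add: Bochner_Integration.integral_sum)
    then show "integral\<^sup>L lborel (\<lambda>X. ((real k + (real CARD('m) - real CARD('n))) * prod_over (?T X) (k # ks) + (\<Sum>r\<le>k. prod_over (?T X) (r # (k - r) # ks))
       + 2 * (\<Sum>(q, l)\<leftarrow>shifted_terms (Suc k) ks. q * prod_over (?T X) l) - 2 * \<beta> * prod_over (?T X) (Suc k # ks)) * exp (- \<beta> * (X \<bullet> X))) = 0"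
      using D(2) by (simp only: R_def[abs_def] sum.neutral_const)
  qed
  then show ?thesis by (simp only: gauss_moment_def[abs_def])
qed

lemma gauss_moment_Nil:
  assumes "\<beta> > 0"
  shows "gauss_moment TYPE('m::finite) TYPE('n::finite) \<beta> [] = (pi / \<beta>) powr (real CARD('n) * real CARD('m) / 2)"
  using gaussian_integral(2)[OF assms, where 'a="real^'m^'n"] assms
  by (simp add: gauss_moment_def powr_half_sqrt[symmetric] powr_power)

section \<open>Loop equations for the Laguerre weight\<close>

text \<open>The density of the Gamma distribution up to normalisation.\<close>
definition laguerre :: "real \<Rightarrow> real \<Rightarrow> real \<Rightarrow> real" where
  "laguerre a b t = (if t > 0 then t powr a * exp (- b * t) else 0)"

text \<open>The density of the eigenvalues of a null Wishart matrix (the Laguerre orthogonal ensemble) up to normalisation, for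
\<open>2 a + 1\<close> the number of columns minus the number of rows.\<close>
definition laguerre_weight :: "real \<Rightarrow> real \<Rightarrow> real^'n::{finite,linorder} \<Rightarrow> real" where
  "laguerre_weight a b x = \<bar>vandermonde x\<bar> * (\<Prod>i\<in>UNIV. laguerre a b (x $ i))"

lemma laguerre_measurable[measurable]: "laguerre a b \<in> borel_measurable borel"
  unfolding laguerre_def[abs_def] by measurable

lemma laguerre_integrable:
  assumes "a \<ge> 0" "b > 0"
  shows "integrable lborel (laguerre a b)"
proof -
  have "(\<lambda>t. complex_of_real t powr (of_real (a + 1) - 1) / of_real (exp (b * t))) absolutely_integrable_on {0<..}"
    by (rule absolutely_integrable_Gamma_integral) (use assms in auto)
  then have "integrable lebesgue (\<lambda>t. norm (indicator {0<..} t *\<^sub>R (complex_of_real t powr (of_real (a + 1) - 1) / of_real (exp (b * t)))))"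
    unfolding set_integrable_def by (rule integrable_norm)
  also have "(\<lambda>t. norm (indicator {0<..} t *\<^sub>R (complex_of_real t powr (of_real (a + 1) - 1) / of_real (exp (b * t))))) = laguerre a b"
    by (auto simp: fun_eq_iff laguerre_def norm_divide norm_powr_real_powr' indicator_def powr_of_real exp_minus field_simps norm_mult)
  finally show ?thesis by (subst (asm) integrable_completion) auto
qed

lemma lborel_vec_product_integral:
  fixes f :: "real \<Rightarrow> real"
  assumes "integrable lborel f"
  shows "integrable lborel (\<lambda>x::real^'n. \<Prod>i\<in>UNIV. f (x $ i))"
    and "integral\<^sup>L lborel (\<lambda>x::real^'n. \<Prod>i\<in>UNIV. f (x $ i)) = integral\<^sup>L lborel f ^ CARD('n)"
proof -
  have eq: "(\<Prod>i\<in>UNIV. f (x $ i)) = (\<Prod>b\<in>Basis. f (x \<bullet> b))" for x :: "real^'n"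
  proof -
    have "(\<Prod>b\<in>Basis. f (x \<bullet> b)) = (\<Prod>b\<in>range (\<lambda>i. axis i 1). f (x \<bullet> b))"
      by (rule prod.cong) (auto simp: Basis_vec_def)
    also have "\<dots> = (\<Prod>i\<in>UNIV. f (x \<bullet> axis i 1))"
      by (subst prod.reindex) (auto intro!: injI simp: axis_eq_axis)
    finally show ?thesis by (simp add: cart_eq_inner_axis)
  qed
  show "integrable lborel (\<lambda>x::real^'n. \<Prod>i\<in>UNIV. f (x $ i))"
    "integral\<^sup>L lborel (\<lambda>x::real^'n. \<Prod>i\<in>UNIV. f (x $ i)) = integral\<^sup>L lborel f ^ CARD('n)"
    unfolding eq using lborel_product_integral[of "\<lambda>_::real^'n. f"] assms by auto
qed

text \<open>In logarithmic form the derivatives of the many factors of the weight simply add up.\<close>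
lemma log_derivative_prod:
  assumes "finite A" "\<And>p. p \<in> A \<Longrightarrow> (f p has_real_derivative f p s * r p) (at s)"
  shows "((\<lambda>s. \<Prod>p\<in>A. f p s) has_real_derivative (\<Prod>p\<in>A. f p s) * (\<Sum>p\<in>A. r p)) (at s)"
  using assms
proof (induction A rule: finite_induct)
  case (insert p A)
  then have "((\<lambda>s. f p s * (\<Prod>p\<in>A. f p s)) has_real_derivative
      f p s * r p * (\<Prod>p\<in>A. f p s) + (\<Prod>p\<in>A. f p s) * (\<Sum>p\<in>A. r p) * f p s) (at s)"
    by (intro DERIV_mult) auto
  then show ?case using insert by (simp add: algebra_simps)
qed simp

lemma DERIV_abs: "x \<noteq> 0 \<Longrightarrow> (abs has_real_derivative sgn x) (at x)" for x :: real
  by (cases "x > 0")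
     (auto intro!: has_field_derivative_transform_within_open[of "\<lambda>x. x" 1 x "{0<..}" abs]
        has_field_derivative_transform_within_open[of "\<lambda>x. -x" "-1" x "{..<0}" abs] derivative_eq_intros)

lemma abs_log_derivative:
  fixes u :: "real \<Rightarrow> real"
  assumes "u s \<noteq> 0" "(u has_real_derivative d) (at s)"
  shows "((\<lambda>s. \<bar>u s\<bar>) has_real_derivative \<bar>u s\<bar> * (d / u s)) (at s)"
proof -
  have "((\<lambda>s. \<bar>u s\<bar>) has_real_derivative sgn (u s) * d) (at s)"
    using DERIV_chain2[OF DERIV_abs[OF assms(1)] assms(2)] .
  also have "sgn (u s) * d = \<bar>u s\<bar> * (d / u s)" using assms(1) by (simp add: sgn_if)
  finally show ?thesis .
qed

lemma laguerre_log_derivative: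
  assumes "t \<noteq> 0"
  shows "(laguerre a b has_real_derivative laguerre a b t * (a / t - b)) (at t)"
proof (cases "t > 0")
  case True
  have "((\<lambda>t. t powr a * exp (- b * t)) has_real_derivative laguerre a b t * (a / t - b)) (at t)"
    using True by (auto intro!: derivative_eq_intros simp: laguerre_def powr_diff field_simps)
  then show ?thesis
    by (rule has_field_derivative_transform_within_open[of _ _ _ "{0<..}"]) (use True in \<open>auto simp: laguerre_def\<close>)
next
  case False
  have "((\<lambda>t. 0) has_real_derivative laguerre a b t * (a / t - b)) (at t)"
    using False by (simp add: laguerre_def)
  then show ?thesis
    by (rule has_field_derivative_transform_within_open[of _ _ _ "{..<0}"]) (use False assms in \<open>auto simp: laguerre_def\<close>)
qed

text \<open>For \<open>a = 0\<close> the weight itself jumps at zero; one factor \<open>t\<close> removes the jump.\<close>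
lemma continuous_power_laguerre:
  assumes "a \<ge> 0" shows "continuous_on UNIV (\<lambda>t. t ^ Suc k * laguerre a b t)"
proof -
  have "(\<lambda>t. t ^ Suc k * laguerre a b t) = (\<lambda>t. t ^ k * (max t 0 powr (a + 1)) * exp (- b * t))"
    using assms by (auto simp: fun_eq_iff laguerre_def powr_add max_def)
  moreover have "continuous_on UNIV (\<lambda>t::real. t ^ k * (max t 0 powr (a + 1)) * exp (- b * t))"
    using assms by (intro continuous_intros continuous_on_powr') auto
  ultimately show ?thesis by (simp only:)
qed

abbreviation pairs :: "('n::{finite,linorder} \<times> 'n) set" where
  "pairs \<equiv> {(i, j). i < j}"

lemma vandermonde_abs: "\<bar>vandermonde x\<bar> = (\<Prod>p\<in>pairs. \<bar>x $ snd p - x $ fst p\<bar>)"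
  by (simp add: vandermonde_def abs_prod split_def)

text \<open>The partial logarithmic derivative of \<open>\<bar>vandermonde x\<bar>\<close> in direction \<open>i\<close>. Summing over pairs, instead of over
the indices different from \<open>i\<close>, makes the sum over \<open>i\<close> below a sum of difference quotients.\<close>
definition vandermonde_dlog :: "'n::{finite,linorder} \<Rightarrow> real^'n::{finite,linorder} \<Rightarrow> real" where
  "vandermonde_dlog i x = (\<Sum>p\<in>pairs. ((if snd p = i then 1 else 0) - (if fst p = i then 1 else 0)) / (x $ snd p - x $ fst p))"

definition laguerre_dlog :: "real \<Rightarrow> real \<Rightarrow> 'n::{finite,linorder} \<Rightarrow> real^'n::{finite,linorder} \<Rightarrow> real" where
  "laguerre_dlog a b i x = a / x $ i - b"

lemma laguerre_weight_log_derivative: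
  fixes x y :: "real^'n::{finite,linorder}" and i :: 'n
  assumes x: "x = y + s *\<^sub>R axis i 1" and ne: "x $ i \<noteq> 0" "\<And>j. j \<noteq> i \<Longrightarrow> x $ i \<noteq> x $ j"
  shows "((\<lambda>s. laguerre_weight a b (y + s *\<^sub>R axis i 1)) has_real_derivative laguerre_weight a b x * (vandermonde_dlog i x + laguerre_dlog a b i x)) (at s)"
proof -
  let ?z = "\<lambda>s. y + s *\<^sub>R axis i 1"
  have z: "?z s $ j = y $ j + (if j = i then s else 0)" for s j by (simp add: axis_def)
  have zd: "((\<lambda>s. ?z s $ j) has_real_derivative (if j = i then 1 else 0)) (at s)" for j
    unfolding z by (auto intro!: derivative_eq_intros)
  have 1: "((\<lambda>s. \<bar>vandermonde (?z s)\<bar>) has_real_derivative \<bar>vandermonde x\<bar> * vandermonde_dlog i x) (at s)"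
    unfolding vandermonde_abs vandermonde_dlog_def x
  proof (rule log_derivative_prod)
    fix p :: "'n \<times> 'n" assume p: "p \<in> pairs"
    have "((\<lambda>s. ?z s $ snd p - ?z s $ fst p) has_real_derivative
        (if snd p = i then 1 else 0) - (if fst p = i then 1 else 0)) (at s)"
      by (intro DERIV_diff zd)
    moreover have "?z s $ snd p - ?z s $ fst p \<noteq> 0" if "fst p = i \<or> snd p = i"
    proof (cases "fst p = i")
      case True
      then have "snd p \<noteq> i" using p by auto
      then show ?thesis using ne(2)[of "snd p"] True unfolding x[symmetric] by simp
    next
      case False
      then show ?thesis using ne(2)[of "fst p"] that unfolding x[symmetric] by simp
    qed
    ultimately show "((\<lambda>s. \<bar>?z s $ snd p - ?z s $ fst p\<bar>) has_real_derivative \<bar>?z s $ snd p - ?z s $ fst p\<bar> *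
       (((if snd p = i then 1 else 0) - (if fst p = i then 1 else 0)) / (?z s $ snd p - ?z s $ fst p))) (at s)"
    proof (cases "fst p = i \<or> snd p = i")
      case True
      then show ?thesis using \<open>_ \<Longrightarrow> ?z s $ snd p - ?z s $ fst p \<noteq> 0\<close>
        by (intro abs_log_derivative \<open>((\<lambda>s. ?z s $ snd p - ?z s $ fst p) has_real_derivative _) (at s)\<close>) auto
    next
      case False
      then show ?thesis by (simp add: axis_def)
    qed
  qed auto
  have 2: "((\<lambda>s. \<Prod>j\<in>UNIV. laguerre a b (?z s $ j)) has_real_derivative
      (\<Prod>j\<in>UNIV. laguerre a b (x $ j)) * (\<Sum>j\<in>UNIV. if j = i then laguerre_dlog a b i x else 0)) (at s)"
    unfolding x
  proof (rule log_derivative_prod)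
    fix j
    show "((\<lambda>s. laguerre a b (?z s $ j)) has_real_derivative laguerre a b (?z s $ j) * (if j = i then laguerre_dlog a b i (?z s) else 0)) (at s)"
    proof (cases "j = i")
      case True
      then show ?thesis using DERIV_chain2[OF laguerre_log_derivative zd, of j a b] ne(1) x by (simp add: laguerre_dlog_def)
    next
      case False
      then show ?thesis by (simp add: axis_def)
    qed
  qed auto
  show ?thesis unfolding laguerre_weight_def
    using DERIV_mult[OF 1 2] by (simp add: x algebra_simps)
qed

lemma continuous_laguerre_weight_line:
  fixes y :: "real^'n::{finite,linorder}"
  assumes "a \<ge> 0"
  shows "continuous_on UNIV (\<lambda>s. ((y + s *\<^sub>R axis i 1) $ i) ^ Suc k * laguerre_weight a b (y + s *\<^sub>R axis i 1))"
proof -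
  let ?z = "\<lambda>s. y + s *\<^sub>R axis i 1"
  have z: "?z s $ j = y $ j + (if j = i then s else 0)" for s j by (simp add: axis_def)
  have "(?z s $ i) ^ Suc k * laguerre_weight a b (?z s) =
     ((y $ i + s) ^ Suc k * laguerre a b (y $ i + s)) * (\<bar>vandermonde (?z s)\<bar> * (\<Prod>j\<in>UNIV - {i}. laguerre a b (y $ j)))" for s
  proof -
    have "(\<Prod>j\<in>UNIV. laguerre a b (?z s $ j)) = laguerre a b (y $ i + s) * (\<Prod>j\<in>UNIV - {i}. laguerre a b (y $ j))"
      by (subst prod.remove[of _ i]) (auto simp: axis_def intro!: arg_cong2[where f="(*)"] prod.cong)
    then show ?thesis by (simp add: laguerre_weight_def z)
  qed
  moreover have "continuous_on UNIV (\<lambda>s. (y $ i + s) ^ Suc k * laguerre a b (y $ i + s))"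
    by (rule continuous_on_compose2[OF continuous_power_laguerre[OF assms]]) (auto intro: continuous_intros)
  moreover have "continuous_on UNIV (\<lambda>s. \<bar>vandermonde (?z s)\<bar> * (\<Prod>j\<in>UNIV - {i}. laguerre a b (y $ j)))"
    unfolding vandermonde_abs by (intro continuous_intros)
  ultimately show ?thesis by (simp only: continuous_on_mult)
qed

lemma real_polynomial_component: "real_polynomial_function (\<lambda>x::real^'n. x $ i)"
  by (rule real_polynomial_function.intros(1)) (rule bounded_linear_vec_nth)

lemma real_polynomial_power_sum: "real_polynomial_function (power_sum k)"
  unfolding power_sum_def[abs_def]
  by (intro real_polynomial_function_sum real_polynomial_function_power real_polynomial_component) auto

lemma real_polynomial_pairs:
  fixes A :: "('n::{finite,linorder} \<times> 'n::{finite,linorder}) set"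
  shows "real_polynomial_function (\<lambda>x. \<Prod>p\<in>A. x $ snd p - x $ fst p)"
  by (intro real_polynomial_function_prod real_polynomial_function_diff real_polynomial_component) auto

lemma prod_laguerre_integrable:
  fixes F :: "real^'n \<Rightarrow> real"
  assumes a: "a \<ge> 0" and b: "b > 0" and F[measurable]: "F \<in> borel_measurable borel"
    and q: "real_polynomial_function q" and le: "\<And>x. \<bar>F x\<bar> \<le> \<bar>q x\<bar>"
  shows "integrable lborel (\<lambda>x. F x * (\<Prod>i\<in>UNIV. laguerre a b (x $ i)))"
proof -
  let ?W = "\<lambda>x::real^'n. \<Sum>i\<in>UNIV. \<bar>x $ i\<bar>"
  have W: "\<exists>C. \<forall>x. norm x \<le> C * exp (e * ?W x)" if "e > 0" for e
  proof -
    have "norm x \<le> (1/e) * exp (e * ?W x)" for x :: "real^'n"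
    proof -
      have "e * norm x \<le> e * ?W x" using that norm_le_l1_cart[of x] by simp
      also have "\<dots> \<le> exp (e * ?W x)" using exp_ge_add_one_self[of "e * ?W x"] by linarith
      finally show ?thesis using that by (simp add: field_simps)
    qed
    then show ?thesis by blast
  qed
  obtain C where C: "\<And>x. \<bar>q x\<bar> \<le> C * exp (b/2 * ?W x)"
    using real_polynomial_function_bound[OF q, of ?W "b/2"] W b by (auto simp: sum_nonneg)
  have prod: "exp (b/2 * ?W x) * (\<Prod>i\<in>UNIV. laguerre a b (x $ i)) = (\<Prod>i\<in>UNIV. laguerre a (b/2) (x $ i))" for x :: "real^'n"
  proof -
    have "exp (b/2 * ?W x) * (\<Prod>i\<in>UNIV. laguerre a b (x $ i)) = (\<Prod>i\<in>UNIV. exp (b/2 * \<bar>x $ i\<bar>) * laguerre a b (x $ i))"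
      by (simp add: exp_sum sum_distrib_left prod.distrib)
    also have "\<dots> = (\<Prod>i\<in>UNIV. laguerre a (b/2) (x $ i))"
      by (intro prod.cong) (auto simp: laguerre_def exp_add[symmetric] field_simps)
    finally show ?thesis .
  qed
  have laguerre0: "0 \<le> (\<Prod>i\<in>UNIV. laguerre a b (x $ i))" for x :: "real^'n"
    by (intro prod_nonneg) (auto simp: laguerre_def)
  show ?thesis
  proof (rule Bochner_Integration.integrable_bound)
    show "integrable lborel (\<lambda>x::real^'n. C * (\<Prod>i\<in>UNIV. laguerre a (b/2) (x $ i)))"
      by (intro integrable_mult_right lborel_vec_product_integral laguerre_integrable) (use a b in auto)
    have "\<bar>F x\<bar> * (\<Prod>i\<in>UNIV. laguerre a b (x $ i)) \<le> C * (\<Prod>i\<in>UNIV. laguerre a (b/2) (x $ i))" for x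
      using mult_right_mono[OF order_trans[OF le C] laguerre0, of x x] prod[of x] by (simp add: mult.assoc)
    then show "AE x in lborel. norm (F x * (\<Prod>i\<in>UNIV. laguerre a b (x $ i))) \<le> norm (C * (\<Prod>i\<in>UNIV. laguerre a (b/2) (x $ i)))"
      using laguerre0 by (intro AE_I2) (simp only: real_norm_def abs_mult[of "F _"] abs_of_nonneg, meson abs_ge_self order_trans)
  qed simp
qed

lemma vandermonde_measurable[measurable]: "vandermonde \<in> borel_measurable borel"
  unfolding vandermonde_def[abs_def]
  by (intro borel_measurable_continuous_onI continuous_on_prod) (auto simp: split_def intro!: continuous_intros)

lemma laguerre_weight_integrable:
  assumes a: "a \<ge> 0" and b: "b > 0" and q: "real_polynomial_function q"
  shows "integrable lborel (\<lambda>x. q x * laguerre_weight a b x)"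
proof -
  have q'[measurable]: "q \<in> borel_measurable borel"
    using q by (intro borel_measurable_continuous_onI continuous_on_polymonial_function) (simp add: real_polynomial_function_eq)
  have "integrable lborel (\<lambda>x. (q x * \<bar>vandermonde x\<bar>) * (\<Prod>i\<in>UNIV. laguerre a b (x $ i)))"
    by (rule prod_laguerre_integrable[OF a b, of _ "\<lambda>x. q x * (\<Prod>p\<in>pairs. x $ snd p - x $ fst p)"])
       (auto intro!: real_polynomial_function.intros(2-4) q real_polynomial_pairs simp: vandermonde_def abs_mult split_def)
  then show ?thesis by (simp add: laguerre_weight_def mult.assoc)
qed

text \<open>Each denominator occurs as a factor of the Vandermonde determinant, so only a polynomial remains.\<close>
lemma laguerre_weight_vandermonde_dlog_integrable:
  assumes a: "a \<ge> 0" and b: "b > 0" and q: "real_polynomial_function q"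
  shows "integrable lborel (\<lambda>x. q x * laguerre_weight a b x * vandermonde_dlog i x)"
proof -
  have q'[measurable]: "q \<in> borel_measurable borel"
    using q by (intro borel_measurable_continuous_onI continuous_on_polymonial_function) (simp add: real_polynomial_function_eq)
  have "integrable lborel (\<lambda>x. (q x * \<bar>vandermonde x\<bar> / (x $ snd p - x $ fst p)) * (\<Prod>i\<in>UNIV. laguerre a b (x $ i)))"
    if p: "p \<in> pairs" for p
  proof (rule prod_laguerre_integrable[OF a b, of _ "\<lambda>x. q x * (\<Prod>p\<in>pairs-{p}. x $ snd p - x $ fst p)"])
    show "\<bar>q x * \<bar>vandermonde x\<bar> / (x $ snd p - x $ fst p)\<bar> \<le> \<bar>q x * (\<Prod>p\<in>pairs - {p}. x $ snd p - x $ fst p)\<bar>" for x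
    proof -
      have "vandermonde x = (x $ snd p - x $ fst p) * (\<Prod>p\<in>pairs - {p}. x $ snd p - x $ fst p)"
        using prod.remove[OF _ p, of "\<lambda>p. x $ snd p - x $ fst p"] by (simp add: vandermonde_def split_def)
      then show ?thesis by (simp add: abs_mult)
    qed
  qed (auto intro!: real_polynomial_function.intros(2-4) q real_polynomial_pairs)
  then have "integrable lborel (\<lambda>x. \<Sum>p\<in>pairs. ((if snd p = i then 1 else 0) - (if fst p = i then 1 else 0)) *
     ((q x * \<bar>vandermonde x\<bar> / (x $ snd p - x $ fst p)) * (\<Prod>i\<in>UNIV. laguerre a b (x $ i))))"
    by (intro Bochner_Integration.integrable_sum integrable_mult_right) auto
  then show ?thesis
    by (rule Bochner_Integration.integrable_cong[THEN iffD1, rotated -1])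
       (auto simp: vandermonde_dlog_def laguerre_weight_def sum_distrib_left mult_ac intro!: sum.cong)
qed

text \<open>A symmetric sum over ordered pairs is twice the sum over increasing pairs plus the diagonal.\<close>
lemma sum_pairs:
  fixes h :: "'n::{finite,linorder} \<Rightarrow> 'n \<Rightarrow> real"
  assumes "\<And>i j. h i j = h j i"
  shows "2 * (\<Sum>p\<in>pairs. h (snd p) (fst p)) = (\<Sum>i\<in>UNIV. \<Sum>j\<in>UNIV. h i j) - (\<Sum>i\<in>UNIV. h i i)"
proof -
  have "(\<Sum>i\<in>UNIV. \<Sum>j\<in>UNIV. h i j) = (\<Sum>p\<in>UNIV. h (snd p) (fst p))"
    using assms by (simp add: sum.cartesian_product split_def flip: UNIV_Times_UNIV)
  also have "(UNIV :: ('n \<times> 'n) set) = pairs \<union> (prod.swap ` pairs \<union> range (\<lambda>i. (i, i)))"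
    by (auto simp: image_iff)
  also have "(\<Sum>p\<in>\<dots>. h (snd p) (fst p)) = (\<Sum>p\<in>pairs. h (snd p) (fst p)) +
      ((\<Sum>p\<in>prod.swap ` pairs. h (snd p) (fst p)) + (\<Sum>p\<in>range (\<lambda>i. (i, i)). h (snd p) (fst p)))"
    by (subst sum.union_disjoint; (subst sum.union_disjoint)?) auto
  also have "(\<Sum>p\<in>prod.swap ` pairs. h (snd p) (fst p)) = (\<Sum>p\<in>pairs. h (snd p) (fst p))"
    using assms by (subst sum.reindex) (auto simp: inj_on_def)
  also have "(\<Sum>p\<in>range (\<lambda>i. (i, i)). h (snd p) (fst p)) = (\<Sum>i\<in>UNIV. h i i)"
    by (subst sum.reindex) (auto simp: inj_on_def)
  finally show ?thesis by simp
qed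

text \<open>The logarithmic derivatives combine to the difference quotients of \<open>t ^ Suc k\<close>, which are
\<open>\<Sum>r\<le>k. s ^ r * t ^ (k - r)\<close> and factor into power sums after summation over all pairs.\<close>
lemma sum_power_vandermonde_dlog:
  fixes x :: "real^'n::{finite,linorder}"
  assumes "\<And>i j. i \<noteq> j \<Longrightarrow> x $ i \<noteq> x $ j"
  shows "2 * (\<Sum>i\<in>UNIV. x $ i ^ Suc k * vandermonde_dlog i x) = (\<Sum>r\<le>k. power_sum r x * power_sum (k - r) x) - real (Suc k) * power_sum k x"
proof -
  define h where "h i j = (\<Sum>r\<le>k. x $ i ^ r * x $ j ^ (k - r))" for i j
  have sym: "h i j = h j i" for i j
    unfolding h_def by (rule sum.reindex_bij_witness[of _ "\<lambda>r. k - r" "\<lambda>r. k - r"]) auto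
  have "(\<Sum>i\<in>UNIV. x $ i ^ Suc k * vandermonde_dlog i x) = (\<Sum>p\<in>pairs. (\<Sum>i\<in>UNIV. x $ i ^ Suc k *
      (((if snd p = i then 1 else 0) - (if fst p = i then 1 else 0)) / (x $ snd p - x $ fst p))))"
    unfolding vandermonde_dlog_def sum_distrib_left by (rule sum.swap)
  also have "\<dots> = (\<Sum>p\<in>pairs. h (snd p) (fst p))"
  proof (rule sum.cong[OF refl])
    fix p :: "'n \<times> 'n" assume p: "p \<in> pairs"
    then have ne: "x $ snd p - x $ fst p \<noteq> 0" using assms[of "snd p" "fst p"] by auto
    have "(\<Sum>i\<in>UNIV. x $ i ^ Suc k * (((if snd p = i then 1 else 0) - (if fst p = i then 1 else 0)) / (x $ snd p - x $ fst p)))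
      = (\<Sum>i\<in>UNIV. (if snd p = i then x $ i ^ Suc k / (x $ snd p - x $ fst p) else 0)
          - (if fst p = i then x $ i ^ Suc k / (x $ snd p - x $ fst p) else 0))"
      by (intro sum.cong) (auto simp: diff_divide_distrib right_diff_distrib)
    also have "\<dots> = (x $ snd p ^ Suc k - x $ fst p ^ Suc k) / (x $ snd p - x $ fst p)"
      by (simp add: sum_subtractf diff_divide_distrib)
    also have "\<dots> = h (snd p) (fst p)"
      using ne unfolding diff_power_eq_sum h_def lessThan_Suc_atMost by simp
    finally show "(\<Sum>i\<in>UNIV. x $ i ^ Suc k * (((if snd p = i then 1 else 0) - (if fst p = i then 1 else 0)) / (x $ snd p - x $ fst p)))
      = h (snd p) (fst p)" .
  qed
  finally have "2 * (\<Sum>i\<in>UNIV. x $ i ^ Suc k * vandermonde_dlog i x) = (\<Sum>i\<in>UNIV. \<Sum>j\<in>UNIV. h i j) - (\<Sum>i\<in>UNIV. h i i)"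
    using sum_pairs[of h, OF sym] by simp
  also have "(\<Sum>i\<in>UNIV. h i i) = real (Suc k) * power_sum k x"
    by (simp add: h_def power_sum_def sum_distrib_left flip: power_add)
  also have "(\<Sum>i\<in>UNIV. \<Sum>j\<in>UNIV. h i j) = (\<Sum>r\<le>k. power_sum r x * power_sum (k - r) x)"
  proof -
    have "(\<Sum>i\<in>UNIV. \<Sum>j\<in>UNIV. h i j) = (\<Sum>i\<in>UNIV. \<Sum>r\<le>k. \<Sum>j\<in>UNIV. x $ i ^ r * x $ j ^ (k - r))"
      unfolding h_def by (intro sum.cong refl sum.swap)
    also have "\<dots> = (\<Sum>r\<le>k. \<Sum>i\<in>UNIV. \<Sum>j\<in>UNIV. x $ i ^ r * x $ j ^ (k - r))" by (rule sum.swap)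
    finally show ?thesis by (simp add: power_sum_def sum_product)
  qed
  finally show ?thesis .
qed

lemma laguerre_weight_nonzero:
  fixes x :: "real^'n::{finite,linorder}"
  assumes "laguerre_weight a b x \<noteq> 0"
  shows "x $ i > 0" "i \<noteq> j \<Longrightarrow> x $ i \<noteq> x $ j"
proof -
  have "laguerre a b (x $ i) \<noteq> 0" using assms by (auto simp: laguerre_weight_def)
  then show "x $ i > 0" by (auto simp: laguerre_def split: if_splits)
  have *: "x $ snd p - x $ fst p \<noteq> 0" if "p \<in> pairs" for p
    using assms that by (auto simp: laguerre_weight_def vandermonde_abs)
  assume "i \<noteq> j"
  then show "x $ i \<noteq> x $ j" using *[of "(i, j)"] *[of "(j, i)"] by (cases i j rule: linorder_cases) auto
qed

text \<open>The vector field \<open>x\<^sub>i ^ Suc k \<partial>\<^sub>i\<close> vanishes at the boundary \<open>x\<^sub>i = 0\<close>, and the weight vanishes where two entries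
meet, so no boundary terms arise.\<close>
lemma laguerre_weight_integration_by_parts:
  fixes ks :: "nat list" and k :: nat and i :: "'n::{finite,linorder}"
  assumes a: "a \<ge> 0" and b: "b > 0"
  defines "P \<equiv> \<lambda>x::real^'n::{finite,linorder}. prod_over (\<lambda>m. power_sum m x) ks"
    and "dP \<equiv> \<lambda>x::real^'n::{finite,linorder}. prod_over_deriv (\<lambda>m. power_sum m x) (\<lambda>m. real m * x $ i ^ (m - 1)) ks"
  defines "D \<equiv> \<lambda>x. (real (Suc k) * x $ i ^ k * P x + x $ i ^ Suc k * dP x + a * x $ i ^ k * P x - b * x $ i ^ Suc k * P x) * laguerre_weight a b x
     + x $ i ^ Suc k * P x * laguerre_weight a b x * vandermonde_dlog i x"
  shows "integrable lborel D" "integral\<^sup>L lborel D = 0"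
proof -
  have polyP: "real_polynomial_function P" unfolding P_def by (intro real_polynomial_prod_over real_polynomial_power_sum)
  have polydP: "real_polynomial_function dP" unfolding dP_def
    by (intro real_polynomial_prod_over_deriv real_polynomial_power_sum real_polynomial_function.intros(2-4)
       real_polynomial_function_power real_polynomial_component)
  note poly = real_polynomial_function.intros(2-4) real_polynomial_function_power real_polynomial_component
    real_polynomial_function_diff polyP polydP
  show "integrable lborel D"
    unfolding D_def by (intro Bochner_Integration.integrable_add laguerre_weight_integrable laguerre_weight_vandermonde_dlog_integrable a b poly)
  show "integral\<^sup>L lborel D = 0"
  proof (rule integral_directional_derivative_eq_0[where b="axis i 1"])
    show "integrable lborel (\<lambda>x. (x $ i ^ Suc k * P x) * laguerre_weight a b x)"
      by (intro laguerre_weight_integrable a b poly)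
    show "integrable lborel D" by fact
    fix y :: "real^'n::{finite,linorder}"
    let ?z = "\<lambda>s. y + s *\<^sub>R axis i 1"
    have cz: "continuous_on UNIV ?z" by (intro continuous_intros)
    have "continuous_on UNIV P" using polyP real_polynomial_function_eq continuous_on_polymonial_function by blast
    then have "continuous_on UNIV (\<lambda>s. P (?z s))" by (rule continuous_on_compose2[OF _ cz]) auto
    from continuous_on_mult[OF this continuous_laguerre_weight_line[OF a, of y i k b]]
    show "continuous_on UNIV (\<lambda>s. (?z s $ i ^ Suc k * P (?z s)) * laguerre_weight a b (?z s))"
      by (simp only: mult_ac)
    show "\<exists>F. finite F \<and> (\<forall>s. s \<notin> F \<longrightarrow>
       ((\<lambda>s. (?z s $ i ^ Suc k * P (?z s)) * laguerre_weight a b (?z s)) has_real_derivative D (?z s)) (at s))"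
    proof (intro exI[of _ "insert (- (y $ i)) (range (\<lambda>j. y $ j - y $ i))"] conjI allI impI)
      fix s assume s: "s \<notin> insert (- (y $ i)) (range (\<lambda>j. y $ j - y $ i))"
      define x where x: "x = ?z s"
      have xi: "x $ i \<noteq> 0" using s by (auto simp: x)
      have xj: "x $ i \<noteq> x $ j" if "j \<noteq> i" for j
      proof
        assume "x $ i = x $ j"
        then have "s = y $ j - y $ i" using that by (simp add: x axis_def)
        then show False using s by blast
      qed
      have zd: "((\<lambda>s. ?z s $ j) has_real_derivative (if j = i then 1 else 0)) (at s)" for j
        by (auto intro!: derivative_eq_intros simp: axis_def)
      have pd: "((\<lambda>s. power_sum m (?z s)) has_real_derivative real m * x $ i ^ (m - 1)) (at s)" for m
      proof -
        have "((\<lambda>s. power_sum m (?z s)) has_real_derivative (\<Sum>j\<in>UNIV. real m * (?z s $ j ^ (m - 1) * (if j = i then 1 else 0)))) (at s)"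
          unfolding power_sum_def using DERIV_power[OF zd, where n=m] by (intro DERIV_sum) (simp add: mult_ac)
        then show ?thesis by (simp add: mult_delta_right x)
      qed
      have d1: "((\<lambda>s. P (?z s)) has_real_derivative dP x) (at s)"
        unfolding P_def dP_def x by (rule has_real_derivative_prod_over) (rule pd[unfolded x])
      have d2: "((\<lambda>s. ?z s $ i ^ Suc k) has_real_derivative real (Suc k) * x $ i ^ k) (at s)"
        using DERIV_power[OF zd[of i], where n="Suc k"] by (simp add: x)
      have d3: "((\<lambda>s. laguerre_weight a b (?z s)) has_real_derivative laguerre_weight a b x * (vandermonde_dlog i x + laguerre_dlog a b i x)) (at s)"
        by (rule laguerre_weight_log_derivative[OF x xi xj])
      have "((\<lambda>s. (?z s $ i ^ Suc k * P (?z s)) * laguerre_weight a b (?z s)) has_real_derivative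
        (real (Suc k) * x $ i ^ k * P x + dP x * x $ i ^ Suc k) * laguerre_weight a b x +
         laguerre_weight a b x * (vandermonde_dlog i x + laguerre_dlog a b i x) * (x $ i ^ Suc k * P x)) (at s)"
        using DERIV_mult[OF DERIV_mult[OF d2 d1] d3] by (simp add: x)
      moreover have "(real (Suc k) * x $ i ^ k * P x + dP x * x $ i ^ Suc k) * laguerre_weight a b x +
         laguerre_weight a b x * (vandermonde_dlog i x + laguerre_dlog a b i x) * (x $ i ^ Suc k * P x) = D x"
        using xi by (simp add: D_def laguerre_dlog_def field_simps)
      ultimately show "((\<lambda>s. (?z s $ i ^ Suc k * P (?z s)) * laguerre_weight a b (?z s)) has_real_derivative D (?z s)) (at s)"
        by (simp add: x)
    qed simp
  qed
qed

definition laguerre_moment :: "'n::{finite,linorder} itself \<Rightarrow> real \<Rightarrow> real \<Rightarrow> nat list \<Rightarrow> real" where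
  "laguerre_moment T a b ks = integral\<^sup>L lborel (\<lambda>x::real^'n::{finite,linorder}. prod_over (\<lambda>m. power_sum m x) ks * laguerre_weight a b x)"

lemma real_polynomial_prod_over_power_sum: "real_polynomial_function (\<lambda>x. prod_over (\<lambda>m. power_sum m x) ks)"
  by (intro real_polynomial_prod_over real_polynomial_power_sum)

text \<open>The repulsion of the eigenvalues produces the product of two power sums that the derivative of \<open>X X\<^sup>T\<close> produces in
\<open>gauss_loop_equations\<close>. The equations agree when \<open>2 a + 1\<close> is the number of columns minus the number of rows.\<close>
lemma laguerre_loop_equations:
  assumes a: "a \<ge> 0" and b: "b > 0"
  shows "loop_equations (real CARD('n)) (2 * a + 1) (2 * b) (laguerre_moment TYPE('n::{finite,linorder}) a b)"
proof -
  let ?T = "\<lambda>(x::real^'n::{finite,linorder}) m. power_sum m x"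
  have "loop_equations (real CARD('n)) (2 * a + 1) (2 * b)
    (\<lambda>ks. integral\<^sup>L lborel (\<lambda>x::real^'n::{finite,linorder}. prod_over (?T x) ks * laguerre_weight a b x))"
  proof (rule loop_equationsI)
    show "integrable lborel (\<lambda>x::real^'n::{finite,linorder}. prod_over (?T x) ks * laguerre_weight a b x)" for ks
      by (rule laguerre_weight_integrable[OF a b real_polynomial_prod_over_power_sum])
    show "?T x 0 = real CARD('n)" for x by (simp add: power_sum_def)
    fix k ks
    define D where "D i x = (real (Suc k) * x $ i ^ k * prod_over (?T x) ks + x $ i ^ Suc k *
       prod_over_deriv (\<lambda>m. power_sum m x) (\<lambda>m. real m * x $ i ^ (m - 1)) ks + a * x $ i ^ k * prod_over (?T x) ks - b * x $ i ^ Suc k * prod_over (?T x) ks) * laguerre_weight a b x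
       + x $ i ^ Suc k * prod_over (?T x) ks * laguerre_weight a b x * vandermonde_dlog i x" for i :: 'n and x
    have D: "integrable lborel (D i)" "integral\<^sup>L lborel (D i) = 0" for i
      using laguerre_weight_integration_by_parts[OF a b, of k i ks] by (simp_all add: D_def[abs_def])
    define R where "R x = ((real k + (2 * a + 1)) * prod_over (?T x) (k # ks) + (\<Sum>r\<le>k. prod_over (?T x) (r # (k - r) # ks))
       + 2 * (\<Sum>(q, l)\<leftarrow>shifted_terms (Suc k) ks. q * prod_over (?T x) l) - 2 * b * prod_over (?T x) (Suc k # ks)) * laguerre_weight a b x" for x
    have DR: "2 * (\<Sum>i\<in>UNIV. D i x) = R x" for x
    proof (cases "laguerre_weight a b x = 0")
      case True then show ?thesis by (simp add: D_def R_def)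
    next
      case False
      have 1: "(\<Sum>i\<in>UNIV. x $ i ^ Suc k * prod_over_deriv (\<lambda>m. power_sum m x) (\<lambda>m. real m * x $ i ^ (m - 1)) ks)
         = (\<Sum>(q, l)\<leftarrow>shifted_terms (Suc k) ks. q * prod_over (?T x) l)"
      proof -
        have "(\<Sum>i\<in>UNIV. x $ i ^ Suc k * (real m * x $ i ^ (m - 1))) = real m * power_sum (Suc k + m - 1) x" for m
          by (cases m) (simp_all add: power_sum_def sum_distrib_left power_add mult_ac)
        then show ?thesis unfolding prod_over_deriv_sum by (simp add: prod_over_deriv_shifted_terms[symmetric])
      qed
      have 2: "2 * (\<Sum>i\<in>UNIV. x $ i ^ Suc k * vandermonde_dlog i x) = (\<Sum>r\<le>k. power_sum r x * power_sum (k - r) x) - real (Suc k) * power_sum k x"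
        by (rule sum_power_vandermonde_dlog) (rule laguerre_weight_nonzero(2)[OF False])
      have "(\<Sum>i\<in>UNIV. D i x) = (real (Suc k) * power_sum k x * prod_over (?T x) ks
          + (\<Sum>i\<in>UNIV. x $ i ^ Suc k * prod_over_deriv (\<lambda>m. power_sum m x) (\<lambda>m. real m * x $ i ^ (m - 1)) ks)
          + a * power_sum k x * prod_over (?T x) ks - b * power_sum (Suc k) x * prod_over (?T x) ks
          + (\<Sum>i\<in>UNIV. x $ i ^ Suc k * vandermonde_dlog i x) * prod_over (?T x) ks) * laguerre_weight a b x"
        unfolding power_sum_def D_def sum_distrib_left sum_distrib_right sum.distrib[symmetric] sum_subtractf[symmetric]
        by (intro sum.cong refl) (simp add: algebra_simps)
      also have "2 * \<dots> = R x"
      proof -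
        define L where "L = (\<Sum>r\<le>k. power_sum r x * power_sum (k - r) x)"
        have 3: "(\<Sum>i\<in>UNIV. x $ i ^ Suc k * vandermonde_dlog i x) = (L - real (Suc k) * power_sum k x) / 2"
          unfolding L_def 2[symmetric] by (rule nonzero_mult_div_cancel_left[symmetric]) simp
        have 4: "(\<Sum>r\<le>k. prod_over (?T x) (r # (k - r) # ks)) = L * prod_over (?T x) ks"
          by (simp add: L_def sum_distrib_right mult.assoc)
        show ?thesis unfolding 1 3 4 R_def by (simp add: field_simps)
      qed
      finally show ?thesis .
    qed
    have "integral\<^sup>L lborel R = 2 * (\<Sum>i\<in>UNIV. integral\<^sup>L lborel (D i))"
      unfolding DR[symmetric] using D(1) by (simp add: Bochner_Integration.integral_sum)
    then show "integral\<^sup>L lborel (\<lambda>x. ((real k + (2 * a + 1)) * prod_over (?T x) (k # ks) + (\<Sum>r\<le>k. prod_over (?T x) (r # (k - r) # ks))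
       + 2 * (\<Sum>(q, l)\<leftarrow>shifted_terms (Suc k) ks. q * prod_over (?T x) l) - 2 * b * prod_over (?T x) (Suc k # ks)) * laguerre_weight a b x) = 0"
      using D(2) by (simp only: R_def[abs_def] sum.neutral_const mult_zero_right)
  qed
  then show ?thesis by (simp only: laguerre_moment_def[abs_def])
qed

text \<open>The exponent is half the number of entries of the Gaussian matrix when \<open>2 a + 1\<close> is the number of columns minus the
number of rows, and thus the exponent in \<open>gauss_moment_Nil\<close>.\<close>
lemma laguerre_moment_scaling:
  assumes b: "b > 0"
  shows "laguerre_moment TYPE('n::{finite,linorder}) a b [] =
    b powr (- (real CARD('n) * (real CARD('n) + 1 + 2 * a) / 2)) * laguerre_moment TYPE('n::{finite,linorder}) a 1 []"
proof -
  define n where "n = real CARD('n)"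
  have inv_pow: "(1/b) ^ k = b powr (- real k)" for k
    using b by (simp add: powr_minus powr_realpow power_divide divide_inverse power_inverse)
  have sc: "laguerre_weight a b ((1/b) *\<^sub>R x) = b powr (- (n * (n - 1 + 2 * a) / 2)) * laguerre_weight a 1 x" for x :: "real^'n::{finite,linorder}"
  proof -
    have "\<bar>vandermonde ((1/b) *\<^sub>R x)\<bar> = (1/b) ^ card (pairs :: ('n \<times> 'n) set) * \<bar>vandermonde x\<bar>"
      using b by (simp add: vandermonde_abs right_diff_distrib[symmetric] diff_divide_distrib[symmetric] abs_mult prod_dividef power_divide)
    moreover have "2 * real (card (pairs :: ('n \<times> 'n) set)) = n^2 - n"
      using sum_pairs[of "\<lambda>i j::'n. 1"] by (simp add: n_def power2_eq_square)
    then have "real (card (pairs :: ('n \<times> 'n) set)) = n * (n - 1) / 2"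
      by (simp add: power2_eq_square algebra_simps)
    then have "(1/b) ^ card (pairs :: ('n \<times> 'n) set) = b powr (- (n * (n - 1) / 2))"
      using inv_pow[of "card (pairs :: ('n \<times> 'n) set)"] by (simp only:)
    moreover have "(\<Prod>i\<in>UNIV. laguerre a b (((1/b) *\<^sub>R x) $ i)) = (\<Prod>i\<in>UNIV. b powr (- a) * laguerre a 1 (x $ i))"
      using b by (intro prod.cong) (auto simp: laguerre_def powr_divide powr_minus_divide zero_less_divide_iff)
    then have "(\<Prod>i\<in>UNIV. laguerre a b (((1/b) *\<^sub>R x) $ i)) = b powr (- (n * a)) * (\<Prod>i\<in>UNIV. laguerre a 1 (x $ i))"
      using b by (simp add: prod.distrib powr_power n_def mult.commute)
    ultimately have "laguerre_weight a b ((1/b) *\<^sub>R x) = (b powr (- (n * (n - 1) / 2)) * b powr (- (n * a))) * laguerre_weight a 1 x"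
      by (simp add: laguerre_weight_def)
    also have "b powr (- (n * (n - 1) / 2)) * b powr (- (n * a)) = b powr (- (n * (n - 1 + 2 * a) / 2))"
      unfolding powr_add[symmetric] by (rule arg_cong[where f="(powr) b"]) (simp add: algebra_simps add_divide_distrib diff_divide_distrib)
    finally show ?thesis .
  qed
  have [measurable]: "laguerre_weight a c \<in> borel_measurable (borel :: (real^'n::{finite,linorder}) measure)" for c unfolding laguerre_weight_def[abs_def] by measurable
  have "laguerre_moment TYPE('n) a b [] = integral\<^sup>L lborel (laguerre_weight a b :: real^'n::{finite,linorder} \<Rightarrow> real)"
    by (simp add: laguerre_moment_def)
  also have "\<dots> = (1/b) ^ CARD('n) * integral\<^sup>L lborel (\<lambda>x::real^'n::{finite,linorder}. laguerre_weight a b ((1/b) *\<^sub>R x))"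
    using b by (subst lborel_affine[of "1/b" 0]) (simp_all add: integral_density integral_distr)
  also have "\<dots> = (1/b) ^ CARD('n) * b powr (- (n * (n - 1 + 2 * a) / 2)) * laguerre_moment TYPE('n) a 1 []"
    unfolding sc by (simp add: laguerre_moment_def)
  also have "(1/b) ^ CARD('n) = b powr (- n)"
    using inv_pow by (simp add: n_def)
  also have "b powr (- n) * b powr (- (n * (n - 1 + 2 * a) / 2)) = b powr (- (n * (n + 1 + 2 * a) / 2))"
    unfolding powr_add[symmetric] by (rule arg_cong[where f="(powr) b"]) (simp add: algebra_simps add_divide_distrib diff_divide_distrib)
  finally show ?thesis by (simp add: n_def)
qed

section \<open>Finite measures with equal integrals over an algebra of functions\<close>

lemma AE_distrI:
  assumes "f \<in> measurable M N" "{x \<in> space N. P x} \<in> sets N" "AE x in M. P (f x)"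
  shows "AE x in distr M N f. P x"
  using assms by (simp add: AE_distr_iff)

text \<open>Indicator functions of closed sets are decreasing limits of continuous functions of the distance to the set, and the closed
sets form a generating system that is closed under intersection.\<close>
lemma finite_measure_eqI_continuous:
  fixes M N :: "'a::metric_space measure"
  assumes fin: "finite_measure M" "finite_measure N" and sets: "sets M = sets borel" "sets N = sets borel"
    and eq: "\<And>f :: 'a \<Rightarrow> real. continuous_on UNIV f \<Longrightarrow> (\<And>x. 0 \<le> f x \<and> f x \<le> 1) \<Longrightarrow> integral\<^sup>L M f = integral\<^sup>L N f"
  shows "M = N"
proof (rule measure_eqI_generator_eq[where E="Collect closed" and \<Omega>=UNIV and A="\<lambda>_. UNIV"])
  interpret M: finite_measure M by fact
  interpret N: finite_measure N by fact
  have sp: "space M = UNIV" "space N = UNIV" using sets by (auto dest: sets_eq_imp_space_eq)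
  show "Int_stable (Collect closed)" by (auto simp: Int_stable_def)
  show "sets M = sigma_sets UNIV (Collect closed)" "sets N = sigma_sets UNIV (Collect closed)"
    using sets by (simp_all add: borel_eq_closed)
  show "emeasure M UNIV \<noteq> \<infinity>" using M.emeasure_finite by auto
  fix C :: "'a set" assume "C \<in> Collect closed"
  then have C: "closed C" by simp
  show "emeasure M C = emeasure N C"
  proof (cases "C = {}")
    case False
    define f where "f n x = max 0 (1 - real n * infdist x C)" for n x
    have fb: "0 \<le> f n x \<and> f n x \<le> 1" for n x by (auto simp: f_def infdist_nonneg)
    have fc: "continuous_on UNIV (f n)" for n
      unfolding f_def by (intro continuous_intros)
    have flim: "(\<lambda>n. f n x) \<longlonglongrightarrow> indicator C x" for x
    proof (cases "x \<in> C")
      case True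
      then have "infdist x C = 0" by simp
      then show ?thesis using True by (simp add: f_def)
    next
      case nC: False
      then have pos: "infdist x C > 0"
        using in_closed_iff_infdist_zero[OF C False, of x] infdist_nonneg[of x C] by simp
      obtain k where k: "1 / infdist x C < real k" using reals_Archimedean2 by blast
      have "f n x = 0" if "n \<ge> k" for n
      proof -
        have "1 / infdist x C \<le> real n" using k that by linarith
        then have "1 \<le> real n * infdist x C" using pos by (simp add: field_simps)
        then show ?thesis by (simp add: f_def)
      qed
      then have "eventually (\<lambda>n. f n x = 0) sequentially" by (auto simp: eventually_sequentially)
      then show ?thesis using nC by (auto intro: tendsto_eventually)
    qed
    have lim: "(\<lambda>n. integral\<^sup>L K (f n)) \<longlonglongrightarrow> measure K C" if K: "finite_measure K" "sets K = sets borel" for K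
    proof -
      interpret K: finite_measure K by fact
      have [measurable_cong]: "sets K = sets borel" by fact
      have [measurable]: "f n \<in> borel_measurable borel" for n by (intro borel_measurable_continuous_onI fc)
      have [measurable]: "C \<in> sets K" using C K(2) by auto
      have "(\<lambda>n. integral\<^sup>L K (f n)) \<longlonglongrightarrow> integral\<^sup>L K (indicator C)"
        by (rule integral_dominated_convergence[where w="\<lambda>_. 1"]) (use fb flim in auto)
      moreover have "integral\<^sup>L K (indicator C) = measure K C"
        using K(2) by (simp add: Bochner_Integration.integral_indicator sets_eq_imp_space_eq[OF K(2)])
      ultimately show ?thesis by simp
    qed
    have "measure M C = measure N C"
      using lim[OF fin(1) sets(1)] lim[OF fin(2) sets(2)] eq[OF fc fb] by (simp add: LIMSEQ_unique)
    then show ?thesis by (simp add: M.emeasure_eq_measure N.emeasure_eq_measure)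
  qed simp
qed auto

text \<open>By the Stone-Weierstrass theorem, continuous functions are uniformly close on \<open>T\<close> to functions of the ring, and nothing
outside \<open>T\<close> matters.\<close>
lemma finite_measure_eqI_function_ring:
  fixes M N :: "'a::metric_space measure" and R :: "('a \<Rightarrow> real) set"
  assumes ring: "function_ring_on R T" and fin: "finite_measure M" "finite_measure N"
    and sets: "sets M = sets borel" "sets N = sets borel"
    and T: "AE x in M. x \<in> T" "AE x in N. x \<in> T"
    and meas: "\<And>f. f \<in> R \<Longrightarrow> f \<in> borel_measurable borel"
    and eq: "\<And>f. f \<in> R \<Longrightarrow> integral\<^sup>L M f = integral\<^sup>L N f"
  shows "M = N"
proof (rule finite_measure_eqI_continuous[OF fin sets])
  fix f :: "'a \<Rightarrow> real"
  assume f: "continuous_on UNIV f" and fb: "\<And>x. 0 \<le> f x \<and> f x \<le> 1"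
  interpret function_ring_on R T by fact
  have mf: "f \<in> borel_measurable borel" using f by (rule borel_measurable_continuous_onI)
  have approx: "\<bar>integral\<^sup>L K f - integral\<^sup>L K g\<bar> \<le> e * measure K (space K)"
    if K: "finite_measure K" "sets K = sets borel" "AE x in K. x \<in> T" and g: "g \<in> R" "\<And>x. x \<in> T \<Longrightarrow> \<bar>f x - g x\<bar> < e"
    for K g e
  proof -
    interpret K: finite_measure K by fact
    have [measurable_cong]: "sets K = sets borel" by fact
    have [measurable]: "f \<in> borel_measurable borel" "g \<in> borel_measurable borel" using mf meas[OF g(1)] by auto
    have intf: "integrable K f" by (rule K.integrable_const_bound[of _ 1]) (use fb in auto)
    have le: "AE x in K. \<bar>f x - g x\<bar> \<le> e" using K(3) g(2) by (auto intro: less_imp_le)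
    have intd: "integrable K (\<lambda>x. f x - g x)" by (rule K.integrable_const_bound[of _ e]) (use le in auto)
    have intg: "integrable K g" using Bochner_Integration.integrable_diff[OF intf intd] by simp
    have "\<bar>integral\<^sup>L K f - integral\<^sup>L K g\<bar> = \<bar>integral\<^sup>L K (\<lambda>x. f x - g x)\<bar>"
      using intf intg by simp
    also have "\<dots> \<le> integral\<^sup>L K (\<lambda>x. \<bar>f x - g x\<bar>)" by (rule integral_abs_bound)
    also have "\<dots> \<le> integral\<^sup>L K (\<lambda>x. e)" using intd le by (intro integral_mono_AE) auto
    finally show ?thesis by (simp add: mult.commute)
  qed
  define m where "m = measure M (space M) + measure N (space N)"
  have "\<bar>integral\<^sup>L M f - integral\<^sup>L N f\<bar> \<le> 0 + d" if "d > 0" for d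
  proof -
    have m0: "m \<ge> 0" by (simp add: m_def)
    define e where "e = d / (m + 1)"
    have "e > 0" using that m0 by (simp add: e_def)
    then obtain g where g: "g \<in> R" "\<And>x. x \<in> T \<Longrightarrow> \<bar>f x - g x\<bar> < e"
      using Stone_Weierstrass_basic[OF continuous_on_subset[OF f subset_UNIV]] by blast
    have "\<bar>integral\<^sup>L M f - integral\<^sup>L N f\<bar> \<le> e * m"
      using approx[OF fin(1) sets(1) T(1) g] approx[OF fin(2) sets(2) T(2) g] eq[OF g(1)]
      by (simp add: m_def distrib_left)
    also have "\<dots> \<le> e * (m + 1)" using \<open>e > 0\<close> by simp
    also have "\<dots> = d" using m0 by (simp add: e_def)
    finally show ?thesis by simp
  qed
  then have "\<bar>integral\<^sup>L M f - integral\<^sup>L N f\<bar> \<le> 0" by (rule field_le_epsilon)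
  then show "integral\<^sup>L M f = integral\<^sup>L N f" by simp
qed

section \<open>Compactifying the space of sorted vectors\<close>

text \<open>An embedding of the noncompact set of sorted nonnegative vectors into a compact set. Power sums of the first component,
times powers of the second one, are products of power sums times a decaying exponential
(\<open>shrunk_monomial_shrink\<close>), so they are integrable and still separate points.\<close>
definition shrink :: "real^'n \<Rightarrow> (real^'n) \<times> real" where
  "shrink x = (exp (- power_sum 1 x) *\<^sub>R x, exp (- power_sum 1 x))"

definition shrunk_monomial :: "nat \<Rightarrow> nat list \<Rightarrow> (real^'n) \<times> real \<Rightarrow> real" where
  "shrunk_monomial s ks p = snd p ^ s * prod_over (\<lambda>k. power_sum k (fst p)) ks"

inductive_set shrunk_ring :: "((real^'n) \<times> real \<Rightarrow> real) set" where
  mono: "(\<lambda>p. c * shrunk_monomial s ks p) \<in> shrunk_ring"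
| add: "f \<in> shrunk_ring \<Longrightarrow> g \<in> shrunk_ring \<Longrightarrow> (\<lambda>p. f p + g p) \<in> shrunk_ring"

definition shrunk_space :: "((real^'n::{finite,linorder}) \<times> real) set" where
  "shrunk_space = {p. sorted_vec (fst p) \<and> (\<forall>i. 0 \<le> fst p $ i \<and> fst p $ i \<le> 1) \<and> 0 \<le> snd p \<and> snd p \<le> 1}"

lemma prod_over_append: "prod_over T (ks @ ls) = prod_over T ks * prod_over T ls"
  by (simp add: prod_over_def)

lemma shrunk_ring_mult: "f \<in> shrunk_ring \<Longrightarrow> g \<in> shrunk_ring \<Longrightarrow> (\<lambda>p. f p * g p) \<in> shrunk_ring"
proof (induction rule: shrunk_ring.induct)
  case (mono c s ks)
  from mono show ?case
  proof (induction rule: shrunk_ring.induct)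
    case (mono c' s' ks')
    have "(\<lambda>p. (c * c') * shrunk_monomial (s + s') (ks @ ks') p) \<in> shrunk_ring" by (rule shrunk_ring.mono)
    then show ?case by (simp add: shrunk_monomial_def power_add prod_over_append mult_ac)
  next
    case (add f g)
    from shrunk_ring.add[OF add.IH] show ?case by (simp add: distrib_left)
  qed
next
  case (add f1 f2)
  from shrunk_ring.add[OF add.IH[OF add.prems]] show ?case by (simp add: distrib_right)
qed

lemma continuous_prod_over:
  assumes "\<And>k. continuous_on S (\<lambda>x. T x k)" shows "continuous_on S (\<lambda>x. prod_over (T x) ks)"
  by (induction ks) (auto intro: continuous_intros assms)

lemma continuous_shrunk_ring: "f \<in> shrunk_ring \<Longrightarrow> continuous_on S f"
  by (induction rule: shrunk_ring.induct)
     (auto simp: shrunk_monomial_def[abs_def] intro!: continuous_intros continuous_prod_over)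

lemma compact_shrunk_space: "compact shrunk_space"
proof -
  have "closed shrunk_space"
    unfolding shrunk_space_def
    by (intro closed_Collect_conj closed_Collect_all closed_Collect_le closed_sorted_vec continuous_intros)
  moreover have "bounded shrunk_space"
  proof (rule bounded_subset)
    show "shrunk_space \<subseteq> cbox (0, 0) (\<chi> i. 1, 1)"
      by (auto simp: shrunk_space_def cbox_Pair_eq mem_box_cart)
  qed simp
  ultimately show ?thesis by (simp add: compact_eq_bounded_closed)
qed

lemma function_ring_shrunk: "function_ring_on shrunk_ring shrunk_space"
proof
  show "compact shrunk_space" by (rule compact_shrunk_space)
  show "(\<lambda>_. c) \<in> shrunk_ring" for c
    using shrunk_ring.mono[of c 0 "[]"] by (simp add: shrunk_monomial_def)
  fix x y :: "(real^'n::{finite,linorder}) \<times> real"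
  assume x: "x \<in> shrunk_space" and y: "y \<in> shrunk_space" and xy: "x \<noteq> y"
  show "\<exists>f\<in>shrunk_ring. f x \<noteq> f y"
  proof (rule ccontr)
    assume "\<not> ?thesis"
    then have eq: "f x = f y" if "f \<in> shrunk_ring" for f using that by blast
    have "snd x = snd y" using eq[OF shrunk_ring.mono[of 1 1 "[]"]] by (simp add: shrunk_monomial_def)
    moreover have "power_sum k (fst x) = power_sum k (fst y)" for k
      using eq[OF shrunk_ring.mono[of 1 0 "[k]"]] by (simp add: shrunk_monomial_def)
    then have "fst x = fst y"
      using x y by (intro sorted_vec_unique entries_eqI) (auto simp: shrunk_space_def)
    ultimately show False using xy by (simp add: prod_eq_iff)
  qed
qed (auto intro: continuous_shrunk_ring shrunk_ring_mult shrunk_ring.add)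

lemma shrink_in_space:
  fixes x :: "real^'n::{finite,linorder}"
  assumes "sorted_vec x" "\<And>i. x $ i \<ge> 0" shows "shrink x \<in> shrunk_space"
proof -
  have p: "power_sum 1 x \<ge> 0" using assms by (auto simp: power_sum_def intro: sum_nonneg)
  have "x $ i \<le> exp (power_sum 1 x)" for i
  proof -
    have "x $ i \<le> power_sum 1 x" unfolding power_sum_def using assms by (simp add: member_le_sum)
    also have "\<dots> \<le> exp (power_sum 1 x)" using exp_ge_add_one_self[of "power_sum 1 x"] by linarith
    finally show ?thesis .
  qed
  then show ?thesis
    using assms p by (auto simp: shrunk_space_def shrink_def sorted_vec_def exp_minus field_simps)
qed

lemma power_sum_scale: "power_sum k (c *\<^sub>R x) = c ^ k * power_sum k x"
  by (simp add: power_sum_def power_mult_distrib sum_distrib_left)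

lemma prod_over_scale: "prod_over (\<lambda>k. c ^ k * T k) ks = c ^ sum_list ks * prod_over T ks"
  by (induction ks) (auto simp: power_add)

lemma shrunk_monomial_shrink:
  "shrunk_monomial s ks (shrink x) = exp (- real (s + sum_list ks) * power_sum 1 x) * prod_over (\<lambda>k. power_sum k x) ks"
proof -
  define c where "c = exp (- power_sum 1 x)"
  have "shrunk_monomial s ks (shrink x) = c ^ (s + sum_list ks) * prod_over (\<lambda>k. power_sum k x) ks"
  proof -
    have "shrink x = (c *\<^sub>R x, c)" by (simp add: shrink_def c_def)
    then show ?thesis by (simp add: shrunk_monomial_def power_sum_scale prod_over_scale power_add)
  qed
  also have "c ^ (s + sum_list ks) = exp (- real (s + sum_list ks) * power_sum 1 x)"
    unfolding c_def exp_of_nat_mult[symmetric] by (simp add: algebra_simps)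
  finally show ?thesis .
qed

lemma continuous_shrink[continuous_intros]: "continuous_on S f \<Longrightarrow> continuous_on S (\<lambda>x. shrink (f x))"
  unfolding shrink_def by (intro continuous_intros)

lemma shrink_measurable[measurable]: "shrink \<in> borel_measurable borel"
  by (intro borel_measurable_continuous_onI continuous_intros)

text \<open>The images under \<open>shrink\<close> live on a compact set and agree on an algebra that separates its points; \<open>shrink\<close> has a
measurable left inverse, so the measures themselves agree.\<close>
lemma measure_eqI_shrink:
  fixes M N :: "(real^'n::{finite,linorder}) measure"
  assumes fin: "finite_measure M" "finite_measure N" and sets: "sets M = sets borel" "sets N = sets borel"
    and K: "AE x in M. sorted_vec x \<and> (\<forall>i. x $ i \<ge> 0)" "AE x in N. sorted_vec x \<and> (\<forall>i. x $ i \<ge> 0)"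
    and intg: "\<And>s ks. integrable M (\<lambda>x. exp (- real s * power_sum 1 x) * prod_over (\<lambda>k. power_sum k x) ks)"
       "\<And>s ks. integrable N (\<lambda>x. exp (- real s * power_sum 1 x) * prod_over (\<lambda>k. power_sum k x) ks)"
    and eq: "\<And>s ks. integral\<^sup>L M (\<lambda>x. exp (- real s * power_sum 1 x) * prod_over (\<lambda>k. power_sum k x) ks) =
       integral\<^sup>L N (\<lambda>x. exp (- real s * power_sum 1 x) * prod_over (\<lambda>k. power_sum k x) ks)"
  shows "M = N"
proof -
  have [measurable_cong]: "sets M = sets borel" "sets N = sets borel" by fact+
  have dist: "distr M borel shrink = distr N borel shrink"
  proof (rule finite_measure_eqI_function_ring[OF function_ring_shrunk])
    show "finite_measure (distr M borel shrink)" "finite_measure (distr N borel shrink)"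
      by (auto intro!: finite_measure.finite_measure_distr fin)
    have [measurable]: "(shrunk_space :: ((real^'n::{finite,linorder}) \<times> real) set) \<in> sets borel"
      by (rule borel_closed[OF compact_imp_closed[OF compact_shrunk_space]])
    show "AE x in distr M borel shrink. x \<in> shrunk_space"
    proof (rule AE_distrI)
      show "AE x in M. shrink x \<in> shrunk_space" using K(1) by eventually_elim (simp add: shrink_in_space)
    qed auto
    show "AE x in distr N borel shrink. x \<in> shrunk_space"
    proof (rule AE_distrI)
      show "AE x in N. shrink x \<in> shrunk_space" using K(2) by eventually_elim (simp add: shrink_in_space)
    qed auto
    show "f \<in> borel_measurable borel" if "f \<in> shrunk_ring" for f
      using that by (intro borel_measurable_continuous_onI continuous_shrunk_ring)
    fix f :: "(real^'n::{finite,linorder}) \<times> real \<Rightarrow> real"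
    assume "f \<in> shrunk_ring"
    then have "integrable (distr M borel shrink) f \<and> integrable (distr N borel shrink) f \<and>
      integral\<^sup>L (distr M borel shrink) f = integral\<^sup>L (distr N borel shrink) f"
    proof (induction rule: shrunk_ring.induct)
      case (mono c s ks)
      have [measurable]: "shrunk_monomial s ks \<in> borel_measurable borel"
        using borel_measurable_continuous_onI[OF continuous_shrunk_ring[OF shrunk_ring.mono[of 1 s ks]]] by simp
      show ?case using intg[of "s + sum_list ks" ks] eq[of "s + sum_list ks" ks]
        by (simp add: integrable_distr_eq integral_distr shrunk_monomial_shrink del: of_nat_add)
    qed simp
    then show "integral\<^sup>L (distr M borel shrink) f = integral\<^sup>L (distr N borel shrink) f" by simp
  qed auto
  define un where "un = (\<lambda>p::(real^'n::{finite,linorder}) \<times> real. inverse (snd p) *\<^sub>R fst p)"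
  have [measurable]: "un \<in> borel_measurable borel"
    unfolding un_def by (intro borel_measurable_scaleR borel_measurable_inverse)
      (auto intro!: borel_measurable_continuous_onI continuous_intros)
  have inv: "un (shrink x) = x" for x by (simp add: un_def shrink_def)
  have "P = distr (distr P borel shrink) borel un" if [measurable_cong]: "sets P = sets borel" for P
  proof -
    have "distr (distr P borel shrink) borel un = distr P borel (\<lambda>x. x)"
      by (subst distr_distr) (auto simp: o_def inv)
    also have "\<dots> = P" using that by (intro distr_id2) simp
    finally show ?thesis by simp
  qed
  then show ?thesis using dist sets by metis
qed

section \<open>The eigenvalue law of a Gaussian Gram matrix\<close>

text \<open>Used to see that the total mass of the Laguerre weight is not zero.\<close>
lemma integral_nonzero_open:
  fixes f :: "'a::euclidean_space \<Rightarrow> real"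
  assumes "integrable lborel f" "\<And>x. 0 \<le> f x" "open U" "U \<noteq> {}" "\<And>x. x \<in> U \<Longrightarrow> f x > 0"
  shows "integral\<^sup>L lborel f > 0"
proof (rule ccontr)
  assume "\<not> ?thesis"
  moreover have "integral\<^sup>L lborel f \<ge> 0" using assms(2) by (intro integral_nonneg_AE) auto
  ultimately have "integral\<^sup>L lborel f = 0" by simp
  then have "AE x in lborel. f x = 0"
    using assms(1,2) by (subst (asm) integral_nonneg_eq_0_iff_AE) auto
  then have "AE x in lborel. x \<notin> U" by eventually_elim (use assms(5) in force)
  then have "U \<in> null_sets lborel" using assms(3) AE_iff_null_sets[of U lborel] by simp
  then have "negligible U" by (simp add: negligible_iff_null_sets null_sets_completionI)
  then show False using open_not_negligible assms(3,4) by blast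
qed

lemma laguerre_weight_nonneg: "0 \<le> laguerre_weight a b x"
  by (auto simp: laguerre_weight_def laguerre_def intro!: mult_nonneg_nonneg prod_nonneg)

lemma laguerre_pos: "t > 0 \<Longrightarrow> laguerre a b t > 0"
  by (simp add: laguerre_def)

lemma laguerre_moment_pos:
  assumes a: "a \<ge> 0" and b: "b > 0"
  shows "laguerre_moment TYPE('n::{finite,linorder}) a b [] > 0"
proof -
  define U where "U = {x::real^'n::{finite,linorder}. (\<forall>i. x $ i > 0) \<and> (\<forall>i j. i < j \<longrightarrow> x $ i < x $ j)}"
  have "integral\<^sup>L lborel (laguerre_weight a b :: real^'n::{finite,linorder} \<Rightarrow> real) > 0"
  proof (rule integral_nonzero_open[where U=U])
    show "integrable lborel (laguerre_weight a b :: real^'n::{finite,linorder} \<Rightarrow> real)"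
      using laguerre_weight_integrable[OF a b, of "\<lambda>_. 1"] by auto
    have "U = (\<Inter>i. {x. x $ i > 0}) \<inter> (\<Inter>i. \<Inter>j\<in>{i<..}. {x. x $ i < x $ j})" by (auto simp: U_def)
    also have "open \<dots>" by (intro open_Int open_INT ballI open_Collect_less continuous_intros) auto
    finally show "open U" .
    have "(\<chi> i. real (card {..i})) \<in> U"
      by (auto simp: U_def card_gt_0_iff intro!: psubset_card_mono)
    then show "U \<noteq> {}" by auto
    fix x assume x: "x \<in> U"
    then have "x $ snd p - x $ fst p \<noteq> 0" if "p \<in> pairs" for p
    proof -
      have "x $ fst p < x $ snd p" using x that by (auto simp: U_def)
      then show ?thesis by simp
    qed
    then have "\<bar>vandermonde x\<bar> > 0" by (auto simp: vandermonde_abs intro!: prod_pos)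
    moreover have "(\<Prod>i\<in>UNIV. laguerre a b (x $ i)) > 0" using x by (intro prod_pos ballI laguerre_pos) (auto simp: U_def)
    ultimately show "laguerre_weight a b x > 0" by (simp add: laguerre_weight_def)
  qed (rule laguerre_weight_nonneg)
  then show ?thesis by (simp add: laguerre_moment_def)
qed

lemma vandermonde_permute:
  fixes x :: "real^'n::{finite,linorder}" and \<sigma> :: "'n \<Rightarrow> 'n"
  assumes "bij \<sigma>"
  shows "\<bar>vandermonde (\<chi> i. x $ \<sigma> i)\<bar> = \<bar>vandermonde x\<bar>"
proof -
  define s where "s p = (if \<sigma> (fst p) < \<sigma> (snd p) then (\<sigma> (fst p), \<sigma> (snd p)) else (\<sigma> (snd p), \<sigma> (fst p)))" for p
  have inj: "\<sigma> i = \<sigma> j \<longleftrightarrow> i = j" for i j using assms by (simp add: bij_def inj_eq)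
  have "inj_on s pairs"
    by (auto simp: inj_on_def s_def inj split: if_splits)
  moreover have "s ` pairs \<subseteq> pairs" by (auto simp: s_def inj not_less order.order_iff_strict)
  ultimately have bij: "bij_betw s pairs pairs" by (simp add: bij_betw_def endo_inj_surj)
  have "\<bar>vandermonde (\<chi> i. x $ \<sigma> i)\<bar> = (\<Prod>p\<in>pairs. \<bar>x $ snd (s p) - x $ fst (s p)\<bar>)"
    unfolding vandermonde_abs by (intro prod.cong refl) (auto simp: s_def abs_minus_commute)
  also have "\<dots> = \<bar>vandermonde x\<bar>"
    unfolding vandermonde_abs using prod.reindex_bij_betw[OF bij, of "\<lambda>p. \<bar>x $ snd p - x $ fst p\<bar>"] .
  finally show ?thesis .
qed

lemma transpose_diag_mat[simp]: "transpose (diag_mat d) = diag_mat d"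
  by (auto simp: transpose_def diag_mat_def vec_eq_iff)

lemma entries_spectrum_diag: "entries (spectrum (diag_mat x)) = entries x"
  using spectrum(2)[of "diag_mat x"] eigenvalues_diag[of x] by simp

lemma power_sum_entries_cong: "entries x = entries y \<Longrightarrow> power_sum k x = power_sum k y"
  by (simp add: power_sum_entries)

lemma spectrum_gram_measurable[measurable]:
  "(\<lambda>X::real^'m^'n::{finite,linorder}. spectrum (gram X)) \<in> borel_measurable borel"
proof (intro borel_measurable_continuous_onI continuous_spectrum)
  have "continuous_on UNIV (\<lambda>X::real^'m^'n::{finite,linorder}. transpose X)"
    unfolding transpose_def by (intro continuous_on_vec_lambda continuous_intros)
  then show "continuous_on UNIV (\<lambda>X::real^'m^'n::{finite,linorder}. gram X)"
    by (intro continuous_matrix_mult continuous_on_id)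
qed simp

lemma spectrum_diag_measurable[measurable]:
  "(\<lambda>x::real^'n::{finite,linorder}. spectrum (diag_mat x)) \<in> borel_measurable borel"
proof (intro borel_measurable_continuous_onI continuous_spectrum)
  have "continuous_on UNIV (\<lambda>x::real^'n::{finite,linorder}. if i = j then x $ i else 0)" for i j :: 'n
    by (cases "i = j") (auto intro!: continuous_intros)
  then show "continuous_on UNIV (diag_mat :: real^'n::{finite,linorder} \<Rightarrow> _)"
    unfolding diag_mat_def by (intro continuous_on_vec_lambda)
qed simp

lemma spectrum_gram_nonneg: "spectrum (gram X) $ i \<ge> 0"
proof (rule spectrum_nonneg)
  show "x \<bullet> (gram X *v x) \<ge> 0" for x
    by (simp add: matrix_vector_mul_assoc[symmetric] inner_matrix_vector[of x X])
qed simp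

lemma power_sum_1_gram: "power_sum 1 (spectrum (gram X)) = X \<bullet> X"
  unfolding power_sum_spectrum[OF transpose_gram] One_nat_def matpow.simps matrix_mul_rid
  by (simp add: trace_def matrix_matrix_mult_def transpose_def inner_vec_def)

lemma laguerre_weight_shift: "laguerre_weight a (b + s) x = exp (- s * power_sum 1 x) * laguerre_weight a b x"
proof -
  have "(\<Prod>i\<in>UNIV. laguerre a (b + s) (x $ i)) = (\<Prod>i\<in>UNIV. exp (- s * x $ i) * laguerre a b (x $ i))"
    by (intro prod.cong) (auto simp: laguerre_def exp_add[symmetric] algebra_simps)
  also have "\<dots> = exp (- s * power_sum 1 x) * (\<Prod>i\<in>UNIV. laguerre a b (x $ i))"
    by (simp add: prod.distrib exp_sum[symmetric] power_sum_def sum_distrib_left)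
  finally show ?thesis by (simp add: laguerre_weight_def)
qed

lemma laguerre_weight_measurable[measurable]: "laguerre_weight a b \<in> borel_measurable borel"
  unfolding laguerre_weight_def[abs_def] by measurable

lemma closed_nonneg_sorted: "closed {x::real^'n::{finite,linorder}. sorted_vec x \<and> (\<forall>i. 0 \<le> x $ i)}"
  by (intro closed_Collect_conj closed_Collect_all closed_Collect_le closed_sorted_vec continuous_intros)

text \<open>The image of Lebesgue measure on matrices under the map to the eigenvalues of \<open>X X\<^sup>T\<close>. Both sides are made finite with the factor
\<open>exp (- p\<^sub>1 / 2)\<close>, which is a function of the eigenvalues and can be divided out again. The right side
is symmetrised by sorting, that is, by taking the spectrum of a diagonal matrix.\<close>
theorem gram_eigenvalue_law:
  assumes MN: "CARD('m::finite) > CARD('n::{finite,linorder})"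
  defines "a \<equiv> (real CARD('m) - real CARD('n) - 1) / 2"
  shows "\<exists>C>0. \<forall>F :: real^'n::{finite,linorder} \<Rightarrow> ennreal. F \<in> borel_measurable borel \<longrightarrow>
     (\<forall>\<sigma> x. bij \<sigma> \<longrightarrow> F (\<chi> i. x $ \<sigma> i) = F x) \<longrightarrow>
     (\<integral>\<^sup>+ X. F (spectrum (gram (X::real^'m^'n::{finite,linorder}))) \<partial>lborel) = (\<integral>\<^sup>+ x. F x * ennreal (C * laguerre_weight a 0 x) \<partial>lborel)"
proof -
  have a: "a \<ge> 0" using MN by (simp add: a_def)
  let ?G = "gauss_moment TYPE('m) TYPE('n)" and ?E = "laguerre_moment TYPE('n) a"
  have c_eq: "2 * a + 1 = real CARD('m) - real CARD('n)" by (simp add: a_def field_simps)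
  define C where "C = pi powr (real CARD('n) * real CARD('m) / 2) / ?E 1 []"
  have C: "C > 0" using laguerre_moment_pos[where 'n='n, OF a, of 1] by (simp add: C_def)
  have GE: "?G \<beta> ks = C * ?E \<beta> ks" if \<beta>: "\<beta> > 0" for \<beta> ks
  proof -
    have "real CARD('n) * (real CARD('n) + 1 + 2 * a) / 2 = real CARD('n) * real CARD('m) / 2"
      by (simp add: a_def field_simps)
    then have "?G \<beta> [] = C * ?E \<beta> []"
      using gauss_moment_Nil[OF \<beta>, where 'm='m and 'n='n] laguerre_moment_scaling[OF \<beta>, where 'n='n and a=a]
         laguerre_moment_pos[where 'n='n, OF a, of 1] \<beta>
      by (simp add: C_def powr_divide powr_minus_divide)
    moreover have "?G \<beta> ks * ?E \<beta> [] = ?E \<beta> ks * ?G \<beta> []"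
    proof (rule loop_equations_unique)
      show "loop_equations (real CARD('n)) (real CARD('m) - real CARD('n)) (2 * \<beta>) (?G \<beta>)"
        by (rule gauss_loop_equations[OF \<beta>])
      show "loop_equations (real CARD('n)) (real CARD('m) - real CARD('n)) (2 * \<beta>) (?E \<beta>)"
        using laguerre_loop_equations[OF a \<beta>, where 'n='n]
        by (subst (asm) c_eq)
    qed (use \<beta> in simp)
    moreover have "?E \<beta> [] > 0" by (rule laguerre_moment_pos[OF a \<beta>])
    ultimately show ?thesis by simp
  qed
  define M where "M = density lborel (\<lambda>X::real^'m^'n::{finite,linorder}. ennreal (exp (- (1/2) * (X \<bullet> X))))"
  define N where "N = density lborel (\<lambda>x::real^'n::{finite,linorder}. ennreal (C * laguerre_weight a (1/2) x))"
  have intN: "integrable lborel (\<lambda>x::real^'n::{finite,linorder}. C * laguerre_weight a (1/2) x)"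
    using laguerre_weight_integrable[OF a, of "1/2" "\<lambda>_. C"] by auto
  have finM: "finite_measure M"
    unfolding M_def using gaussian_integral(1)[of "1/2", where 'a="real^'m^'n::{finite,linorder}"]
    by (intro finite_measureI) (simp add: emeasure_density nn_integral_eq_integral)
  have finN: "finite_measure N"
  proof (rule finite_measureI)
    have "(\<integral>\<^sup>+ x. ennreal (C * laguerre_weight a (1/2) (x::real^'n::{finite,linorder})) \<partial>lborel) = ennreal (integral\<^sup>L lborel (\<lambda>x::real^'n::{finite,linorder}. C * laguerre_weight a (1/2) x))"
      by (rule nn_integral_eq_integral[OF intN]) (auto intro!: AE_I2 mult_nonneg_nonneg less_imp_le[OF C] laguerre_weight_nonneg)
    then show "emeasure N (space N) \<noteq> \<infinity>" by (simp add: N_def emeasure_density)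
  qed
  have sM[measurable_cong]: "sets M = sets borel" and sN[measurable_cong]: "sets N = sets borel" by (simp_all add: M_def N_def)
  let ?f = "\<lambda>X::real^'m^'n::{finite,linorder}. spectrum (gram X)" and ?g = "\<lambda>x::real^'n::{finite,linorder}. spectrum (diag_mat x)"
  have polym: "(\<lambda>x. exp (- real s * power_sum 1 x) * prod_over (\<lambda>k. power_sum k x) ks) \<in> borel_measurable borel" for s ks
    by (intro borel_measurable_continuous_onI continuous_intros continuous_prod_over)
  have pos: "AE x in N. \<forall>i. x $ i > 0"
    unfolding N_def by (subst AE_density) (auto intro!: AE_I2 laguerre_weight_nonzero(1)[of a "1/2"] simp: C)
  have IM: "has_bochner_integral M (\<lambda>X. exp (- real s * power_sum 1 (?f X)) * prod_over (\<lambda>k. power_sum k (?f X)) ks) (?G (1/2 + real s) ks)" for s ks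
  proof -
    have "integrable lborel (\<lambda>X::real^'m^'n::{finite,linorder}. prod_over (\<lambda>m. trace (matpow (gram X) m)) ks * exp (- (1/2 + real s) * (X \<bullet> X)))"
      by (intro gaussian_polynomial_integrable real_polynomial_prod_over_gram) auto
    moreover have "exp (- (1/2) * (X \<bullet> X)) *\<^sub>R (exp (- real s * power_sum 1 (?f X)) * prod_over (\<lambda>k. power_sum k (?f X)) ks) =
        prod_over (\<lambda>m. trace (matpow (gram X) m)) ks * exp (- (1/2 + real s) * (X \<bullet> X))" for X
      unfolding power_sum_1_gram by (simp add: power_sum_spectrum exp_add[symmetric] algebra_simps)
    ultimately show ?thesis
      unfolding M_def using measurable_compose[OF spectrum_gram_measurable polym[of s ks]]
      by (intro has_bochner_integral_density) (auto simp: has_bochner_integral_iff gauss_moment_def)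
  qed
  have IN: "has_bochner_integral N (\<lambda>x. exp (- real s * power_sum 1 (?g x)) * prod_over (\<lambda>k. power_sum k (?g x)) ks) (C * ?E (1/2 + real s) ks)" for s ks
  proof -
    have "integrable lborel (\<lambda>x::real^'n::{finite,linorder}. prod_over (\<lambda>m. power_sum m x) ks * laguerre_weight a (1/2 + real s) x)"
      by (intro laguerre_weight_integrable real_polynomial_prod_over_power_sum a) auto
    then have hb: "has_bochner_integral lborel (\<lambda>x::real^'n::{finite,linorder}. C * (prod_over (\<lambda>m. power_sum m x) ks * laguerre_weight a (1/2 + real s) x)) (C * ?E (1/2 + real s) ks)"
      by (auto simp: has_bochner_integral_iff laguerre_moment_def)
    have eq: "(C * laguerre_weight a (1/2) x) *\<^sub>R (exp (- real s * power_sum 1 (?g x)) * prod_over (\<lambda>k. power_sum k (?g x)) ks) =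
        C * (prod_over (\<lambda>m. power_sum m x) ks * laguerre_weight a (1/2 + real s) x)" for x
      unfolding power_sum_entries_cong[OF entries_spectrum_diag] laguerre_weight_shift by simp
    show ?thesis
      unfolding N_def
    proof (rule has_bochner_integral_density)
      show "has_bochner_integral lborel (\<lambda>x. (C * laguerre_weight a (1/2) x) *\<^sub>R (exp (- real s * power_sum 1 (?g x)) * prod_over (\<lambda>k. power_sum k (?g x)) ks)) (C * ?E (1/2 + real s) ks)"
        unfolding eq by (rule hb)
      show "(\<lambda>x. exp (- real s * power_sum 1 (?g x)) * prod_over (\<lambda>k. power_sum k (?g x)) ks) \<in> borel_measurable lborel"
        using measurable_compose[OF spectrum_diag_measurable polym[of s ks]] by simp
    qed (auto intro!: AE_I2 mult_nonneg_nonneg less_imp_le[OF C] laguerre_weight_nonneg)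
  qed
  have law: "distr M borel ?f = distr N borel ?g"
  proof (rule measure_eqI_shrink)
    show "finite_measure (distr M borel ?f)" "finite_measure (distr N borel ?g)"
      using finM finN by (auto intro!: finite_measure.finite_measure_distr)
    show "AE x in distr M borel ?f. sorted_vec x \<and> (\<forall>i. x $ i \<ge> 0)"
    proof (rule AE_distrI)
      show "AE x in M. sorted_vec (?f x) \<and> (\<forall>i. ?f x $ i \<ge> 0)" by (auto intro!: AE_I2 spectrum spectrum_gram_nonneg)
    qed (simp_all add: borel_closed closed_nonneg_sorted)
    show "AE x in distr N borel ?g. sorted_vec x \<and> (\<forall>i. x $ i \<ge> 0)"
    proof (rule AE_distrI)
      have "sorted_vec (?g x) \<and> (\<forall>i. ?g x $ i \<ge> 0)" if x: "\<forall>i. x $ i > 0" for x :: "real^'n::{finite,linorder}"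
      proof -
        obtain \<sigma> where "?g x = (\<chi> i. x $ \<sigma> i)" using entries_eq_permute[OF entries_spectrum_diag[symmetric]] by metis
        then show ?thesis using x spectrum(1)[of "diag_mat x"] by (auto intro: less_imp_le)
      qed
      then show "AE x in N. sorted_vec (?g x) \<and> (\<forall>i. ?g x $ i \<ge> 0)" using pos by auto
    qed (simp_all add: borel_closed closed_nonneg_sorted)
    fix s ks
    show "integrable (distr M borel ?f) (\<lambda>x. exp (- real s * power_sum 1 x) * prod_over (\<lambda>k. power_sum k x) ks)"
      using IM[of s ks] polym[of s ks] by (subst integrable_distr_eq) (auto simp: has_bochner_integral_iff)
    show "integrable (distr N borel ?g) (\<lambda>x. exp (- real s * power_sum 1 x) * prod_over (\<lambda>k. power_sum k x) ks)"
      using IN[of s ks] polym[of s ks] by (subst integrable_distr_eq) (auto simp: has_bochner_integral_iff)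
    show "integral\<^sup>L (distr M borel ?f) (\<lambda>x. exp (- real s * power_sum 1 x) * prod_over (\<lambda>k. power_sum k x) ks) =
      integral\<^sup>L (distr N borel ?g) (\<lambda>x. exp (- real s * power_sum 1 x) * prod_over (\<lambda>k. power_sum k x) ks)"
      using IM[of s ks] IN[of s ks] polym[of s ks] GE[of "1/2 + real s" ks]
      by (subst (1 2) integral_distr) (auto simp: has_bochner_integral_iff)
  qed auto
  show ?thesis
  proof (intro exI[of _ C] conjI allI impI)
    show "C > 0" by (rule C)
    fix F :: "real^'n::{finite,linorder} \<Rightarrow> ennreal"
    assume F[measurable]: "F \<in> borel_measurable borel" and sym: "\<forall>\<sigma> x. bij \<sigma> \<longrightarrow> F (\<chi> i. x $ \<sigma> i) = F x"
    have Fg: "F (?g x) = F x" for x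
    proof -
      obtain \<sigma> where "bij \<sigma>" "?g x = (\<chi> i. x $ \<sigma> i)" using entries_eq_permute[OF entries_spectrum_diag[symmetric]] by metis
      then show ?thesis using sym by simp
    qed
    \<comment> \<open>The exponential cancels the one in the finite measures above.\<close>
  define F' where "F' x = F x * ennreal (exp (1/2 * power_sum 1 x))" for x
    have [measurable]: "(\<lambda>x. power_sum 1 x) \<in> borel_measurable borel"
      by (intro borel_measurable_continuous_onI continuous_intros)
    have [measurable]: "F' \<in> borel_measurable borel" unfolding F'_def[abs_def] by measurable
    have "(\<integral>\<^sup>+ x. F' x \<partial>distr M borel ?f) = (\<integral>\<^sup>+ X. ennreal (exp (- (1/2) * (X \<bullet> X))) * F' (?f X) \<partial>lborel)"
      by (subst nn_integral_distr) (auto simp: M_def nn_integral_density)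
    also have "\<dots> = (\<integral>\<^sup>+ X. F (?f X) \<partial>lborel)"
      unfolding F'_def power_sum_1_gram by (intro nn_integral_cong) (simp add: mult_ac ennreal_mult[symmetric] exp_add[symmetric])
    finally have 1: "(\<integral>\<^sup>+ x. F' x \<partial>distr M borel ?f) = (\<integral>\<^sup>+ X. F (?f X) \<partial>lborel)" .
    have "(\<integral>\<^sup>+ x. F' x \<partial>distr N borel ?g) = (\<integral>\<^sup>+ x. ennreal (C * laguerre_weight a (1/2) x) * F' (?g x) \<partial>lborel)"
      by (subst nn_integral_distr) (auto simp: N_def nn_integral_density)
    also have "\<dots> = (\<integral>\<^sup>+ x. F x * ennreal (C * laguerre_weight a 0 x) \<partial>lborel)"
    proof (intro nn_integral_cong)
      fix x :: "real^'n::{finite,linorder}"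
      have "C * laguerre_weight a (1/2) x * exp (1/2 * power_sum 1 x) = C * laguerre_weight a 0 x"
        using laguerre_weight_shift[of a 0 "1/2" x] by (simp add: exp_add[symmetric] mult_ac)
      then show "ennreal (C * laguerre_weight a (1/2) x) * F' (?g x) = F x * ennreal (C * laguerre_weight a 0 x)"
        using C laguerre_weight_nonneg[of a "1/2" x]
        by (simp only: F'_def Fg power_sum_entries_cong[OF entries_spectrum_diag]) (simp add: mult_ac ennreal_mult[symmetric])
    qed
    finally show "(\<integral>\<^sup>+ X. F (?f X) \<partial>lborel) = (\<integral>\<^sup>+ x. F x * ennreal (C * laguerre_weight a 0 x) \<partial>lborel)"
      using 1 law by simp
  qed
qed

section \<open>The law of a Wishart data matrix and orthogonal invariance\<close>

definition from_columns :: "('m \<Rightarrow> real^'n) \<Rightarrow> real^'m^'n" where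
  "from_columns g = (\<chi> r c. g c $ r)"

lemma from_columns_measurable[measurable]:
  "from_columns \<in> borel_measurable (Pi\<^sub>M UNIV (\<lambda>_::'m::finite. borel :: (real^'n::finite) measure))"
proof -
  have "(\<lambda>g. from_columns g $ r $ c) \<in> borel_measurable (Pi\<^sub>M UNIV (\<lambda>_::'m. borel :: (real^'n) measure))" for r c
  proof -
    have "(\<lambda>x. x $ r) \<in> borel_measurable (borel :: (real^'n) measure)"
      by (intro borel_measurable_continuous_onI continuous_intros)
    from measurable_compose[OF measurable_component_singleton[of c UNIV] this]
    show ?thesis by (simp add: from_columns_def)
  qed
  then show ?thesis
    by (subst borel_measurable_euclidean_space) (auto simp: Basis_vec_def inner_axis)
qed

lemma matrix_Basis: "(Basis :: (real^'m^'n) set) = (\<lambda>(r, c). axis r (axis c 1)) ` UNIV"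
  by (auto simp: Basis_vec_def image_iff)

lemma inj_matrix_unit: "inj (\<lambda>(r, c). axis r (axis c (1::real)))"
  by (auto simp: inj_on_def axis_eq_axis)

lemma matrix_prod_Basis: "(\<Prod>b\<in>(Basis::(real^'m^'n) set). f b) = (\<Prod>c\<in>UNIV. \<Prod>r\<in>UNIV. f (axis r (axis c 1)))"
proof -
  have "(\<Prod>b\<in>(Basis::(real^'m^'n) set). f b) = (\<Prod>p\<in>UNIV. f (axis (fst p) (axis (snd p) 1)))"
    unfolding matrix_Basis by (subst prod.reindex[OF inj_matrix_unit]) (simp add: split_def)
  also have "\<dots> = (\<Prod>r\<in>UNIV. \<Prod>c\<in>UNIV. f (axis r (axis c 1)))"
    by (simp add: prod.cartesian_product split_def flip: UNIV_Times_UNIV)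
  also have "\<dots> = (\<Prod>c\<in>UNIV. \<Prod>r\<in>UNIV. f (axis r (axis c 1)))" by (rule prod.swap)
  finally show ?thesis .
qed

lemma vec_prod_Basis: "(\<Prod>b\<in>(Basis::(real^'n) set). f b) = (\<Prod>r\<in>UNIV. f (axis r 1))"
proof -
  have "(\<Prod>b\<in>(Basis::(real^'n) set). f b) = (\<Prod>b\<in>range (\<lambda>r. axis r 1). f b)"
    by (rule prod.cong) (auto simp: Basis_vec_def)
  also have "\<dots> = (\<Prod>r\<in>UNIV. f (axis r 1))"
    by (subst prod.reindex) (auto simp: inj_on_def axis_eq_axis)
  finally show ?thesis .
qed

text \<open>The columns are independent random vectors, while the Euclidean structure of a matrix lists its entries by rows.\<close>
lemma lborel_from_columns:
  "distr (Pi\<^sub>M UNIV (\<lambda>_::'m::finite. lborel :: (real^'n::finite) measure)) borel from_columns = lborel"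
proof (rule lborel_eqI[symmetric])
  interpret product_sigma_finite "\<lambda>_::'m. lborel :: (real^'n) measure" ..
  fix l u :: "real^'m^'n" assume lu: "\<And>b. b \<in> Basis \<Longrightarrow> l \<bullet> b \<le> u \<bullet> b"
  have lu': "l $ r $ c \<le> u $ r $ c" for r c
  proof -
    have "axis r (axis c 1) \<in> (Basis :: (real^'m^'n) set)" by (auto simp: Basis_vec_def)
    from lu[OF this] show ?thesis by (simp add: inner_axis)
  qed
  have [measurable]: "from_columns \<in> borel_measurable (Pi\<^sub>M UNIV (\<lambda>_::'m::finite. lborel :: (real^'n::finite) measure))"
    using from_columns_measurable by (simp cong: measurable_cong_sets sets_PiM_cong)
  have "from_columns -` box l u \<inter> space (Pi\<^sub>M UNIV (\<lambda>_::'m. lborel :: (real^'n) measure)) =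
    Pi\<^sub>E UNIV (\<lambda>c. box (\<chi> r. l $ r $ c) (\<chi> r. u $ r $ c))"
    by (auto simp: space_PiM box_def from_columns_def Basis_vec_def inner_axis PiE_UNIV_domain)
  then have "emeasure (distr (Pi\<^sub>M UNIV (\<lambda>_::'m. lborel :: (real^'n) measure)) borel from_columns) (box l u)
      = (\<Prod>c\<in>UNIV. emeasure lborel (box (\<chi> r. l $ r $ c) (\<chi> r. u $ r $ c) :: (real^'n) set))"
    by (subst emeasure_distr) (auto simp: emeasure_PiM)
  also have "\<dots> = (\<Prod>c\<in>UNIV. ennreal (\<Prod>r\<in>UNIV. u $ r $ c - l $ r $ c))"
  proof (intro prod.cong refl)
    fix c
    show "emeasure lborel (box (\<chi> r. l $ r $ c) (\<chi> r. u $ r $ c) :: (real^'n) set) = ennreal (\<Prod>r\<in>UNIV. u $ r $ c - l $ r $ c)"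
    proof (subst emeasure_lborel_box)
      show "(\<chi> r. l $ r $ c) \<bullet> b \<le> (\<chi> r. u $ r $ c) \<bullet> b" if "b \<in> Basis" for b :: "real^'n"
        using that lu' by (auto simp: Basis_vec_def inner_axis)
    qed (simp add: vec_prod_Basis inner_axis)
  qed
  also have "\<dots> = ennreal (\<Prod>b\<in>Basis. (u - l) \<bullet> b)"
    using lu' by (simp add: prod_ennreal prod_nonneg matrix_prod_Basis inner_axis)
  finally show "emeasure (distr (Pi\<^sub>M UNIV (\<lambda>_::'m. lborel :: (real^'n) measure)) borel from_columns) (box l u)
     = ennreal (\<Prod>b\<in>Basis. (u - l) \<bullet> b)" .
qed simp

lemma density_from_columns:
  fixes f :: "real^'n::finite \<Rightarrow> ennreal"
  assumes f[measurable]: "f \<in> borel_measurable borel" and sf: "sigma_finite_measure (density lborel f)"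
  shows "distr (Pi\<^sub>M UNIV (\<lambda>_::'m::finite. density lborel f)) borel from_columns =
    density lborel (\<lambda>X. \<Prod>c\<in>UNIV. f (column c X))"
proof -
  interpret L: product_sigma_finite "\<lambda>_::'m. lborel :: (real^'n) measure" ..
  interpret D: product_sigma_finite "\<lambda>_::'m. density lborel f" by (simp add: product_sigma_finite_def sf)
  let ?L = "Pi\<^sub>M UNIV (\<lambda>_::'m. lborel :: (real^'n) measure)"
  let ?F = "\<lambda>g::'m \<Rightarrow> real^'n. \<Prod>c\<in>UNIV. f (g c)"
  have "density ?L ?F = Pi\<^sub>M UNIV (\<lambda>_::'m. density lborel f)"
  proof (rule D.PiM_eqI)
    fix A :: "'m \<Rightarrow> (real^'n) set" assume "\<And>i. i \<in> UNIV \<Longrightarrow> A i \<in> sets (density lborel f)"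
    then have A[measurable]: "A i \<in> sets borel" for i by simp
    have PA: "Pi\<^sub>E UNIV A \<in> sets ?L" by (intro sets_PiM_I_finite) auto
    have "emeasure (density ?L ?F) (Pi\<^sub>E UNIV A) = (\<integral>\<^sup>+ g. ?F g * indicator (Pi\<^sub>E UNIV A) g \<partial>?L)"
      using PA by (subst emeasure_density) auto
    also have "\<dots> = (\<integral>\<^sup>+ g. (\<Prod>c\<in>UNIV. f (g c) * indicator (A c) (g c)) \<partial>?L)"
    proof (intro nn_integral_cong)
      fix g :: "'m \<Rightarrow> real^'n"
      have "(\<Prod>c\<in>UNIV. indicator (A c) (g c)) = (indicator (Pi\<^sub>E UNIV A) g :: ennreal)"
      proof (cases "g \<in> Pi\<^sub>E UNIV A")
        case False
        then obtain c where "g c \<notin> A c" by (auto simp: PiE_UNIV_domain)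
        then have "(\<Prod>c\<in>UNIV. indicator (A c) (g c)) = (0 :: ennreal)" by (intro prod_zero bexI[of _ c]) auto
        then show ?thesis using False by simp
      qed (auto simp: PiE_UNIV_domain Pi_def)
      then show "?F g * indicator (Pi\<^sub>E UNIV A) g = (\<Prod>c\<in>UNIV. f (g c) * indicator (A c) (g c))"
        by (simp add: prod.distrib)
    qed
    also have "\<dots> = (\<Prod>c\<in>UNIV. \<integral>\<^sup>+ x. f x * indicator (A c) x \<partial>lborel)"
      by (rule L.product_nn_integral_prod) auto
    also have "\<dots> = (\<Prod>c\<in>UNIV. emeasure (density lborel f) (A c))"
      by (simp add: emeasure_density)
    finally show "emeasure (density ?L ?F) (Pi\<^sub>E UNIV A) = (\<Prod>c\<in>UNIV. emeasure (density lborel f) (A c))" .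
  qed (auto cong: sets_PiM_cong)
  moreover have [measurable]: "from_columns \<in> borel_measurable ?L"
    using from_columns_measurable by (simp cong: measurable_cong_sets sets_PiM_cong)
  have colm[measurable]: "(\<lambda>X::real^'m^'n. column c X) \<in> borel_measurable borel" for c
    unfolding column_def by (intro borel_measurable_continuous_onI continuous_on_vec_lambda continuous_intros)
  have "distr (density ?L ?F) borel from_columns = density (distr ?L borel from_columns) (\<lambda>X. \<Prod>c\<in>UNIV. f (column c X))"
  proof (rule measure_eqI)
    fix A assume "A \<in> sets (distr (density ?L ?F) borel from_columns)"
    then have [measurable]: "A \<in> sets borel" by simp
    have col: "column c (from_columns g) = g c" for c and g :: "'m \<Rightarrow> real^'n"
      by (simp add: column_def from_columns_def vec_eq_iff)
    show "emeasure (distr (density ?L ?F) borel from_columns) A = emeasure (density (distr ?L borel from_columns) (\<lambda>X. \<Prod>c\<in>UNIV. f (column c X))) A"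
      by (simp add: emeasure_distr emeasure_density nn_integral_distr col measurable_sets[of from_columns ?L borel A] measurable_space)
         (intro nn_integral_cong, auto simp: indicator_def col)
  qed simp
  ultimately show ?thesis by (simp add: lborel_from_columns)
qed

lemma real_wishart_law:
  fixes X :: "'a \<Rightarrow> real^'m^'n"
  assumes "real_wishart \<Omega> C X S"
  defines "f \<equiv> \<lambda>x::real^'n. ennreal (multivariate_normal_density 0 C x)"
  shows "X \<in> borel_measurable \<Omega>" "distr \<Omega> borel X = density lborel (\<lambda>X. \<Prod>c\<in>UNIV. f (column c X))"
proof -
  interpret prob_space \<Omega> using assms by (simp add: real_wishart_def)
  have ind: "indep_vars (\<lambda>_. borel) (\<lambda>k \<omega>. column k (X \<omega>)) UNIV"
    and dis: "\<And>k. distributed \<Omega> lborel (\<lambda>\<omega>. column k (X \<omega>)) f"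
    using assms by (auto simp: real_wishart_def f_def)
  have colm[measurable]: "(\<lambda>\<omega>. column k (X \<omega>)) \<in> borel_measurable \<Omega>" for k
    using distributed_measurable[OF dis, of k] by simp
  have fm[measurable]: "f \<in> borel_measurable borel"
    using distributed_borel_measurable[OF dis] by simp
  have Xeq: "X \<omega> = from_columns (\<lambda>k\<in>UNIV. column k (X \<omega>))" for \<omega>
    by (simp add: from_columns_def column_def vec_eq_iff)
  have pm: "(\<lambda>\<omega>. \<lambda>k\<in>UNIV. column k (X \<omega>)) \<in> measurable \<Omega> (Pi\<^sub>M UNIV (\<lambda>_::'m. borel :: (real^'n) measure))"
    by (rule measurable_restrict) simp
  show Xm: "X \<in> borel_measurable \<Omega>"
    using measurable_compose[OF pm from_columns_measurable] by (simp flip: Xeq)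
  have d: "distr \<Omega> borel (\<lambda>\<omega>. column k (X \<omega>)) = density lborel f" for k
  proof -
    have "distr \<Omega> borel (\<lambda>\<omega>. column k (X \<omega>)) = distr \<Omega> lborel (\<lambda>\<omega>. column k (X \<omega>))"
      by (rule distr_cong) auto
    then show ?thesis using distributed_distr_eq_density[OF dis] by simp
  qed
  have "prob_space (distr \<Omega> borel (\<lambda>\<omega>. column (undefined::'m) (X \<omega>)))" by (rule prob_space_distr) simp
  then have sf: "sigma_finite_measure (density lborel f)"
    unfolding d by (simp add: prob_space_imp_sigma_finite)
  have "distr \<Omega> borel X = distr (distr \<Omega> (Pi\<^sub>M UNIV (\<lambda>_::'m. borel :: (real^'n) measure)) (\<lambda>\<omega>. \<lambda>k\<in>UNIV. column k (X \<omega>))) borel from_columns"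
    by (subst distr_distr[OF from_columns_measurable pm]) (simp add: o_def flip: Xeq)
  also have "distr \<Omega> (Pi\<^sub>M UNIV (\<lambda>_::'m. borel :: (real^'n) measure)) (\<lambda>\<omega>. \<lambda>k\<in>UNIV. column k (X \<omega>))
     = Pi\<^sub>M UNIV (\<lambda>k::'m. distr \<Omega> borel (\<lambda>\<omega>. column k (X \<omega>)))"
    using ind by (subst (asm) indep_vars_iff_distr_eq_PiM) auto
  also have "\<dots> = Pi\<^sub>M UNIV (\<lambda>_::'m. density lborel f)" by (simp add: d)
  finally show "distr \<Omega> borel X = density lborel (\<lambda>X. \<Prod>c\<in>UNIV. f (column c X))"
    using density_from_columns[OF fm sf] by simp
qed

lemma nn_integral_lborel_translate:
  fixes f :: "'a::euclidean_space \<Rightarrow> ennreal"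
  assumes [measurable]: "f \<in> borel_measurable borel"
  shows "(\<integral>\<^sup>+ x. f (x + c) \<partial>lborel) = (\<integral>\<^sup>+ x. f x \<partial>lborel)"
proof -
  have "(\<integral>\<^sup>+ x. f x \<partial>lborel) = (\<integral>\<^sup>+ x. f x \<partial>distr lborel borel ((+) c))" by (simp add: lborel_distr_plus)
  also have "\<dots> = (\<integral>\<^sup>+ x. f (x + c) \<partial>lborel)" by (subst nn_integral_distr) (auto simp: add.commute)
  finally show ?thesis by simp
qed

text \<open>The image of Lebesgue measure is translation invariant and gives the unit ball the same mass. A translation
invariant measure is determined by such a value: for a test function \<open>f\<close> and the indicator \<open>g\<close> of the ball, Fubini's
theorem and translation by the variable of the other integral show \<open>\<mu>(f) \<lambda>(g) = \<lambda>(f) \<mu>(g)\<close>, where the symmetry of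
the ball is used.\<close>
lemma lborel_linear_isometry:
  fixes T :: "'a::euclidean_space \<Rightarrow> 'a"
  assumes lin: "linear T" and iso: "\<And>x. norm (T x) = norm x" and surj: "surj T"
  shows "distr lborel borel T = lborel"
proof (rule measure_eqI)
  have [measurable]: "T \<in> borel_measurable borel"
    using lin by (intro borel_measurable_continuous_onI linear_continuous_on linear_conv_bounded_linear[THEN iffD1])
  have shift: "(\<integral>\<^sup>+ x. f (T x + y) \<partial>lborel) = (\<integral>\<^sup>+ x. f (T x) \<partial>lborel)"
    if [measurable]: "f \<in> borel_measurable borel" for f :: "'a \<Rightarrow> ennreal" and y
  proof -
    obtain z where "y = T z" using surj by (metis surjD)
    then have "(\<integral>\<^sup>+ x. f (T x + y) \<partial>lborel) = (\<integral>\<^sup>+ x. f (T (x + z)) \<partial>lborel)" by (simp add: linear_add[OF lin])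
    also have "\<dots> = (\<integral>\<^sup>+ x. f (T x) \<partial>lborel)" by (rule nn_integral_lborel_translate) measurable
    finally show ?thesis .
  qed
  fix A assume "A \<in> sets (distr lborel borel T)"
  then have [measurable]: "A \<in> sets borel" by simp
  define f where "f = (indicator A :: 'a \<Rightarrow> ennreal)"
  \<comment> \<open>The ball is invariant under the isometry and under \<open>x \<mapsto> - x\<close>.\<close>
  define g where "g = (indicator (ball 0 1) :: 'a \<Rightarrow> ennreal)"
  have [measurable]: "f \<in> borel_measurable borel" "g \<in> borel_measurable borel" by (auto simp: f_def g_def intro!: borel_measurable_indicator)
  have gT: "g (T x) = g x" and g_even: "g (- x) = g x" for x by (auto simp: g_def indicator_def iso)
  let ?F = "\<integral>\<^sup>+ x. f (T x) \<partial>lborel" and ?G = "\<integral>\<^sup>+ x. g x \<partial>lborel"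
  have "?G * ?F = (\<integral>\<^sup>+ y. g y * ?F \<partial>lborel)" by (simp add: nn_integral_multc)
  also have "\<dots> = (\<integral>\<^sup>+ y. (\<integral>\<^sup>+ x. g y * f (T x + y) \<partial>lborel) \<partial>lborel)"
    by (simp add: nn_integral_cmult shift)
  also have "\<dots> = (\<integral>\<^sup>+ x. (\<integral>\<^sup>+ y. g y * f (T x + y) \<partial>lborel) \<partial>lborel)"
    by (rule lborel_pair.Fubini') measurable
  also have "\<dots> = (\<integral>\<^sup>+ x. (\<integral>\<^sup>+ y. g (y + - T x) * f y \<partial>lborel) \<partial>lborel)"
  proof (rule nn_integral_cong)
    fix x
    show "(\<integral>\<^sup>+ y. g y * f (T x + y) \<partial>lborel) = (\<integral>\<^sup>+ y. g (y + - T x) * f y \<partial>lborel)"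
      using nn_integral_lborel_translate[of "\<lambda>y. g y * f (T x + y)" "- T x"] by simp
  qed
  also have "\<dots> = (\<integral>\<^sup>+ y. (\<integral>\<^sup>+ x. g (y + - T x) * f y \<partial>lborel) \<partial>lborel)"
    by (rule lborel_pair.Fubini'[symmetric]) measurable
  also have "\<dots> = (\<integral>\<^sup>+ y. ?G * f y \<partial>lborel)"
  proof (rule nn_integral_cong)
    fix y
    have "(\<integral>\<^sup>+ x. g (y + - T x) * f y \<partial>lborel) = (\<integral>\<^sup>+ x. g (y + - T x) \<partial>lborel) * f y"
      by (rule nn_integral_multc) measurable
    also have "(\<integral>\<^sup>+ x. g (y + - T x) \<partial>lborel) = (\<integral>\<^sup>+ x. g (T x + - y) \<partial>lborel)"
      using g_even[of "y - T x" for x] by simp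
    also have "\<dots> = ?G" by (simp add: shift[of g "- y", simplified] gT)
    finally show "(\<integral>\<^sup>+ x. g (y + - T x) * f y \<partial>lborel) = ?G * f y" .
  qed
  also have "\<dots> = ?G * (\<integral>\<^sup>+ y. f y \<partial>lborel)" by (simp add: nn_integral_cmult)
  finally have eq: "?G * ?F = ?G * (\<integral>\<^sup>+ y. f y \<partial>lborel)" .
  have "?G = emeasure lborel (ball (0::'a) 1)" by (simp add: g_def)
  moreover have "emeasure lborel (ball (0::'a) 1) \<noteq> 0"
    using emeasure_lborel_ball_finite[of "0::'a" 1] content_ball_pos[of 1 "0::'a"] by (auto simp: measure_def)
  moreover have "emeasure lborel (ball (0::'a) 1) \<noteq> \<top>"
    using emeasure_lborel_ball_finite[of "0::'a" 1] by auto
  ultimately have "?F = (\<integral>\<^sup>+ y. f y \<partial>lborel)" using eq by (simp add: ennreal_mult_cancel_left)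
  then show "emeasure (distr lborel borel T) A = emeasure lborel A"
    by (simp add: f_def nn_integral_distr[symmetric, of T lborel borel] flip: nn_integral_indicator)
qed simp

lemma lborel_orthogonal_vec:
  fixes Q :: "real^'n^'n"
  assumes Q: "orthogonal_matrix Q"
  shows "distr lborel borel (\<lambda>x. Q *v x) = lborel"
proof (rule lborel_linear_isometry)
  show "norm (Q *v x) = norm x" for x
    using Q by (simp add: norm_eq_sqrt_inner inner_matrix_vector[of "Q *v x"] matrix_vector_mul_assoc orthogonal_matrix_def
       del: transpose_matrix_vector)
  have "Q *v (transpose Q *v y) = y" for y using Q by (simp only: matrix_vector_mul_assoc orthogonal_matrix_def matrix_vector_mul_lid)
  then show "surj (\<lambda>x. Q *v x)" by (metis surjI)
qed (rule matrix_vector_mul_linear)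

lemma inner_trace: "X \<bullet> Y = trace (X ** transpose Y)" for X Y :: "real^'m^'n"
  by (simp add: trace_inner[symmetric] inner_vec_def)

lemma lborel_orthogonal_matrix:
  fixes Q :: "real^'n^'n"
  assumes Q: "orthogonal_matrix Q"
  shows "distr lborel borel (\<lambda>X::real^'m^'n. Q ** X) = lborel"
proof (rule lborel_linear_isometry)
  show "linear (\<lambda>X::real^'m^'n. Q ** X)"
    by (rule linearI) (simp add: matrix_add_ldistrib, simp add: matrix_matrix_mult_def vec_eq_iff sum_distrib_left mult_ac)
  show "norm (Q ** X) = norm X" for X :: "real^'m^'n"
  proof -
    have "(Q ** X) \<bullet> (Q ** X) = trace (Q ** gram X ** transpose Q)"
      by (simp add: inner_trace matrix_transpose_mul matrix_mul_assoc)
    also have "\<dots> = X \<bullet> X" unfolding trace_similar[OF Q] by (simp add: inner_trace)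
    finally show ?thesis by (simp add: norm_eq_sqrt_inner)
  qed
  have "Q ** (transpose Q ** X) = X" for X :: "real^'m^'n"
    using Q by (simp add: matrix_mul_assoc orthogonal_matrix_def)
  then show "surj (\<lambda>X::real^'m^'n. Q ** X)" by (metis surjI)
qed

section \<open>Contours around a compact set\<close>

text \<open>A path from one contour to the other in the connected complement of the hull, run through forwards and then backwards, joins
the first contour and the reversed second one to a single closed path. Its winding numbers around the hull are zero,
because the winding number of either contour is constant on the connected hull.\<close>
lemma encloses_ccw_contour_integral_eq:
  assumes A: "finite A" and f: "f holomorphic_on - (convex hull A)"
    and \<Gamma>: "encloses_ccw \<Gamma> A" and \<gamma>: "encloses_ccw \<gamma> A"
  shows "contour_integral \<Gamma> f = contour_integral \<gamma> f"
proof -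
  let ?S = "- (convex hull A)"
  have comp: "compact (convex hull A)" using A by (rule finite_imp_compact_convex_hull)
  have op: "open ?S" by (rule open_Compl[OF compact_imp_closed[OF comp]])
  have conn: "connected ?S"
    using comp by (intro connected_complement_bounded_convex) (auto simp: compact_imp_bounded)
  have G: "valid_path \<Gamma>" "pathfinish \<Gamma> = pathstart \<Gamma>" "path_image \<Gamma> \<subseteq> ?S"
    and g: "valid_path \<gamma>" "pathfinish \<gamma> = pathstart \<gamma>" "path_image \<gamma> \<subseteq> ?S"
    using \<Gamma> \<gamma> by (auto simp: encloses_ccw_def)
  have wind: "winding_number p w = 1" if p: "encloses_ccw p A" and w: "w \<in> convex hull A" for p w
  proof -
    obtain a where a: "a \<in> A" using w by (metis convex_hull_empty empty_iff equals0I)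
    have "winding_number p w = winding_number p a"
      using p w hull_inc[OF a, of convex]
      by (intro winding_number_eq[of _ _ "convex hull A"])
         (auto simp: encloses_ccw_def valid_path_imp_path convex_connected)
    then show ?thesis using p a by (auto simp: encloses_ccw_def)
  qed
  have "pathstart \<Gamma> \<in> ?S" "pathstart \<gamma> \<in> ?S"
    using G(3) g(3) pathstart_in_path_image by blast+
  from connected_open_polynomial_connected[OF op conn this]
  obtain c where c: "polynomial_function c" "path_image c \<subseteq> ?S" "pathstart c = pathstart \<Gamma>" "pathfinish c = pathstart \<gamma>"
    by blast
  have vc: "valid_path c" using c(1) by (rule valid_path_polynomial_function)
  let ?p = "\<Gamma> +++ (c +++ (reversepath \<gamma> +++ reversepath c))"
  have int: "f contour_integrable_on p" if "valid_path p" "path_image p \<subseteq> ?S" for p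
    using contour_integrable_holomorphic_simple[OF f op that] .
  have "(f has_contour_integral 0) ?p"
  proof (rule Cauchy_theorem_global[OF op f])
    show "valid_path ?p" using G g c vc by (intro valid_path_join) (auto simp: valid_path_reversepath)
    show "pathfinish ?p = pathstart ?p" using c by simp
    show "path_image ?p \<subseteq> ?S" using G g c by (auto simp: path_image_join path_image_reversepath)
    fix w assume "w \<notin> ?S"
    then have w: "w \<in> convex hull A" by simp
    then have nin: "w \<notin> path_image \<Gamma>" "w \<notin> path_image \<gamma>" "w \<notin> path_image c" using G g c by auto
    have "winding_number ?p w = winding_number \<Gamma> w + (winding_number c w + (winding_number (reversepath \<gamma>) w + winding_number (reversepath c) w))"
      using nin G g c vc
      by (simp add: winding_number_join valid_path_imp_path path_image_join path_image_reversepath valid_path_reversepath)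
    also have "\<dots> = 0"
      using nin g vc wind[OF \<Gamma> w] wind[OF \<gamma> w] by (simp add: winding_number_reversepath valid_path_imp_path)
    finally show "winding_number ?p w = 0" .
  qed
  then have "0 = contour_integral ?p f" by (simp add: contour_integral_unique)
  also have "\<dots> = contour_integral \<Gamma> f + (contour_integral c f + (contour_integral (reversepath \<gamma>) f + contour_integral (reversepath c) f))"
    using G g c vc int
    by (simp add: contour_integral_join contour_integrable_join path_image_join path_image_reversepath valid_path_reversepath
       contour_integrable_reversepath)
  also have "\<dots> = contour_integral \<Gamma> f - contour_integral \<gamma> f"
    using g vc by (simp add: contour_integral_reversepath)
  finally show ?thesis by simp
qed

lemma encloses_ccw_circlepath:
  assumes "A \<subseteq> ball z r"
  shows "encloses_ccw (circlepath z r) A"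
proof -
  have h: "convex hull A \<subseteq> ball z r" using assms by (intro hull_minimal) auto
  moreover have "sphere z r \<inter> ball z r = {}" by auto
  moreover have "winding_number (circlepath z r) a = 1" if "a \<in> A" for a
    using assms that by (intro winding_number_circlepath) (auto simp: dist_norm norm_minus_commute)
  moreover have "path_image (circlepath z r) \<inter> convex hull A = {}"
  proof (cases "A = {}")
    case False
    then have "r > 0" using assms by (metis ball_empty ex_in_conv not_le subset_empty)
    then show ?thesis using h by auto
  qed simp
  ultimately show ?thesis by (simp add: encloses_ccw_def)
qed

section \<open>The product of inverse square roots\<close>

definition inv_sqrt_prod :: "real^'n \<Rightarrow> complex \<Rightarrow> complex" where
  "inv_sqrt_prod a t = (\<Prod>j\<in>UNIV. (t - complex_of_real (a $ j)) powr (- 1 / 2))"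

lemma powr_minus_half_sq: "(z powr (- 1 / 2)) * (z powr (- 1 / 2)) = inverse z" for z :: complex
proof -
  have "(- 1 / 2) + (- 1 / 2) = (- 1 :: complex)" by simp
  then have "(z powr (- 1 / 2)) * (z powr (- 1 / 2)) = z powr (- 1)" by (simp only: powr_add[symmetric])
  then show ?thesis by (simp add: powr_minus)
qed

text \<open>The function is a product of principal branches off the ray that extends from the branch points to the left. Off the ray to the
right, \<open>(t - a\<^sub>j) powr (- 1/2)\<close> is \<open>(a\<^sub>j - t) powr (- 1/2)\<close> times \<open>\<plusminus>\<i>\<close>, with a sign that depends on the side of the real axis only;
for an even number of factors the signs multiply to a constant. The two regions cover the complement of the
segment spanned by the branch points.\<close>
lemma inv_sqrt_prod_holomorphic:
  fixes a :: "real^'n"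
  assumes even: "even CARD('n)"
  shows "inv_sqrt_prod a holomorphic_on - (convex hull (range (\<lambda>j. complex_of_real (a $ j))))"
proof -
  let ?A = "range (\<lambda>j. complex_of_real (a $ j))"
  \<comment> \<open>The complements of the rays from the branch points to the left and to the right.\<close>
  define U1 where "U1 = (\<Inter>j. {t. t - complex_of_real (a $ j) \<notin> \<real>\<^sub>\<le>\<^sub>0})"
  define U2 where "U2 = (\<Inter>j. {t. complex_of_real (a $ j) - t \<notin> \<real>\<^sub>\<le>\<^sub>0})"
  have op: "open U1" "open U2"
  proof -
    have preimage: "open {t. g t \<notin> \<real>\<^sub>\<le>\<^sub>0}" if "continuous_on UNIV g" for g :: "complex \<Rightarrow> complex"
    proof -
      have "{t. g t \<notin> \<real>\<^sub>\<le>\<^sub>0} = g -` (- \<real>\<^sub>\<le>\<^sub>0)" by auto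
      then show ?thesis using that closed_nonpos_Reals_complex by (simp add: open_vimage open_Compl)
    qed
    show "open U1" unfolding U1_def
      by (intro open_INT ballI finite_class.finite_UNIV preimage continuous_intros)
    show "open U2" unfolding U2_def
      by (intro open_INT ballI finite_class.finite_UNIV preimage continuous_intros)
  qed
  have h1: "inv_sqrt_prod a holomorphic_on U1"
    unfolding inv_sqrt_prod_def by (intro holomorphic_intros) (auto simp: U1_def)
  obtain h where h: "CARD('n) = 2 * h" using even by auto
  have h2: "inv_sqrt_prod a holomorphic_on U2"
  proof (rule holomorphic_transform)
    show "(\<lambda>t. (-1) ^ h * (\<Prod>j\<in>UNIV. (complex_of_real (a $ j) - t) powr (- 1 / 2))) holomorphic_on U2"
      by (intro holomorphic_intros) (auto simp: U2_def)
    fix t assume t: "t \<in> U2"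
    \<comment> \<open>The principal branch is continuous from above at the cut, so real \<open>t\<close> belong to the upper half plane.\<close>
    define e where "e = (if Im t \<ge> 0 then - \<i> else \<i>)"
    have "(t - complex_of_real (a $ j)) powr (- 1 / 2) = e * (complex_of_real (a $ j) - t) powr (- 1 / 2)" for j
    proof -
      define u where "u = complex_of_real (a $ j) - t"
      have u1: "u \<notin> \<real>\<^sub>\<le>\<^sub>0" using t by (auto simp: U2_def u_def)
      then have u: "u \<notin> \<real>\<^sub>\<le>\<^sub>0" "u \<noteq> 0" by auto
      then have nr: "\<not> (Re u < 0 \<and> Im u = 0)" by (auto simp: complex_nonpos_Reals_iff)
      have Im: "Im u = - Im t" by (simp add: u_def)
      have "(- u) powr (- 1 / 2) = e * u powr (- 1 / 2)"
      proof (cases "Im u \<le> 0")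
        case True
        then have "Ln (- u) = Ln u + \<i> * pi" using Ln_minus[OF u(2)] nr by simp
        then have "(- u) powr (- 1 / 2) = exp (- (\<i> * pi / 2)) * u powr (- 1 / 2)"
          using u by (simp add: powr_def exp_add[symmetric] algebra_simps)
        also have "exp (- (\<i> * pi / 2)) = - \<i>"
          using exp_Ln[of "- \<i>"] by simp
        finally show ?thesis using True Im by (simp add: e_def)
      next
        case False
        then have L: "Ln (- u) = Ln u - \<i> * pi" using Ln_minus[OF u(2)] by simp
        have "(- u) powr (- 1 / 2) = exp ((- 1 / 2) * (Ln u - \<i> * pi))"
          unfolding powr_def L using u by simp
        also have "(- 1 / 2) * (Ln u - \<i> * pi) = \<i> * pi / 2 + (- 1 / 2) * Ln u"
          by (simp add: field_simps)
        finally have P: "(- u) powr (- 1 / 2) = exp (\<i> * pi / 2 + (- 1 / 2) * Ln u)" .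
        have "(- u) powr (- 1 / 2) = exp (\<i> * pi / 2) * u powr (- 1 / 2)"
          unfolding P exp_add using u by (simp add: powr_def)
        also have "exp (\<i> * complex_of_real pi / 2) = \<i>"
          using exp_Ln[of "\<i>"] by simp
        finally show ?thesis using False Im by (simp add: e_def)
      qed
      then show ?thesis by (simp add: u_def)
    qed
    then have "inv_sqrt_prod a t = e ^ (2 * h) * (\<Prod>j\<in>UNIV. (complex_of_real (a $ j) - t) powr (- 1 / 2))"
      by (simp add: inv_sqrt_prod_def prod.distrib h)
    also have "e ^ (2 * h) = (-1) ^ h" by (simp add: power_mult e_def power2_eq_square)
    finally show "(-1) ^ h * (\<Prod>j\<in>UNIV. (complex_of_real (a $ j) - t) powr (- 1 / 2)) = inv_sqrt_prod a t" by simp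
  qed
  have "- (convex hull ?A) \<subseteq> U1 \<union> U2"
  proof
    fix t assume t: "t \<in> - (convex hull ?A)"
    show "t \<in> U1 \<union> U2"
    proof (rule ccontr)
      assume "t \<notin> U1 \<union> U2"
      then obtain j k where jk: "t - complex_of_real (a $ j) \<in> \<real>\<^sub>\<le>\<^sub>0" "complex_of_real (a $ k) - t \<in> \<real>\<^sub>\<le>\<^sub>0"
        by (auto simp: U1_def U2_def)
      then have t': "t = of_real (Re t)" "Re t \<le> a $ j" "a $ k \<le> Re t"
        by (auto simp: complex_nonpos_Reals_iff complex_eq_iff)
      have "Re t \<in> closed_segment (a $ k) (a $ j)" using t' by (simp add: closed_segment_eq_real_ivl)
      then have "of_real (Re t) \<in> closed_segment (complex_of_real (a $ k)) (complex_of_real (a $ j))"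
        by (simp add: of_real_closed_segment)
      also have "\<dots> \<subseteq> convex hull ?A" by (intro closed_segment_subset_convex_hull hull_inc) auto
      finally show False using t t'(1) by simp
    qed
  qed
  then show ?thesis using holomorphic_on_Un[OF h1 h2 op] holomorphic_on_subset by blast
qed

text \<open>The arguments of \<open>w\<close> and of \<open>1 - b / w\<close> add up without leaving the principal range: subtracting \<open>b \<ge> 0\<close> from \<open>w\<close> does not
change the side of the real axis, and \<open>1 - b / w\<close> lies in the right half plane.\<close>
lemma powr_minus_half_split:
  fixes w :: complex and b :: real
  assumes b: "0 \<le> b" "b < cmod w"
  shows "(w - of_real b) powr (- 1 / 2) = w powr (- 1 / 2) * (1 - of_real b / w) powr (- 1 / 2)"
proof -
  define v where "v = 1 - of_real b / w"
  have w: "w \<noteq> 0" using b by auto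
  have wv: "w * v = w - of_real b" using w by (simp add: v_def field_simps)
  have "\<bar>Re (of_real b / w)\<bar> \<le> cmod (of_real b / w)" by (rule abs_Re_le_cmod)
  also have "\<dots> < 1" using b w by (simp add: norm_divide)
  finally have Rv: "Re v > 0" by (simp add: v_def)
  then have v: "v \<noteq> 0" and Lv: "\<bar>Im (Ln v)\<bar> < pi/2" using Re_Ln_pos_lt_imp by auto
  have Imv: "Im v = b * Im w / (cmod w)^2"
    by (simp add: v_def Im_divide cmod_power2)
  define y where "y = Im (Ln w) + Im (Ln v)"
  have ey: "w * v = of_real (cmod (w * v)) * exp (\<i> * of_real y)"
  proof -
    have "w * v = exp (Ln w + Ln v)" using w v by (simp add: exp_add)
    also have "\<dots> = of_real (exp (Re (Ln w + Ln v))) * exp (\<i> * of_real y)"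
      by (simp add: exp_eq_polar[of "Ln w + Ln v"] y_def cis_conv_exp exp_of_real mult.commute)
    also have "exp (Re (Ln w + Ln v)) = cmod (w * v)"
      using w v by (simp add: exp_add norm_mult)
    finally show ?thesis .
  qed
  have siny: "Im w = cmod (w * v) * sin y"
  proof -
    have "Im w = Im (w * v)" by (simp add: wv)
    also have "\<dots> = cmod (w * v) * sin y" by (subst ey) (simp add: Im_exp)
    finally show ?thesis .
  qed
  have cpos: "cmod (w * v) > 0" using w v by simp
  have "- pi < y \<and> y \<le> pi"
  proof (cases "Im w" "0::real" rule: linorder_cases)
    case greater
    have "0 < Im (Ln w) \<and> Im (Ln w) < pi" using greater by (rule Im_Ln_pos_lt_imp)
    moreover have "sin y > 0" using greater siny cpos by (simp add: zero_less_mult_iff)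
    then have "y \<le> pi" using calculation Lv sin_le_zero[of y] by (force simp: y_def)
    ultimately show ?thesis using Lv by (auto simp: y_def)
  next
    case equal
    then have "Im v = 0" by (simp add: Imv)
    then have "Im (Ln v) = 0" using Rv v by (simp add: Im_Ln_eq_0)
    then show ?thesis using mpi_less_Im_Ln[OF w] Im_Ln_le_pi[OF w] by (simp add: y_def)
  next
    case less
    have nr: "w \<notin> \<real>\<^sub>\<le>\<^sub>0" using less by (auto simp: complex_nonpos_Reals_iff)
    have "Im (Ln (cnj w)) = - Im (Ln w)" by (simp add: cnj_Ln[OF nr, symmetric])
    then have Lw: "- pi < Im (Ln w) \<and> Im (Ln w) < 0" using Im_Ln_pos_lt_imp[of "cnj w"] less by auto
    have "sin y < 0" using less siny cpos by (simp add: mult_less_0_iff)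
    then have "\<not> sin (- y) \<le> 0" by simp
    then have "- y < pi" using Lw Lv sin_le_zero[of "- y"] by (force simp: y_def)
    then show ?thesis using Lw Lv by (auto simp: y_def)
  qed
  then have "Ln (w * v) = Ln w + Ln v" using w v by (intro Ln_times_simple) (auto simp: y_def)
  then have "(w * v) powr (- 1 / 2) = w powr (- 1 / 2) * v powr (- 1 / 2)"
    using w v by (simp add: powr_def exp_add[symmetric] algebra_simps add_divide_distrib)
  then show ?thesis unfolding wv by (simp add: v_def)
qed

lemma inv_sqrt_prod_exterior:
  fixes b :: "real^'n"
  assumes h: "CARD('n) = 2 * h" and b: "\<And>j. 0 \<le> b $ j" "\<And>j. b $ j < cmod w"
  shows "inv_sqrt_prod b w = inverse w ^ h * (\<Prod>j\<in>UNIV. (1 - of_real (b $ j) / w) powr (- 1 / 2))"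
proof -
  have "inv_sqrt_prod b w = (w powr (- 1 / 2)) ^ (2 * h) * (\<Prod>j\<in>UNIV. (1 - of_real (b $ j) / w) powr (- 1 / 2))"
    unfolding inv_sqrt_prod_def powr_minus_half_split[OF b] prod.distrib by (simp only: prod_constant h)
  also have "(w powr (- 1 / 2)) ^ (2 * h) = inverse w ^ h"
    by (simp only: power_mult power2_eq_square powr_minus_half_sq)
  finally show ?thesis .
qed

section \<open>Termwise integration of a Laurent series against an exponential\<close>

lemma contour_integral_exp_power:
  assumes "r > 0"
  shows "((\<lambda>t. exp (of_nat M * t) / (t - z) ^ Suc q) has_contour_integral
     (2 * pi * \<i>) / fact q * (of_nat M ^ q * exp (of_nat M * z))) (circlepath z r)"
proof -
  have d: "(deriv ^^ k) (\<lambda>t. exp (of_nat M * t)) = (\<lambda>t::complex. of_nat M ^ k * exp (of_nat M * t))" for k :: nat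
  proof (induction k)
    case (Suc k)
    have "deriv (\<lambda>t. of_nat M ^ k * exp (of_nat M * t)) t = of_nat M ^ Suc k * exp (of_nat M * t)" for t :: complex
      by (rule DERIV_imp_deriv) (auto intro!: derivative_eq_intros)
    then show ?case by (simp add: Suc fun_eq_iff)
  qed simp
  show ?thesis
    using Cauchy_has_contour_integral_higher_derivative_circlepath[of z r "\<lambda>t. exp (of_nat M * t)" z q] assms
    by (simp add: d holomorphic_intros continuous_intros)
qed

text \<open>Only the coefficients survive, each multiplied by an inverse factorial from Cauchy's formula; this is the Borel transform of the
Laurent series.\<close>
lemma contour_integral_exp_laurent:
  fixes c :: "nat \<Rightarrow> real" and F :: "complex \<Rightarrow> complex"
  assumes r: "r > 0" and h: "h > 0" and summ: "summable (\<lambda>k. \<bar>c k\<bar> / r ^ k)"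
    and F: "\<And>t. cmod (t - z) = r \<Longrightarrow> (\<lambda>k. of_real (c k) / (t - z) ^ (h + k)) sums F t"
  shows "(\<lambda>k. of_real (c k * real M ^ (h + k - 1) / fact (h + k - 1)) * (2 * pi * \<i> * exp (of_nat M * z)))
     sums contour_integral (circlepath z r) (\<lambda>t. exp (of_nat M * t) * F t)"
proof -
  define f where "f k t = of_real (c k) * (exp (of_nat M * t) / (t - z) ^ Suc (h + k - 1))" for k t
  define s where "s n t = (\<Sum>k<n. f k t)" for n t
  obtain B where B: "\<And>t. t \<in> sphere z r \<Longrightarrow> cmod (exp (of_nat M * t)) \<le> B"
  proof -
    have "compact ((\<lambda>t. exp (of_nat M * t)) ` sphere z r)"
      by (intro compact_continuous_image continuous_intros compact_sphere)
    then show ?thesis using that compact_imp_bounded bounded_iff by (metis imageI)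
  qed
  have fk: "(f k has_contour_integral of_real (c k * real M ^ (h + k - 1) / fact (h + k - 1)) * (2 * pi * \<i> * exp (of_nat M * z))) (circlepath z r)" for k
    using has_contour_integral_lmul[OF contour_integral_exp_power[OF r, of M z "h + k - 1"], of "of_real (c k)"]
    unfolding f_def by (simp add: mult_ac)
  have sn: "(s n has_contour_integral (\<Sum>k<n. of_real (c k * real M ^ (h + k - 1) / fact (h + k - 1)) * (2 * pi * \<i> * exp (of_nat M * z)))) (circlepath z r)" for n
    unfolding s_def by (intro has_contour_integral_sum fk) auto
  have sums: "(\<lambda>k. f k t) sums (exp (of_nat M * t) * F t)" if "t \<in> sphere z r" for t
  proof -
    have "cmod (t - z) = r" using that by (simp add: dist_norm norm_minus_commute)
    from sums_mult[OF F[OF this], of "exp (of_nat M * t)"]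
    show ?thesis using h by (simp add: f_def mult_ac)
  qed
  have unif: "uniform_limit (sphere z r) s (\<lambda>t. exp (of_nat M * t) * F t) sequentially"
  proof -
    have "uniform_limit (sphere z r) (\<lambda>n t. \<Sum>k<n. f k t) (\<lambda>t. suminf (\<lambda>k. f k t)) sequentially"
    proof (rule Weierstrass_m_test)
      show "norm (f k t) \<le> (\<bar>c k\<bar> / r ^ k) * (B / r ^ h)" if "t \<in> sphere z r" for k t
      proof -
        have "cmod (t - z) = r" using that by (simp add: dist_norm norm_minus_commute)
        then have "norm (f k t) = \<bar>c k\<bar> * (cmod (exp (of_nat M * t)) / r ^ (h + k))"
          using h by (simp add: f_def norm_mult norm_divide norm_power del: norm_exp_eq_Re)
        also have "\<dots> \<le> \<bar>c k\<bar> * (B / r ^ (h + k))"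
          using r B[OF that] by (intro mult_left_mono divide_right_mono) auto
        finally show ?thesis by (simp add: power_add mult_ac)
      qed
      show "summable (\<lambda>k. (\<bar>c k\<bar> / r ^ k) * (B / r ^ h))" using summ by (rule summable_mult2)
    qed
    then show ?thesis
      unfolding s_def using sums by (auto simp: sums_iff intro: uniform_limit_cong' [THEN iffD1, rotated -1])
  qed
  have "\<forall>\<^sub>F n in sequentially. s n contour_integrable_on circlepath z r"
    using sn by (intro always_eventually allI) (auto simp: contour_integrable_on_def)
  from contour_integral_uniform_limit_circlepath(2)[OF this unif _ r]
  have "(\<lambda>n. contour_integral (circlepath z r) (s n)) \<longlonglongrightarrow> contour_integral (circlepath z r) (\<lambda>t. exp (of_nat M * t) * F t)"
    by simp
  then show ?thesis
    unfolding sums_def contour_integral_unique[OF sn] .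
qed

section \<open>Moments of Gaussian quadratic forms\<close>

definition diag_form :: "real^'n \<Rightarrow> real^'n \<Rightarrow> real" where
  "diag_form b w = (\<Sum>j\<in>UNIV. b $ j * (w $ j)^2)"

text \<open>The Gaussian is not normalised; the total mass is the value for \<open>k = 0\<close>.\<close>
definition diag_moment :: "nat \<Rightarrow> real^'n \<Rightarrow> real" where
  "diag_moment k b = integral\<^sup>L lborel (\<lambda>w. diag_form b w ^ k * exp (- (1/2) * (w \<bullet> w)))"

lemma real_polynomial_diag_form: "real_polynomial_function (diag_form b)"
  unfolding diag_form_def[abs_def]
  by (intro real_polynomial_function_sum real_polynomial_function.intros(2-4) real_polynomial_function_power real_polynomial_component) auto

lemma diag_moment_integrable: "integrable lborel (\<lambda>w. diag_form b w ^ k * exp (- (1/2) * (w \<bullet> w)))"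
  by (intro gaussian_polynomial_integrable real_polynomial_function_power real_polynomial_diag_form) auto

lemma diag_form_nonneg: "(\<And>j. 0 \<le> b $ j) \<Longrightarrow> 0 \<le> diag_form b w"
  by (auto simp: diag_form_def intro!: sum_nonneg)

lemma diag_moment_nonneg: "(\<And>j. 0 \<le> b $ j) \<Longrightarrow> 0 \<le> diag_moment k b"
  unfolding diag_moment_def by (intro integral_nonneg_AE AE_I2) (simp add: diag_form_nonneg)

lemma diag_moment_0: "diag_moment 0 (b::real^'n) = sqrt (2 * pi) ^ CARD('n)"
  using gaussian_integral(2)[of "1/2", where 'a="real^'n"] by (simp add: diag_moment_def mult.commute)

lemma gaussian_exp_diag_form:
  fixes b :: "real^'n"
  assumes zb: "\<And>j. 2 * z * b $ j < 1"
  shows "integrable lborel (\<lambda>w. exp (z * diag_form b w) * exp (- (1/2) * (w \<bullet> w)))"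
    and "integral\<^sup>L lborel (\<lambda>w. exp (z * diag_form b w) * exp (- (1/2) * (w \<bullet> w))) =
      sqrt (2 * pi) ^ CARD('n) * (\<Prod>j\<in>UNIV. (1 - 2 * z * b $ j) powr (- 1 / 2))"
proof -
  let ?f = "\<lambda>e x. exp (- (1/2 - z * (b \<bullet> e)) * x^2)"
  have eq: "exp (z * diag_form b w) * exp (- (1/2) * (w \<bullet> w)) = (\<Prod>e\<in>Basis. ?f e (w \<bullet> e))" for w
  proof -
    have "(\<Prod>e\<in>Basis. ?f e (w \<bullet> e)) = (\<Prod>j\<in>UNIV. exp (- (1/2 - z * b $ j) * (w $ j)^2))"
      by (simp add: vec_prod_Basis inner_axis)
    also have "\<dots> = exp (\<Sum>j\<in>UNIV. - (1/2 - z * b $ j) * (w $ j)^2)" by (simp add: exp_sum)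
    also have "(\<Sum>j\<in>UNIV. - (1/2 - z * b $ j) * (w $ j)^2) = z * diag_form b w + - (1/2) * (w \<bullet> w)"
      unfolding diag_form_def inner_vec_def sum_distrib_left sum.distrib[symmetric]
      by (intro sum.cong) (auto simp: algebra_simps power2_eq_square)
    finally show ?thesis by (simp only: exp_add)
  qed
  have pos: "1/2 - z * (b \<bullet> e) > 0" if "e \<in> Basis" for e
    using that zb by (auto simp: Basis_vec_def inner_axis algebra_simps)
  show "integrable lborel (\<lambda>w. exp (z * diag_form b w) * exp (- (1/2) * (w \<bullet> w)))"
    unfolding eq by (rule lborel_product_integral(1)) (use gaussian_integral_1(1)[OF pos] in simp)
  have "integral\<^sup>L lborel (\<lambda>w. exp (z * diag_form b w) * exp (- (1/2) * (w \<bullet> w))) = (\<Prod>e\<in>Basis. integral\<^sup>L lborel (?f e))"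
    unfolding eq by (rule lborel_product_integral(2)) (use gaussian_integral_1(1)[OF pos] in simp)
  also have "\<dots> = (\<Prod>e\<in>Basis. sqrt (pi / (1/2 - z * (b \<bullet> e))))"
    by (intro prod.cong refl) (rule gaussian_integral_1(2)[OF pos])
  also have "\<dots> = (\<Prod>j\<in>UNIV. sqrt (2 * pi) * (1 - 2 * z * b $ j) powr (- 1 / 2))"
    unfolding vec_prod_Basis
  proof (intro prod.cong refl)
    fix j
    have p: "1 - 2 * z * b $ j > 0" using zb[of j] by simp
    have "pi / (1/2 - z * (b \<bullet> axis j 1)) = (2 * pi) / (1 - 2 * z * b $ j)"
      using p by (simp add: inner_axis field_simps)
    then have "sqrt (pi / (1/2 - z * (b \<bullet> axis j 1))) = sqrt (2 * pi) / sqrt (1 - 2 * z * b $ j)"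
      by (simp only: real_sqrt_divide)
    then show "sqrt (pi / (1/2 - z * (b \<bullet> axis j 1))) = sqrt (2 * pi) * (1 - 2 * z * b $ j) powr (- 1 / 2)"
    proof -
      have "(1 - 2 * z * b $ j) powr (- 1 / 2) = 1 / sqrt (1 - 2 * z * b $ j)"
        using p powr_minus[of "1 - 2 * z * b $ j" "1/2"] powr_half_sqrt[of "1 - 2 * z * b $ j"]
        by (simp add: inverse_eq_divide)
      with \<open>sqrt _ = sqrt _ / sqrt _\<close> show ?thesis by (simp only: times_divide_eq_right mult_1_right)
    qed
  qed
  finally show "integral\<^sup>L lborel (\<lambda>w. exp (z * diag_form b w) * exp (- (1/2) * (w \<bullet> w))) =
      sqrt (2 * pi) ^ CARD('n) * (\<Prod>j\<in>UNIV. (1 - 2 * z * b $ j) powr (- 1 / 2))"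
    by (simp add: prod.distrib)
qed

lemma diag_moment_generating_real:
  fixes b :: "real^'n"
  assumes b: "\<And>j. 0 \<le> b $ j" and z: "0 \<le> z" "\<And>j. 2 * z * b $ j < 1"
  shows "(\<lambda>k. diag_moment k b / fact k * z ^ k) sums
     (sqrt (2 * pi) ^ CARD('n) * (\<Prod>j\<in>UNIV. (1 - 2 * z * b $ j) powr (- 1 / 2)))"
proof -
  let ?g = "\<lambda>w::real^'n. exp (- (1/2) * (w \<bullet> w))"
  define f where "f k w = z ^ k / fact k * (diag_form b w ^ k * ?g w)" for k w
  have fint: "integrable lborel (f k)" and fval: "integral\<^sup>L lborel (f k) = diag_moment k b / fact k * z ^ k" for k
    unfolding f_def using diag_moment_integrable[of b k] by (simp_all add: diag_moment_def)
  have f0: "f k w \<ge> 0" for k w using z diag_form_nonneg[OF b] by (simp add: f_def)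
  have fs: "(\<lambda>k. f k w) sums (exp (z * diag_form b w) * ?g w)" for w
  proof -
    have "f k w = (z * diag_form b w) ^ k /\<^sub>R fact k * ?g w" for k
      by (simp add: f_def power_mult_distrib field_simps)
    then show ?thesis using sums_mult2[OF exp_converges[of "z * diag_form b w"], of "?g w"] by (simp only:)
  qed
  note ei = gaussian_exp_diag_form[of z b, OF z(2)]
  have "(\<lambda>k. integral\<^sup>L lborel (f k)) sums (integral\<^sup>L lborel (\<lambda>w. \<Sum>k. f k w))"
  proof (rule sums_integral[OF fint])
    show "AE w in lborel. summable (\<lambda>k. norm (f k w))"
      using fs f0 by (intro AE_I2) (auto simp: sums_iff)
    show "summable (\<lambda>k. \<integral>w. norm (f k w) \<partial>lborel)"
    proof (rule summableI_nonneg_bounded)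
      show "(\<Sum>k<n. \<integral>w. norm (f k w) \<partial>lborel) \<le> integral\<^sup>L lborel (\<lambda>w. exp (z * diag_form b w) * ?g w)" for n
      proof -
        have "(\<Sum>k<n. \<integral>w. norm (f k w) \<partial>lborel) = integral\<^sup>L lborel (\<lambda>w. \<Sum>k<n. f k w)"
          using f0 fint by (simp add: Bochner_Integration.integral_sum)
        also have "\<dots> \<le> integral\<^sup>L lborel (\<lambda>w. exp (z * diag_form b w) * ?g w)"
        proof (rule integral_mono)
          show "(\<Sum>k<n. f k w) \<le> exp (z * diag_form b w) * ?g w" for w
            using sum_le_suminf[of "\<lambda>k. f k w" "{..<n}"] fs[of w] f0 by (simp add: sums_iff)
        qed (use fint ei in auto)
        finally show ?thesis .
      qed
    qed simp
  qed
  moreover have "(\<Sum>k. f k w) = exp (z * diag_form b w) * ?g w" for w using fs by (simp add: sums_iff)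
  ultimately show ?thesis using ei(2) by (simp add: fval)
qed

text \<open>Both sides are holomorphic in the disc and agree on a real interval that ends at the centre.\<close>
lemma diag_moment_generating:
  fixes b :: "real^'n"
  assumes b: "\<And>j. 0 \<le> b $ j" and r: "r > 0" "\<And>j. 2 * r * b $ j \<le> 1" and \<zeta>: "cmod \<zeta> < r"
  shows "(\<lambda>k. of_real (diag_moment k b / fact k) * \<zeta> ^ k) sums
     (of_real (sqrt (2 * pi) ^ CARD('n)) * (\<Prod>j\<in>UNIV. (1 - 2 * \<zeta> * of_real (b $ j)) powr (- 1 / 2)))"
proof -
  let ?c = "\<lambda>k. complex_of_real (diag_moment k b / fact k)"
  let ?G = "\<lambda>\<zeta>. of_real (sqrt (2 * pi) ^ CARD('n)) * (\<Prod>j\<in>UNIV. (1 - 2 * \<zeta> * of_real (b $ j)) powr (- 1 / 2))"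
  have lt: "2 * x * b $ j < 1" if "0 \<le> x" "x < r" for x j
  proof (cases "b $ j = 0")
    case False
    then have "2 * x * b $ j < 2 * r * b $ j" using that b[of j] by simp
    then show ?thesis using r(2)[of j] by simp
  qed simp
  have reals: "(\<lambda>k. diag_moment k b / fact k * x ^ k) sums
     (sqrt (2 * pi) ^ CARD('n) * (\<Prod>j\<in>UNIV. (1 - 2 * x * b $ j) powr (- 1 / 2)))" if "0 \<le> x" "x < r" for x
    by (rule diag_moment_generating_real[OF b]) (use that lt in auto)
  have summ: "summable (\<lambda>k. ?c k * \<xi> ^ k)" if "cmod \<xi> < r" for \<xi>
  proof (rule summable_norm_cancel)
    have "summable (\<lambda>k. diag_moment k b / fact k * cmod \<xi> ^ k)" using reals[of "cmod \<xi>"] that by (simp add: sums_iff)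
    then show "summable (\<lambda>k. norm (?c k * \<xi> ^ k))"
      using diag_moment_nonneg[OF b] by (simp add: norm_mult norm_power norm_divide)
  qed
  define S where "S \<xi> = (\<Sum>k. ?c k * \<xi> ^ k)" for \<xi>
  have S: "(\<lambda>k. ?c k * \<xi> ^ k) sums S \<xi>" if "cmod \<xi> < r" for \<xi>
    using summ[OF that] by (simp add: S_def summable_sums)
  have "S holomorphic_on ball 0 r"
    by (rule power_series_holomorphic[of 0 r ?c]) (use S in auto)
  moreover have "?G holomorphic_on ball 0 r"
  proof (intro holomorphic_intros)
    fix \<xi> j assume "\<xi> \<in> ball (0::complex) r"
    then have "\<bar>Re \<xi>\<bar> < r" using abs_Re_le_cmod[of \<xi>] by auto
    then have "2 * \<bar>Re \<xi>\<bar> * b $ j < 1" by (intro lt) auto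
    moreover have "2 * Re \<xi> * b $ j \<le> 2 * \<bar>Re \<xi>\<bar> * b $ j" using b[of j] by (intro mult_right_mono) auto
    ultimately have "Re (1 - 2 * \<xi> * of_real (b $ j)) > 0" by simp
    then show "1 - 2 * \<xi> * of_real (b $ j) \<notin> \<real>\<^sub>\<le>\<^sub>0" by (auto simp: complex_nonpos_Reals_iff)
  qed
  ultimately have hol: "(\<lambda>\<xi>. S \<xi> - ?G \<xi>) holomorphic_on ball 0 r" by (rule holomorphic_on_diff)
  have "S \<zeta> - ?G \<zeta> = 0"
  proof (rule analytic_continuation[OF hol, of "of_real ` {0<..<r}" 0])
    show "(0::complex) islimpt of_real ` {0<..<r}"
    proof (rule islimpt_approachable[THEN iffD2], intro allI impI)
      fix e :: real assume "e > 0"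
      show "\<exists>x'\<in>of_real ` {0<..<r}. x' \<noteq> (0::complex) \<and> dist x' 0 < e"
      proof (intro bexI conjI)
        show "complex_of_real (min e r / 2) \<in> of_real ` {0<..<r}"
          by (rule image_eqI[of _ _ "min e r / 2"]) (use r(1) \<open>e > 0\<close> in auto)
        have "cmod (complex_of_real (min e r / 2)) = min e r / 2" using r(1) \<open>e > 0\<close> unfolding norm_of_real by simp
        then show "complex_of_real (min e r / 2) \<noteq> 0" "dist (complex_of_real (min e r / 2)) 0 < e"
          using r(1) \<open>e > 0\<close> by (auto simp del: of_real_divide)
      qed
    qed
    fix x assume "x \<in> complex_of_real ` {0<..<r}"
    then obtain y where y: "x = of_real y" "0 < y" "y < r" by auto
    have "(\<lambda>k. ?c k * x ^ k) sums of_real (sqrt (2 * pi) ^ CARD('n) * (\<Prod>j\<in>UNIV. (1 - 2 * y * b $ j) powr (- 1 / 2)))"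
      using sums_of_real[OF reals[of y], where 'a=complex] y by simp
    moreover have "complex_of_real (sqrt (2 * pi) ^ CARD('n) * (\<Prod>j\<in>UNIV. (1 - 2 * y * b $ j) powr (- 1 / 2))) = ?G x"
    proof -
      have "complex_of_real ((1 - 2 * y * b $ j) powr (- 1 / 2)) = (1 - 2 * x * of_real (b $ j)) powr (- 1 / 2)" for j
        using powr_of_real[of "1 - 2 * y * b $ j" "- 1 / 2"] lt[of y j] y by simp
      then show ?thesis by simp
    qed
    ultimately show "S x - ?G x = 0" using S[of x] y sums_unique2 by fastforce
  qed (use r \<zeta> in auto)
  then show ?thesis using S[OF \<zeta>] by simp
qed

lemma diag_form_1: "diag_form 1 w = w \<bullet> w"
  by (simp add: diag_form_def inner_vec_def power2_eq_square)

text \<open>The Euler vector field, multiplied by \<open>(w \<bullet> w) ^ k\<close>, has divergence \<open>(n + 2 k) (w \<bullet> w) ^ k\<close>.\<close>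
lemma diag_moment_1_Suc: "diag_moment (Suc k) (1::real^'n) = (real CARD('n) + 2 * real k) * diag_moment k (1::real^'n)"
proof -
  let ?g = "\<lambda>w::real^'n. exp (- (1/2) * (w \<bullet> w))"
  define D where "D i w = ((w \<bullet> w) ^ k + w $ i * (real k * (w \<bullet> w) ^ (k - 1) * (2 * w $ i)) - w $ i * (w \<bullet> w) ^ k * w $ i) * ?g w" for i :: 'n and w
  have poly: "real_polynomial_function (\<lambda>w::real^'n. w \<bullet> w)"
    using real_polynomial_diag_form[of "1::real^'n"] by (simp add: diag_form_1[abs_def])
  note pi = real_polynomial_function.intros(2-4) real_polynomial_function_power real_polynomial_component real_polynomial_function_diff poly
  have D: "integrable lborel (D i)" "integral\<^sup>L lborel (D i) = 0" for i
  proof -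
    show int: "integrable lborel (D i)" unfolding D_def by (intro gaussian_polynomial_integrable pi) auto
    have der: "((\<lambda>s. (y + s *\<^sub>R axis i 1) $ i * ((y + s *\<^sub>R axis i 1) \<bullet> (y + s *\<^sub>R axis i 1)) ^ k * ?g (y + s *\<^sub>R axis i 1))
        has_real_derivative D i (y + s *\<^sub>R axis i 1)) (at s)" for y s
    proof -
      let ?Z = "\<lambda>s. y + s *\<^sub>R axis i 1"
      define X where X: "X = ?Z s"
      have 1: "((\<lambda>s. ?Z s $ i) has_real_derivative 1) (at s)" by (auto intro!: derivative_eq_intros)
      have 2: "((\<lambda>s. ?Z s \<bullet> ?Z s) has_real_derivative 2 * X $ i) (at s)"
        by (auto intro!: derivative_eq_intros simp: X inner_add inner_axis inner_axis' algebra_simps inner_commute)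
      have 3: "((\<lambda>s. (?Z s \<bullet> ?Z s) ^ k) has_real_derivative real k * (X \<bullet> X) ^ (k - 1) * (2 * X $ i)) (at s)"
        using DERIV_power[OF 2, of k] by (simp add: X mult_ac)
      have 4: "((\<lambda>s. ?g (?Z s)) has_real_derivative ?g X * (- (1/2) * (2 * X $ i))) (at s)"
        using 2 unfolding X by (intro DERIV_fun_exp DERIV_cmult)
      show ?thesis using DERIV_mult[OF DERIV_mult[OF 1 3] 4] by (simp add: D_def X algebra_simps)
    qed
    show "integral\<^sup>L lborel (D i) = 0"
    proof (rule integral_directional_derivative_eq_0[where b="axis i 1" and H="\<lambda>w. w $ i * (w \<bullet> w) ^ k * ?g w"])
      show "integrable lborel (\<lambda>w. w $ i * (w \<bullet> w) ^ k * ?g w)" by (intro gaussian_polynomial_integrable pi) auto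
      show "integrable lborel (D i)" by (rule int)
      fix y
      show "continuous_on UNIV (\<lambda>s. (y + s *\<^sub>R axis i 1) $ i * ((y + s *\<^sub>R axis i 1) \<bullet> (y + s *\<^sub>R axis i 1)) ^ k * ?g (y + s *\<^sub>R axis i 1))"
        using der by (intro continuous_at_imp_continuous_on) (blast intro: DERIV_isCont)
      show "\<exists>F. finite F \<and> (\<forall>s. s \<notin> F \<longrightarrow> ((\<lambda>s. (y + s *\<^sub>R axis i 1) $ i * ((y + s *\<^sub>R axis i 1) \<bullet> (y + s *\<^sub>R axis i 1)) ^ k * ?g (y + s *\<^sub>R axis i 1))
          has_real_derivative D i (y + s *\<^sub>R axis i 1)) (at s))"
        using der by (intro exI[of _ "{}"]) auto
    qed
  qed
  have sum: "(\<Sum>i\<in>UNIV. D i w) = (real CARD('n) + 2 * real k) * ((w \<bullet> w) ^ k * ?g w) - (w \<bullet> w) ^ Suc k * ?g w" for w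
  proof -
    have "(\<Sum>i\<in>UNIV. D i w) = ((\<Sum>i\<in>(UNIV::'n set). (w \<bullet> w) ^ k) + 2 * real k * (w \<bullet> w) ^ (k - 1) * (\<Sum>i\<in>UNIV. w $ i * w $ i) - (w \<bullet> w) ^ k * (\<Sum>i\<in>UNIV. w $ i * w $ i)) * ?g w"
      unfolding D_def sum_distrib_left sum_distrib_right sum.distrib[symmetric] sum_subtractf[symmetric]
      by (intro sum.cong refl) (simp add: algebra_simps)
    also have "(\<Sum>i\<in>UNIV. w $ i * w $ i) = w \<bullet> w" by (simp add: inner_vec_def)
    finally show ?thesis by (cases k) (simp_all add: algebra_simps)
  qed
  have "0 = integral\<^sup>L lborel (\<lambda>w. \<Sum>i\<in>UNIV. D i w)" using D by (simp add: Bochner_Integration.integral_sum)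
  also have "\<dots> = (real CARD('n) + 2 * real k) * diag_moment k (1::real^'n) - diag_moment (Suc k) (1::real^'n)"
    unfolding sum using diag_moment_integrable[of "1::real^'n" k] diag_moment_integrable[of "1::real^'n" "Suc k"]
    by (simp add: diag_moment_def diag_form_1 del: power_Suc)
  finally show ?thesis by simp
qed

lemma diag_moment_1:
  assumes "CARD('n) = 2 * h"
  shows "diag_moment k (1::real^'n) = sqrt (2 * pi) ^ CARD('n) * 2 ^ k * fact (h + k - 1) / fact (h - 1)"
proof (induction k)
  case (Suc k)
  have h: "h > 0" using assms by (cases h) auto
  then obtain q where q: "h = Suc q" by (cases h) auto
  show ?case unfolding diag_moment_1_Suc Suc using assms by (simp add: q field_simps)
qed (simp add: diag_moment_0)

lemma integral_lborel_orthogonal: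
  fixes f :: "real^'n \<Rightarrow> real"
  assumes Q: "orthogonal_matrix Q" and [measurable]: "f \<in> borel_measurable borel"
  shows "integral\<^sup>L lborel (\<lambda>w. f (Q *v w)) = integral\<^sup>L lborel f"
proof -
  have [measurable]: "(\<lambda>x. Q *v x) \<in> borel_measurable borel"
    by (intro borel_measurable_continuous_onI matrix_vector_mult_linear_continuous_on)
  have "integral\<^sup>L lborel f = integral\<^sup>L (distr lborel borel (\<lambda>x. Q *v x)) f" by (simp add: lborel_orthogonal_vec[OF Q])
  also have "\<dots> = integral\<^sup>L lborel (\<lambda>w. f (Q *v w))" by (subst integral_distr) auto
  finally show ?thesis by simp
qed

lemma diag_form_diag: "w \<bullet> (diag_mat d *v w) = diag_form d w"
proof -
  have "(diag_mat d *v w) $ i = d $ i * w $ i" for i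
    by (simp add: matrix_vector_mult_def diag_mat_def mult_delta_left)
  then show ?thesis by (simp add: diag_form_def inner_vec_def power2_eq_square mult_ac)
qed

lemma diag_moment_matrix:
  assumes Q: "orthogonal_matrix Q" and A: "A = Q ** diag_mat d ** transpose Q"
  shows "integral\<^sup>L lborel (\<lambda>w. (w \<bullet> (A *v w)) ^ k * exp (- (1/2) * (w \<bullet> w))) = diag_moment k d"
proof -
  have Qt: "orthogonal_matrix (transpose Q)" using Q by (simp add: orthogonal_matrix_transpose)
  have 1: "w \<bullet> (A *v w) = diag_form d (transpose Q *v w)" for w
    unfolding A diag_form_diag[symmetric] matrix_vector_mul_assoc[symmetric] by (rule inner_matrix_vector)
  have 2: "w \<bullet> w = (transpose Q *v w) \<bullet> (transpose Q *v w)" for w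
  proof -
    have "Q *v (transpose Q *v w) = w" using Q by (simp only: matrix_vector_mul_assoc orthogonal_matrix_def matrix_vector_mul_lid)
    then show ?thesis using inner_matrix_vector[of w Q "transpose Q *v w"] by simp
  qed
  have [measurable]: "diag_form d \<in> borel_measurable borel"
    unfolding diag_form_def by (intro borel_measurable_continuous_onI continuous_intros)
  have "integral\<^sup>L lborel (\<lambda>w. (w \<bullet> (A *v w)) ^ k * exp (- (1/2) * (w \<bullet> w))) =
    integral\<^sup>L lborel (\<lambda>w. (\<lambda>u. diag_form d u ^ k * exp (- (1/2) * (u \<bullet> u))) (transpose Q *v w))"
    by (simp only: 1 2[symmetric])
  also have "\<dots> = diag_moment k d" unfolding diag_moment_def by (rule integral_lborel_orthogonal[OF Qt]) measurable
  finally show ?thesis .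
qed

section \<open>Diagonalisation by the sorted eigenvalues and the spiked covariance\<close>

text \<open>The eigenvectors are rearranged so that the eigenvalues appear in increasing order.\<close>
lemma spectral_theorem_spectrum:
  fixes A :: "real^'n::{finite,linorder}^'n::{finite,linorder}"
  assumes sym: "transpose A = A"
  obtains Q where "orthogonal_matrix Q" "A = Q ** diag_mat (spectrum A) ** transpose Q"
proof -
  obtain Q d where Q: "orthogonal_matrix Q" and A: "A = Q ** diag_mat d ** transpose Q"
    using spectral_theorem[OF sym] .
  have "entries d = entries (spectrum A)"
    unfolding spectrum(2)[OF sym, symmetric] by (subst A) (simp add: eigenvalues_orthogonal_similar[OF Q] eigenvalues_diag)
  then obtain \<sigma> where \<sigma>: "bij \<sigma>" "spectrum A = (\<chi> i. d $ \<sigma> i)" by (rule entries_eq_permute)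
  define P :: "real^'n::{finite,linorder}^'n::{finite,linorder}" where "P = (\<chi> i j. Q $ i $ \<sigma> j)"
  have sand: "(R ** diag_mat x ** transpose R) $ i $ j = (\<Sum>k\<in>UNIV. R $ i $ k * x $ k * R $ j $ k)"
    for R :: "real^'n::{finite,linorder}^'n::{finite,linorder}" and x i j
  proof -
    have "(R ** diag_mat x) $ i $ k = R $ i $ k * x $ k" for i k
      by (simp add: matrix_matrix_mult_def diag_mat_def mult_delta_right)
    then show ?thesis by (simp add: matrix_matrix_mult_def[of "R ** diag_mat x"] transpose_def)
  qed
  have "P ** diag_mat (spectrum A) ** transpose P = Q ** diag_mat d ** transpose Q"
    unfolding vec_eq_iff sand
    using sum.reindex_bij_betw[OF \<sigma>(1), of "\<lambda>k. Q $ i $ k * d $ k * Q $ j $ k" for i j]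
    by (simp add: P_def \<sigma>(2))
  moreover have "orthogonal_matrix P"
  proof -
    have "P ** transpose P = Q ** transpose Q"
      unfolding vec_eq_iff using sum.reindex_bij_betw[OF \<sigma>(1), of "\<lambda>k. Q $ i $ k * Q $ j $ k" for i j]
      by (simp add: matrix_matrix_mult_def transpose_def P_def)
    then have "P ** transpose P = mat 1" using Q by (simp add: orthogonal_matrix_def)
    then show ?thesis by (simp add: orthogonal_matrix_def matrix_left_right_inverse)
  qed
  ultimately show ?thesis using that[of P] A by simp
qed

lemma matrix_inv_eqI:
  fixes A B :: "real^'n^'n"
  assumes "A ** B = mat 1" "B ** A = mat 1"
  shows "matrix_inv A = B"
proof -
  have "A ** matrix_inv A = mat 1 \<and> matrix_inv A ** A = mat 1"
    unfolding matrix_inv_def by (rule someI[of _ B]) (use assms in simp)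
  then have "B = B ** (A ** matrix_inv A)" by simp
  also have "\<dots> = matrix_inv A" by (simp add: matrix_mul_assoc assms)
  finally show ?thesis by simp
qed

text \<open>The multiset of eigenvalues determines the covariance matrix up to the direction \<open>v\<close> of the exceptional eigenvector, and its
inverse differs from the identity by a multiple of the projection to \<open>v\<close>.\<close>
lemma spiked_precision:
  fixes \<Sigma> :: "real^'n^'n"
  assumes pd: "positive_definite \<Sigma>"
    and ev: "eigenvalues \<Sigma> = add_mset (1 + \<tau>) (replicate_mset (CARD('n) - 1) 1)"
  obtains v where "norm v = 1" "1 + \<tau> > 0"
    "\<And>x. x \<bullet> (matrix_inv \<Sigma> *v x) = x \<bullet> x - \<tau> / (1 + \<tau>) * (v \<bullet> x)^2"
proof -
  have sym: "transpose \<Sigma> = \<Sigma>" and pos: "\<And>x. x \<noteq> 0 \<Longrightarrow> x \<bullet> (\<Sigma> *v x) > 0" using pd by (auto simp: positive_definite_def)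
  obtain Q d where Q: "orthogonal_matrix Q" and A: "\<Sigma> = Q ** diag_mat d ** transpose Q"
    using spectral_theorem[OF sym] .
  have QQ: "Q ** transpose Q = mat 1" "transpose Q ** Q = mat 1" using Q by (auto simp: orthogonal_matrix_def)
  have ent: "entries d = add_mset (1 + \<tau>) (replicate_mset (CARD('n) - 1) 1)"
    unfolding ev[symmetric] by (subst A) (simp add: eigenvalues_orthogonal_similar[OF Q] eigenvalues_diag)
  then have "1 + \<tau> \<in># entries d" by simp
  then obtain i0 where i0: "d $ i0 = 1 + \<tau>" by (auto simp: entries_def)
  have "mset_set (UNIV::'n set) = add_mset i0 (mset_set (UNIV - {i0}))" by (simp add: mset_set.remove)
  then have "image_mset (\<lambda>i. d $ i) (mset_set (UNIV - {i0})) = replicate_mset (CARD('n) - 1) 1"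
    using ent i0 by (simp add: entries_def)
  then have d1: "d $ j = 1" if "j \<noteq> i0" for j
  proof -
    have "d $ j \<in># image_mset (\<lambda>i. d $ i) (mset_set (UNIV - {i0}))" using that by simp
    then show ?thesis unfolding \<open>image_mset _ (mset_set (UNIV - {i0})) = _\<close> by (simp split: if_splits)
  qed
  define v where "v = Q *v axis i0 1"
  have tv: "transpose Q *v v = axis i0 1" unfolding v_def by (simp only: matrix_vector_mul_assoc QQ matrix_vector_mul_lid)
  have vx: "v \<bullet> x = (transpose Q *v x) $ i0" for x
    unfolding v_def using inner_matrix_vector[of x Q "axis i0 1"] by (simp add: inner_axis' inner_commute)
  have "v \<bullet> v = 1" unfolding vx tv by simp
  then have v1: "norm v = 1" by (simp add: norm_eq_1)
  have quad: "x \<bullet> ((Q ** diag_mat e ** transpose Q) *v x) = diag_form e (transpose Q *v x)" for e x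
    unfolding diag_form_diag[symmetric] matrix_vector_mul_assoc[symmetric] by (rule inner_matrix_vector)
  have "v \<noteq> 0" using v1 by auto
  then have "0 < v \<bullet> (\<Sigma> *v v)" by (rule pos)
  also have "\<dots> = diag_form d (axis i0 1)" by (subst A) (simp only: quad tv)
  also have "\<dots> = 1 + \<tau>"
  proof -
    have "diag_form d (axis i0 1) = (\<Sum>j\<in>UNIV. if j = i0 then d $ j else 0)"
      unfolding diag_form_def by (intro sum.cong) (auto simp: axis_def)
    then show ?thesis by (simp add: i0)
  qed
  finally have tau: "1 + \<tau> > 0" .
  define e :: "real^'n" where "e = (\<chi> j. 1 / d $ j)"
  have dnz: "d $ j \<noteq> 0" for j using d1[of j] i0 tau by (cases "j = i0") auto
  have "diag_mat d ** diag_mat e = mat 1" "diag_mat e ** diag_mat d = mat 1"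
    unfolding diag_mat_mult by (auto simp: diag_mat_def mat_def vec_eq_iff e_def dnz)
  then have "\<Sigma> ** (Q ** diag_mat e ** transpose Q) = mat 1" "(Q ** diag_mat e ** transpose Q) ** \<Sigma> = mat 1"
  proof -
    have m: "(Q ** diag_mat x ** transpose Q) ** (Q ** diag_mat y ** transpose Q) = Q ** (diag_mat x ** diag_mat y) ** transpose Q" for x y
    proof -
      have "(Q ** diag_mat x ** transpose Q) ** (Q ** diag_mat y ** transpose Q) = Q ** diag_mat x ** (transpose Q ** Q) ** diag_mat y ** transpose Q"
        by (simp only: matrix_mul_assoc)
      then show ?thesis by (simp add: QQ matrix_mul_assoc)
    qed
    show "\<Sigma> ** (Q ** diag_mat e ** transpose Q) = mat 1"
      by (subst A) (simp only: m \<open>diag_mat d ** diag_mat e = mat 1\<close> matrix_mul_rid QQ)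
    show "(Q ** diag_mat e ** transpose Q) ** \<Sigma> = mat 1"
      by (subst A) (simp only: m \<open>diag_mat e ** diag_mat d = mat 1\<close> matrix_mul_rid QQ)
  qed
  then have inv: "matrix_inv \<Sigma> = Q ** diag_mat e ** transpose Q" by (rule matrix_inv_eqI)
  have "x \<bullet> (matrix_inv \<Sigma> *v x) = x \<bullet> x - \<tau> / (1 + \<tau>) * (v \<bullet> x)^2" for x
  proof -
    let ?u = "transpose Q *v x"
    have "x \<bullet> x = x \<bullet> (Q *v ?u)" by (simp only: matrix_vector_mul_assoc QQ matrix_vector_mul_lid)
    also have "\<dots> = ?u \<bullet> ?u" by (rule inner_matrix_vector)
    finally have xx: "x \<bullet> x = ?u \<bullet> ?u" .
    have "diag_form e ?u = (\<Sum>j\<in>UNIV. ?u $ j * ?u $ j - (if j = i0 then \<tau> / (1 + \<tau>) * (?u $ j)^2 else 0))"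
      unfolding diag_form_def
    proof (intro sum.cong refl)
      fix j
      have "1 / (1 + \<tau>) = 1 - \<tau> / (1 + \<tau>)" using tau by (simp add: field_simps)
      then show "e $ j * (?u $ j)^2 = ?u $ j * ?u $ j - (if j = i0 then \<tau> / (1 + \<tau>) * (?u $ j)^2 else 0)"
        using d1[of j] i0 by (cases "j = i0") (simp_all add: e_def power2_eq_square left_diff_distrib del: transpose_matrix_vector)
    qed
    also have "\<dots> = x \<bullet> x - \<tau> / (1 + \<tau>) * (v \<bullet> x)^2"
      unfolding xx vx by (simp add: sum_subtractf inner_vec_def del: transpose_matrix_vector)
    finally show ?thesis unfolding inv quad .
  qed
  then show ?thesis using that v1 tau by blast
qed

section \<open>Averaging the spike direction\<close>

text \<open>The exponent of the spike with the trace added, so that the form is nonnegative for \<open>\<bar>\<beta>\<bar> \<le> \<alpha>\<close>.\<close>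
definition spike_form :: "real \<Rightarrow> real \<Rightarrow> real^'m^'n \<Rightarrow> real^'n \<Rightarrow> real" where
  "spike_form \<alpha> \<beta> Y w = \<alpha> * (Y \<bullet> Y) * (w \<bullet> w) + \<beta> * (w \<bullet> (gram Y *v w))"

text \<open>The eigenvalues of the quadratic form \<open>spike_form \<alpha> \<beta> Y\<close>, if \<open>x\<close> lists those of \<open>gram Y\<close>.\<close>
definition spike_weights :: "real \<Rightarrow> real \<Rightarrow> real^'n \<Rightarrow> real^'n" where
  "spike_weights \<alpha> \<beta> x = (\<chi> j. \<alpha> * power_sum 1 x + \<beta> * x $ j)"

lemma spike_weights_nonneg:
  fixes x :: "real^'n"
  assumes "\<bar>\<beta>\<bar> \<le> \<alpha>" "\<And>i. 0 \<le> x $ i"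
  shows "0 \<le> spike_weights \<alpha> \<beta> x $ j"
proof -
  have "x $ j \<le> power_sum 1 x" unfolding power_sum_def using assms by (simp add: member_le_sum)
  then have "\<bar>\<beta>\<bar> * x $ j \<le> \<alpha> * power_sum 1 x" using assms by (intro mult_mono) auto
  moreover have "- (\<bar>\<beta>\<bar> * x $ j) \<le> \<beta> * x $ j" using assms(2)[of j] by (auto simp: abs_if mult_le_0_iff)
  ultimately show ?thesis by (simp add: spike_weights_def)
qed

lemma inner_orthogonal:
  fixes Q :: "real^'n^'n"
  assumes "orthogonal_matrix Q"
  shows "(transpose Q *v x) \<bullet> (transpose Q *v x) = x \<bullet> x"
proof -
  have "x \<bullet> x = x \<bullet> (Q *v (transpose Q *v x))"
    using assms by (simp only: matrix_vector_mul_assoc orthogonal_matrix_def matrix_vector_mul_lid)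
  then show ?thesis by (simp only: inner_matrix_vector)
qed

lemma gram_orthogonal: "gram (Q ** Y) = Q ** gram Y ** transpose Q"
  by (simp add: matrix_transpose_mul matrix_mul_assoc)

lemma spike_form_orthogonal:
  assumes Q: "orthogonal_matrix Q"
  shows "spike_form \<alpha> \<beta> (Q ** Y) w = spike_form \<alpha> \<beta> Y (transpose Q *v w)"
proof -
  have "(Q ** Y) \<bullet> (Q ** Y) = Y \<bullet> Y"
    unfolding inner_trace gram_orthogonal trace_similar[OF Q] ..
  moreover have "w \<bullet> (gram (Q ** Y) *v w) = (transpose Q *v w) \<bullet> (gram Y *v (transpose Q *v w))"
    unfolding gram_orthogonal matrix_vector_mul_assoc[symmetric] by (rule inner_matrix_vector)
  ultimately show ?thesis by (simp only: spike_form_def inner_orthogonal[OF Q])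
qed

lemma spike_form_diag:
  assumes Q: "orthogonal_matrix Q" and A: "gram Y = Q ** diag_mat (spectrum (gram Y)) ** transpose Q"
  shows "spike_form \<alpha> \<beta> Y w = diag_form (spike_weights \<alpha> \<beta> (spectrum (gram Y))) (transpose Q *v w)"
proof -
  let ?u = "transpose Q *v w" and ?x = "spectrum (gram Y)"
  have "w \<bullet> (gram Y *v w) = diag_form ?x ?u"
    by (subst A) (simp only: diag_form_diag[symmetric] matrix_vector_mul_assoc[symmetric] inner_matrix_vector)
  moreover have "w \<bullet> w = ?u \<bullet> ?u" by (rule inner_orthogonal[OF Q, symmetric])
  ultimately show ?thesis
    unfolding spike_form_def power_sum_1_gram[symmetric]
    by (simp add: diag_form_def spike_weights_def inner_vec_def sum_distrib_left sum.distrib[symmetric] algebra_simps power2_eq_square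
        del: transpose_matrix_vector)
qed

lemma spike_form_scale: "spike_form \<alpha> \<beta> Y (c *\<^sub>R w) = c^2 * spike_form \<alpha> \<beta> Y w"
  by (simp add: spike_form_def matrix_vector_mult_scaleR power2_eq_square algebra_simps)

lemma spike_form_nonneg:
  fixes Y :: "real^'m^'n::{finite,linorder}"
  assumes "\<bar>\<beta>\<bar> \<le> \<alpha>" shows "0 \<le> spike_form \<alpha> \<beta> Y w"
proof -
  obtain Q where Q: "orthogonal_matrix Q" "gram Y = Q ** diag_mat (spectrum (gram Y)) ** transpose Q"
    using spectral_theorem_spectrum[OF transpose_gram] .
  show ?thesis
    unfolding spike_form_diag[OF Q] using assms spectrum_gram_nonneg
    by (intro diag_form_nonneg spike_weights_nonneg) auto
qed

lemma gaussian_spike_moment: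
  fixes Y :: "real^'m^'n::{finite,linorder}"
  shows "integrable lborel (\<lambda>w. spike_form \<alpha> \<beta> Y w ^ k * exp (- (1/2) * (w \<bullet> w)))"
    and "integral\<^sup>L lborel (\<lambda>w. spike_form \<alpha> \<beta> Y w ^ k * exp (- (1/2) * (w \<bullet> w))) =
      diag_moment k (spike_weights \<alpha> \<beta> (spectrum (gram Y)))"
proof -
  obtain Q where Q: "orthogonal_matrix Q" "gram Y = Q ** diag_mat (spectrum (gram Y)) ** transpose Q"
    using spectral_theorem_spectrum[OF transpose_gram] .
  let ?b = "spike_weights \<alpha> \<beta> (spectrum (gram Y))"
  have eq: "spike_form \<alpha> \<beta> Y w = w \<bullet> ((Q ** diag_mat ?b ** transpose Q) *v w)" for w
    unfolding spike_form_diag[OF Q] diag_form_diag[symmetric] matrix_vector_mul_assoc[symmetric]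
    by (rule inner_matrix_vector[symmetric])
  show "integral\<^sup>L lborel (\<lambda>w. spike_form \<alpha> \<beta> Y w ^ k * exp (- (1/2) * (w \<bullet> w))) = diag_moment k ?b"
    unfolding eq by (rule diag_moment_matrix[OF Q(1) refl])
  have "real_polynomial_function (\<lambda>w. w \<bullet> ((Q ** diag_mat ?b ** transpose Q) *v w))"
    unfolding inner_vec_def matrix_vector_mult_def
    by (auto intro!: real_polynomial_function_sum real_polynomial_function.intros(2-4) real_polynomial_component)
  then show "integrable lborel (\<lambda>w. spike_form \<alpha> \<beta> Y w ^ k * exp (- (1/2) * (w \<bullet> w)))"
    unfolding eq by (intro gaussian_polynomial_integrable real_polynomial_function_power) auto
qed

lemma spike_form_measurable_pair:
  "(\<lambda>p. spike_form \<alpha> \<beta> (fst p :: real^'m^'n) (snd p)) \<in> borel_measurable (borel \<Otimes>\<^sub>M borel)"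
proof -
  have "continuous_on UNIV (\<lambda>p::(real^'m^'n) \<times> (real^'n). spike_form \<alpha> \<beta> (fst p) (snd p))"
    unfolding spike_form_def inner_vec_def matrix_vector_mult_def matrix_matrix_mult_def transpose_def
    by (auto intro!: continuous_intros)
  then have "(\<lambda>p::(real^'m^'n) \<times> (real^'n). spike_form \<alpha> \<beta> (fst p) (snd p)) \<in> borel_measurable borel"
    by (rule borel_measurable_continuous_onI)
  then show ?thesis by (simp add: borel_prod)
qed

lemma spike_form_measurable[measurable (raw)]:
  fixes f :: "'a \<Rightarrow> real^'m^'n"
  assumes "f \<in> borel_measurable M" "g \<in> borel_measurable M"
  shows "(\<lambda>x. spike_form \<alpha> \<beta> (f x) (g x)) \<in> borel_measurable M"
  using measurable_compose[OF measurable_Pair[OF assms] spike_form_measurable_pair] by simp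

lemma nn_integral_lborel_orthogonal_matrix:
  fixes f :: "real^'m^'n \<Rightarrow> ennreal"
  assumes Q: "orthogonal_matrix Q" and [measurable]: "f \<in> borel_measurable borel"
  shows "(\<integral>\<^sup>+ X. f (Q ** X) \<partial>lborel) = (\<integral>\<^sup>+ X. f X \<partial>lborel)"
proof -
  have [measurable]: "(\<lambda>X::real^'m^'n. Q ** X) \<in> borel_measurable borel"
    by (intro borel_measurable_continuous_onI continuous_matrix_mult) (auto intro: continuous_intros)
  have "(\<integral>\<^sup>+ X. f X \<partial>lborel) = (\<integral>\<^sup>+ X. f X \<partial>distr lborel borel (\<lambda>X::real^'m^'n. Q ** X))"
    by (simp add: lborel_orthogonal_matrix[OF Q])
  also have "\<dots> = (\<integral>\<^sup>+ X. f (Q ** X) \<partial>lborel)" by (subst nn_integral_distr) auto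
  finally show ?thesis by simp
qed

lemma spectrum_orthogonal:
  fixes Y :: "real^'m^'n::{finite,linorder}"
  assumes Q: "orthogonal_matrix Q" shows "spectrum (gram (Q ** Y)) = spectrum (gram Y)"
proof (rule spectrum_eqI)
  show "power_sum k (spectrum (gram Y)) = trace (matpow (gram (Q ** Y)) k)" for k
    unfolding power_sum_spectrum[OF transpose_gram] gram_orthogonal matpow_similar[OF Q] trace_similar[OF Q] ..
qed (simp_all only: transpose_gram spectrum)

text \<open>Invariance under orthogonal matrices makes the integral depend on the vector only through its norm. Integrating
over a Gaussian vector \<open>w\<close> instead of a fixed \<open>v\<close> thus costs the moment of \<open>(w \<bullet> w) ^ k\<close>, and for fixed \<open>Y\<close> the Gaussian
integral depends on the spectrum of \<open>gram Y\<close> only.\<close>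
lemma spike_direction_average:
  fixes F :: "real^'n::{finite,linorder} \<Rightarrow> ennreal" and v :: "real^'n::{finite,linorder}"
  assumes F[measurable]: "F \<in> borel_measurable borel" and ab: "\<bar>\<beta>\<bar> \<le> \<alpha>" and v: "norm v = 1"
  shows "(\<integral>\<^sup>+ Y. F (spectrum (gram (Y::real^'m^'n::{finite,linorder}))) * ennreal (spike_form \<alpha> \<beta> Y v ^ k) \<partial>lborel) * ennreal (diag_moment k (1::real^'n::{finite,linorder}))
     = (\<integral>\<^sup>+ Y. F (spectrum (gram (Y::real^'m^'n::{finite,linorder}))) * ennreal (diag_moment k (spike_weights \<alpha> \<beta> (spectrum (gram Y)))) \<partial>lborel)"
proof -
  let ?g = "\<lambda>w::real^'n::{finite,linorder}. exp (- (1/2) * (w \<bullet> w))"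
  let ?ev = "\<lambda>Y::real^'m^'n::{finite,linorder}. spectrum (gram Y)"
  define J where "J w = (\<integral>\<^sup>+ Y. F (?ev Y) * ennreal (spike_form \<alpha> \<beta> Y w ^ k) \<partial>lborel)" for w
 have nn: "0 \<le> spike_form \<alpha> \<beta> Y u" for Y :: "real^'m^'n::{finite,linorder}" and u
    by (rule spike_form_nonneg[OF ab])
  have J: "J w = ennreal ((w \<bullet> w) ^ k) * J v" for w
  proof -
    have "norm w = norm (norm w *\<^sub>R v)" using v by simp
    then obtain f where f: "orthogonal_transformation f" "f w = norm w *\<^sub>R v"
      by (rule orthogonal_transformation_exists)
    define Q where "Q = transpose (matrix f)"
    have Q: "orthogonal_matrix Q" and fQ: "transpose Q *v w = norm w *\<^sub>R v"
      using f orthogonal_transformation_matrix[of f]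
      by (auto simp: Q_def orthogonal_matrix_transpose matrix_works orthogonal_transformation_linear)
    have "J w = (\<integral>\<^sup>+ Y. F (?ev (Q ** Y)) * ennreal (spike_form \<alpha> \<beta> (Q ** Y) w ^ k) \<partial>lborel)"
      unfolding J_def by (rule nn_integral_lborel_orthogonal_matrix[OF Q, symmetric]) measurable
    also have "\<dots> = (\<integral>\<^sup>+ Y. ennreal ((w \<bullet> w) ^ k) * (F (?ev Y) * ennreal (spike_form \<alpha> \<beta> Y v ^ k)) \<partial>lborel)"
      unfolding spectrum_orthogonal[OF Q] spike_form_orthogonal[OF Q] fQ spike_form_scale
      by (intro nn_integral_cong) (simp add: nn power_mult_distrib power2_norm_eq_inner ennreal_mult mult_ac)
    also have "\<dots> = ennreal ((w \<bullet> w) ^ k) * J v" unfolding J_def by (rule nn_integral_cmult) measurable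
    finally show ?thesis .
  qed
  have "(\<integral>\<^sup>+ w. J w * ennreal (?g w) \<partial>lborel) = (\<integral>\<^sup>+ w. J v * ennreal ((w \<bullet> w) ^ k * ?g w) \<partial>lborel)"
  proof (rule nn_integral_cong)
    fix w
    show "J w * ennreal (?g w) = J v * ennreal ((w \<bullet> w) ^ k * ?g w)"
      by (subst J) (simp add: ennreal_mult mult_ac)
  qed
  also have "\<dots> = J v * (\<integral>\<^sup>+ w. ennreal ((w \<bullet> w) ^ k * ?g w) \<partial>lborel)"
    by (rule nn_integral_cmult) measurable
  also have "(\<integral>\<^sup>+ w. ennreal ((w \<bullet> w) ^ k * ?g w) \<partial>lborel) = ennreal (diag_moment k (1::real^'n::{finite,linorder}))"
    using diag_moment_integrable[of "1::real^'n::{finite,linorder}" k]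
    by (subst nn_integral_eq_integral) (auto simp: diag_moment_def diag_form_1)
  finally have 1: "(\<integral>\<^sup>+ w. J w * ennreal (?g w) \<partial>lborel) = J v * ennreal (diag_moment k (1::real^'n::{finite,linorder}))" .
  have "(\<integral>\<^sup>+ w. J w * ennreal (?g w) \<partial>lborel) =
     (\<integral>\<^sup>+ w. (\<integral>\<^sup>+ Y. F (?ev Y) * ennreal (spike_form \<alpha> \<beta> Y w ^ k) * ennreal (?g w) \<partial>lborel) \<partial>lborel)"
    unfolding J_def by (intro nn_integral_cong nn_integral_multc[symmetric]) measurable
  also have "\<dots> = (\<integral>\<^sup>+ Y. (\<integral>\<^sup>+ w. F (?ev Y) * ennreal (spike_form \<alpha> \<beta> Y w ^ k) * ennreal (?g w) \<partial>lborel) \<partial>lborel)"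
    by (rule lborel_pair.Fubini') measurable
  also have "\<dots> = (\<integral>\<^sup>+ Y. F (?ev Y) * ennreal (diag_moment k (spike_weights \<alpha> \<beta> (?ev Y))) \<partial>lborel)"
  proof (intro nn_integral_cong)
    fix Y :: "real^'m^'n::{finite,linorder}"
    have "(\<integral>\<^sup>+ w. F (?ev Y) * ennreal (spike_form \<alpha> \<beta> Y w ^ k) * ennreal (?g w) \<partial>lborel) =
      (\<integral>\<^sup>+ w. F (?ev Y) * ennreal (spike_form \<alpha> \<beta> Y w ^ k * ?g w) \<partial>lborel)"
      using spike_form_nonneg[OF ab, of Y] by (intro nn_integral_cong) (simp add: ennreal_mult mult.assoc)
    also have "\<dots> = F (?ev Y) * (\<integral>\<^sup>+ w. ennreal (spike_form \<alpha> \<beta> Y w ^ k * ?g w) \<partial>lborel)"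
      by (rule nn_integral_cmult) measurable
    also have "(\<integral>\<^sup>+ w. ennreal (spike_form \<alpha> \<beta> Y w ^ k * ?g w) \<partial>lborel) = ennreal (diag_moment k (spike_weights \<alpha> \<beta> (?ev Y)))"
      unfolding gaussian_spike_moment(2)[symmetric]
      using gaussian_spike_moment(1) spike_form_nonneg[OF ab, of Y] by (intro nn_integral_eq_integral) auto
    finally show "(\<integral>\<^sup>+ w. F (?ev Y) * ennreal (spike_form \<alpha> \<beta> Y w ^ k) * ennreal (?g w) \<partial>lborel) =
      F (?ev Y) * ennreal (diag_moment k (spike_weights \<alpha> \<beta> (?ev Y)))" .
  qed
  finally show ?thesis using 1 by (simp add: J_def)
qed

section \<open>The averaged spike factor\<close>

text \<open>The average of \<open>spike_form \<alpha> \<beta> Y v ^ k / fact k\<close> over a uniformly distributed unit vector \<open>v\<close>, if \<open>x\<close> is the spectrum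
of \<open>gram Y\<close>.\<close>
definition spike_term :: "real \<Rightarrow> real \<Rightarrow> nat \<Rightarrow> real^'n \<Rightarrow> real" where
  "spike_term \<alpha> \<beta> k x = diag_moment k (spike_weights \<alpha> \<beta> x) / (fact k * diag_moment k (1::real^'n))"

lemma diag_moment_1_pos:
  assumes "CARD('n) = 2 * h" shows "diag_moment k (1::real^'n) > 0"
  unfolding diag_moment_1[OF assms] by simp

lemma diag_moment_scale: "diag_moment k (c *\<^sub>R b) = c ^ k * diag_moment k b"
proof -
  have "diag_form (c *\<^sub>R b) w = c * diag_form b w" for w by (simp add: diag_form_def sum_distrib_left mult_ac)
  then show ?thesis by (simp add: diag_moment_def power_mult_distrib mult.assoc)
qed

lemma diag_moment_permute:
  fixes b :: "real^'n" and \<sigma> :: "'n \<Rightarrow> 'n"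
  assumes "bij \<sigma>"
  shows "diag_moment k (\<chi> i. b $ \<sigma> i) = diag_moment k b"
proof -
  define T where "T w = (\<chi> i. w $ \<sigma> i)" for w :: "real^'n"
  have r: "(\<Sum>i\<in>UNIV. f (\<sigma> i)) = (\<Sum>i\<in>UNIV. f i)" for f :: "'n \<Rightarrow> real"
    using sum.reindex_bij_betw[OF assms] by simp
  have ii: "T w \<bullet> T w = w \<bullet> w" for w
    unfolding inner_vec_def T_def using r[of "\<lambda>i. w $ i * w $ i"] by simp
  have dist: "distr lborel borel T = lborel"
  proof (rule lborel_linear_isometry)
    show "linear T" by (rule linearI) (simp_all add: T_def vec_eq_iff)
    show "norm (T w) = norm w" for w by (simp add: norm_eq_sqrt_inner ii)
    have "T (\<chi> i. y $ inv \<sigma> i) = y" for y using assms by (simp add: T_def vec_eq_iff bij_is_inj)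
    then show "surj T" by (rule surjI[of T "\<lambda>y. \<chi> i. y $ inv \<sigma> i"])
  qed
  have [measurable]: "T \<in> borel_measurable borel"
    unfolding T_def by (intro borel_measurable_continuous_onI continuous_on_vec_lambda continuous_intros)
  have [measurable]: "diag_form c \<in> borel_measurable borel" for c :: "real^'n"
    unfolding diag_form_def by (intro borel_measurable_continuous_onI continuous_intros)
  have q: "diag_form (\<chi> i. b $ \<sigma> i) (T w) = diag_form b w" for w
    unfolding diag_form_def T_def using r[of "\<lambda>i. b $ i * (w $ i)^2"] by simp
  have "diag_moment k (\<chi> i. b $ \<sigma> i) = integral\<^sup>L (distr lborel borel T) (\<lambda>w. diag_form (\<chi> i. b $ \<sigma> i) w ^ k * exp (- (1/2) * (w \<bullet> w)))"
    by (simp add: dist diag_moment_def)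
  also have "\<dots> = diag_moment k b" by (subst integral_distr) (simp_all add: q ii diag_moment_def)
  finally show ?thesis .
qed

lemma power_sum_permute:
  fixes x :: "real^'n" and \<sigma> :: "'n \<Rightarrow> 'n"
  shows "bij \<sigma> \<Longrightarrow> power_sum k (\<chi> i. x $ \<sigma> i) = power_sum k x"
  by (intro power_sum_entries_cong entries_permute)

lemma spike_term_permute:
  fixes x :: "real^'n" and \<sigma> :: "'n \<Rightarrow> 'n"
  assumes "bij \<sigma>" shows "spike_term \<alpha> \<beta> k (\<chi> i. x $ \<sigma> i) = spike_term \<alpha> \<beta> k x"
proof -
  have "spike_weights \<alpha> \<beta> (\<chi> i. x $ \<sigma> i) = (\<chi> i. spike_weights \<alpha> \<beta> x $ \<sigma> i)"
    by (simp add: spike_weights_def vec_eq_iff power_sum_permute[OF assms])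
  then show ?thesis by (simp add: spike_term_def diag_moment_permute[OF assms])
qed

lemma laguerre_weight_permute:
  fixes x :: "real^'n::{finite,linorder}" and \<sigma> :: "'n \<Rightarrow> 'n"
  assumes "bij \<sigma>" shows "laguerre_weight a b (\<chi> i. x $ \<sigma> i) = laguerre_weight a b x"
  unfolding laguerre_weight_def vandermonde_permute[OF assms]
  using prod.reindex_bij_betw[OF assms, of "\<lambda>i. laguerre a b (x $ i)"] by simp

lemma spike_term_measurable[measurable]: "spike_term \<alpha> \<beta> k \<in> borel_measurable borel"
proof -
  have "continuous_on UNIV (\<lambda>p::(real^'n) \<times> (real^'n). diag_form (spike_weights \<alpha> \<beta> (fst p)) (snd p) ^ k * exp (- (1/2) * (snd p \<bullet> snd p)))"
    unfolding diag_form_def spike_weights_def by (auto intro!: continuous_intros)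
  then have "(\<lambda>p::(real^'n) \<times> (real^'n). diag_form (spike_weights \<alpha> \<beta> (fst p)) (snd p) ^ k * exp (- (1/2) * (snd p \<bullet> snd p))) \<in> borel_measurable (borel \<Otimes>\<^sub>M borel)"
    unfolding borel_prod by (rule borel_measurable_continuous_onI)
  then have "(\<lambda>(x, w). diag_form (spike_weights \<alpha> \<beta> x) w ^ k * exp (- (1/2) * (w \<bullet> w))) \<in> borel_measurable (borel \<Otimes>\<^sub>M (lborel :: (real^'n) measure))"
    by (simp add: split_beta' cong: measurable_cong_sets sets_pair_measure_cong)
  from lborel.borel_measurable_lebesgue_integral[OF this]
  have "(\<lambda>x. diag_moment k (spike_weights \<alpha> \<beta> x)) \<in> borel_measurable (borel :: (real^'n) measure)"
    by (simp add: diag_moment_def)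
  then show ?thesis unfolding spike_term_def[abs_def] by measurable
qed

text \<open>On a large circle around \<open>- \<bar>c\<bar> p\<^sub>1\<close> the distances from the centre to the branch points are the nonnegative spike weights, so that the
product of inverse square roots is a Laurent series in Gaussian moments; termwise integration divides by exactly the
factorials that occur in \<open>diag_moment_1\<close>.\<close>
lemma contour_spike_terms:
  fixes x :: "real^'n" and c :: real and M h :: nat
  assumes h: "CARD('n) = 2 * h" and M: "M > 0" and x: "\<And>j. 0 \<le> x $ j"
    and \<Gamma>: "encloses_ccw \<Gamma> (range (\<lambda>j. complex_of_real (c * x $ j)))"
  shows "summable (\<lambda>k. spike_term (M * \<bar>c\<bar>) (M * c) k x)"
    and "contour_integral \<Gamma> (\<lambda>t. exp (of_nat M * t) * inv_sqrt_prod (c *\<^sub>R x) t) =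
      of_real (\<Sum>k. spike_term (M * \<bar>c\<bar>) (M * c) k x) *
      (2 * pi * \<i> * of_real (exp (- M * \<bar>c\<bar> * power_sum 1 x) * M ^ (h - 1) / fact (h - 1)))"
proof -
  have h0: "h > 0" using h by (cases h) auto
  define s where "s = \<bar>c\<bar> * power_sum 1 x"
  define b where "b = spike_weights \<bar>c\<bar> c x"
  have b0: "0 \<le> b $ j" for j unfolding b_def by (rule spike_weights_nonneg) (use x in auto)
  have bs: "b $ j = c * x $ j + s" for j by (simp add: b_def s_def spike_weights_def)
  \<comment> \<open>The generating function is needed in a disc that is strictly larger than the image of the circle of radius \<open>R\<close>.\<close>
  define R' where "R' = 1 + (\<Sum>j\<in>UNIV. b $ j)"
  define R where "R = 1 + R'"
  have sb: "b $ j \<le> R' - 1" for j using b0 by (simp add: R'_def member_le_sum)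
  have R'1: "R' \<ge> 1" using b0 by (simp add: R'_def sum_nonneg)
  then have R0: "R > 0" and RR: "R > R'" by (auto simp: R_def)
  let ?z = "complex_of_real (- s)"
  let ?A = "range (\<lambda>j. complex_of_real (c * x $ j))"
  define g0 where "g0 = sqrt (2 * pi) ^ CARD('n)"
  have g0: "g0 > 0" by (simp add: g0_def)
  define d where "d k = diag_moment k b / (fact k * g0 * 2 ^ k)" for k
  have F: "(\<lambda>k. of_real (d k) / (t - ?z) ^ (h + k)) sums inv_sqrt_prod (c *\<^sub>R x) t" if t: "cmod (t - ?z) = R" for t
  proof -
    define w where "w = t - ?z"
    have w: "w \<noteq> 0" "cmod w = R" using t R0 by (auto simp: w_def)
    have "inv_sqrt_prod (c *\<^sub>R x) t = inv_sqrt_prod b w"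
      by (simp add: inv_sqrt_prod_def w_def bs)
    also have "\<dots> = inverse w ^ h * (\<Prod>j\<in>UNIV. (1 - of_real (b $ j) / w) powr (- 1 / 2))"
    proof (rule inv_sqrt_prod_exterior[OF h b0])
      show "b $ j < cmod w" for j using sb[of j] RR w(2) by linarith
    qed
    finally have rp: "inv_sqrt_prod (c *\<^sub>R x) t = inverse w ^ h * (\<Prod>j\<in>UNIV. (1 - of_real (b $ j) / w) powr (- 1 / 2))" .
    have "(\<lambda>k. of_real (diag_moment k b / fact k) * (1 / (2 * w)) ^ k) sums
      (of_real g0 * (\<Prod>j\<in>UNIV. (1 - 2 * (1 / (2 * w)) * of_real (b $ j)) powr (- 1 / 2)))"
      unfolding g0_def
    proof (rule diag_moment_generating[OF b0, of "1 / (2 * R')"])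
      show "cmod (1 / (2 * w)) < 1 / (2 * R')" using w RR R'1 by (simp add: norm_divide norm_mult field_simps)
      show "2 * (1 / (2 * R')) * b $ j \<le> 1" for j using sb[of j] R'1 by (simp add: field_simps)
    qed (use R'1 in simp)
    from sums_mult[OF this, of "inverse w ^ h / of_real g0"]
    have "(\<lambda>k. inverse w ^ h / of_real g0 * (of_real (diag_moment k b / fact k) * (1 / (2 * w)) ^ k)) sums inv_sqrt_prod (c *\<^sub>R x) t"
      using g0 by (simp add: rp)
    moreover have "inverse w ^ h / of_real g0 * (of_real (diag_moment k b / fact k) * (1 / (2 * w)) ^ k) = of_real (d k) / w ^ (h + k)" for k
    proof -
      have "inverse w ^ h = 1 / w ^ h" by (simp add: inverse_eq_divide power_one_over)
      moreover have "(1 / (2 * w)) ^ k = 1 / (2 ^ k * w ^ k)" by (simp add: power_one_over power_mult_distrib)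
      ultimately show ?thesis by (simp add: d_def power_add)
    qed
    ultimately show ?thesis by (simp add: w_def)
  qed
  have summ: "summable (\<lambda>k. \<bar>d k\<bar> / R ^ k)"
  proof -
    have "summable (\<lambda>k. diag_moment k b / fact k * (1 / (2 * R)) ^ k)"
    proof (rule sums_summable, rule diag_moment_generating_real[OF b0])
      show "2 * (1 / (2 * R)) * b $ j < 1" for j using sb[of j] RR R0 by (simp add: field_simps)
    qed (use R0 in simp)
    from summable_mult[OF this, of "1 / g0"] show ?thesis
      using diag_moment_nonneg[OF b0] g0 by (simp add: d_def power_divide power_mult_distrib field_simps)
  qed
  have sums: "(\<lambda>k. of_real (d k * real M ^ (h + k - 1) / fact (h + k - 1)) * (2 * pi * \<i> * exp (of_nat M * ?z)))
     sums contour_integral (circlepath ?z R) (\<lambda>t. exp (of_nat M * t) * inv_sqrt_prod (c *\<^sub>R x) t)"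
    by (rule contour_integral_exp_laurent[OF R0 h0 summ F])
  have term_eq: "d k * real M ^ (h + k - 1) / fact (h + k - 1) = spike_term (M * \<bar>c\<bar>) (M * c) k x * (M ^ (h - 1) / fact (h - 1))" for k
  proof -
    have "spike_weights (M * \<bar>c\<bar>) (M * c) x = real M *\<^sub>R b"
      by (simp add: spike_weights_def b_def vec_eq_iff algebra_simps)
    moreover obtain q where "h = Suc q" using h0 by (cases h) auto
    ultimately show ?thesis
      unfolding spike_term_def diag_moment_1[OF h] g0_def[symmetric] d_def
      using g0 by (simp add: diag_moment_scale power_add field_simps)
  qed
  define K where "K = 2 * pi * \<i> * exp (of_nat M * ?z) * of_real (M ^ (h - 1) / fact (h - 1))"
  have K0: "K \<noteq> 0" using M by (simp add: K_def)
  have sums': "(\<lambda>k. of_real (spike_term (M * \<bar>c\<bar>) (M * c) k x) * K) sums contour_integral (circlepath ?z R) (\<lambda>t. exp (of_nat M * t) * inv_sqrt_prod (c *\<^sub>R x) t)"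
    using sums unfolding term_eq by (simp add: K_def mult_ac)
  then have "summable (\<lambda>k. complex_of_real (spike_term (M * \<bar>c\<bar>) (M * c) k x) * K)" by (rule sums_summable)
  then have "summable (\<lambda>k. complex_of_real (spike_term (M * \<bar>c\<bar>) (M * c) k x))" using summable_mult2[of _ "1 / K"] K0 by fastforce
  then show sm: "summable (\<lambda>k. spike_term (M * \<bar>c\<bar>) (M * c) k x)" by (simp add: summable_of_real_iff)
  have hol: "(\<lambda>t. exp (of_nat M * t) * inv_sqrt_prod (c *\<^sub>R x) t) holomorphic_on - (convex hull ?A)"
    using inv_sqrt_prod_holomorphic[of "c *\<^sub>R x"] h by (intro holomorphic_intros) auto
  have "contour_integral \<Gamma> (\<lambda>t. exp (of_nat M * t) * inv_sqrt_prod (c *\<^sub>R x) t) =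
     contour_integral (circlepath ?z R) (\<lambda>t. exp (of_nat M * t) * inv_sqrt_prod (c *\<^sub>R x) t)"
  proof (rule encloses_ccw_contour_integral_eq[OF _ hol \<Gamma>])
    have "dist ?z (complex_of_real (c * x $ j)) < R" for j
    proof -
      have "?z - complex_of_real (c * x $ j) = of_real (- b $ j)" by (simp add: bs)
      then have "dist ?z (complex_of_real (c * x $ j)) = b $ j" using b0[of j] unfolding dist_norm by (simp only: norm_of_real)
      then show ?thesis using sb[of j] RR by simp
    qed
    then show "encloses_ccw (circlepath ?z R) ?A" by (intro encloses_ccw_circlepath) auto
  qed simp
  also have "\<dots> = of_real (\<Sum>k. spike_term (M * \<bar>c\<bar>) (M * c) k x) * K"
    using sums_unique2[OF sums' sums_mult2[OF sums_of_real[OF summable_sums[OF sm]], of K]] .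
  also have "K = 2 * pi * \<i> * of_real (exp (- M * \<bar>c\<bar> * power_sum 1 x) * M ^ (h - 1) / fact (h - 1))"
    by (simp add: K_def s_def exp_of_real[symmetric] mult_ac)
  finally show "contour_integral \<Gamma> (\<lambda>t. exp (of_nat M * t) * inv_sqrt_prod (c *\<^sub>R x) t) =
      of_real (\<Sum>k. spike_term (M * \<bar>c\<bar>) (M * c) k x) *
      (2 * pi * \<i> * of_real (exp (- M * \<bar>c\<bar> * power_sum 1 x) * M ^ (h - 1) / fact (h - 1)))" .
qed

section \<open>The eigenvalue density of a spiked Wishart matrix\<close>

lemma nn_integral_lborel_scale:
  fixes G :: "'a::euclidean_space \<Rightarrow> ennreal"
  assumes r: "r > 0" and [measurable]: "G \<in> borel_measurable borel"
  shows "(\<integral>\<^sup>+ X. G X \<partial>lborel) = ennreal (r ^ DIM('a)) * (\<integral>\<^sup>+ Y. G (r *\<^sub>R Y) \<partial>lborel)"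
proof -
  have "(\<integral>\<^sup>+ X. G X \<partial>lborel) = (\<integral>\<^sup>+ X. G X \<partial>density (distr lborel borel (\<lambda>x. 0 + r *\<^sub>R x)) (\<lambda>_. \<bar>r\<bar> ^ DIM('a)))"
    using r by (subst lborel_affine[of r 0]) simp_all
  also have "\<dots> = (\<integral>\<^sup>+ Y. ennreal (r ^ DIM('a)) * G (r *\<^sub>R Y) \<partial>lborel)"
    using r by (simp add: nn_integral_density nn_integral_distr)
  also have "\<dots> = ennreal (r ^ DIM('a)) * (\<integral>\<^sup>+ Y. G (r *\<^sub>R Y) \<partial>lborel)"
    by (rule nn_integral_cmult) measurable
  finally show ?thesis .
qed

lemma sum_column_inner: "(\<Sum>k\<in>UNIV. column k X \<bullet> column k X) = X \<bullet> X" for X :: "real^'m^'n"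
  unfolding inner_vec_def column_def by (simp add: inner_vec_def) (rule sum.swap)

lemma sum_column_spike: "(\<Sum>k\<in>UNIV. (v \<bullet> column k X)^2) = v \<bullet> (gram X *v v)" for X :: "real^'m^'n"
proof -
  have c: "(transpose X *v v) $ k = v \<bullet> column k X" for k
    by (simp only: matrix_vector_mult_def transpose_def column_def inner_vec_def vec_lambda_beta inner_real_def mult.commute)
  have "v \<bullet> (gram X *v v) = (transpose X *v v) \<bullet> (transpose X *v v)"
    unfolding matrix_vector_mul_assoc[symmetric] by (rule inner_matrix_vector)
  then show ?thesis by (simp only: inner_vec_def c inner_real_def power2_eq_square)
qed

text \<open>The normalising constant of the normal density is positive, since otherwise the total mass would be zero.\<close>
lemma spiked_wishart_matrix_density:
  fixes X :: "'a \<Rightarrow> real^'m^'n"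
  assumes W: "real_wishart \<Omega> C X S"
    and prec: "\<And>x. x \<bullet> (matrix_inv C *v x) = x \<bullet> x - 2 * c * (v \<bullet> x)^2"
  obtains K where "K > 0" "distr \<Omega> borel X =
     density lborel (\<lambda>X. ennreal (K * exp (- (1/2) * (X \<bullet> X) + c * (v \<bullet> (gram X *v v)))))"
proof -
  interpret prob_space \<Omega> using W by (simp add: real_wishart_def)
  define f where "f = (\<lambda>x::real^'n. ennreal (multivariate_normal_density 0 C x))"
  have Xm: "X \<in> borel_measurable \<Omega>" and dX: "distr \<Omega> borel X = density lborel (\<lambda>X. \<Prod>k\<in>UNIV. f (column k X))"
    using real_wishart_law[OF W] by (simp_all add: f_def)
  define K0 where "K0 = 1 / sqrt ((2 * pi) ^ CARD('n) * det C)"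
  have f: "f x = ennreal (K0 * exp (- (1/2) * (x \<bullet> x) + c * (v \<bullet> x)^2))" for x
    unfolding f_def multivariate_normal_density_def K0_def by (simp add: prec algebra_simps diff_divide_distrib)
  have K0: "K0 > 0"
  proof (rule ccontr)
    assume "\<not> K0 > 0"
    then have "f x = 0" for x unfolding f by (intro ennreal_neg) (simp add: mult_nonpos_nonneg)
    then have "distr \<Omega> borel X = density lborel (\<lambda>_. 0)" unfolding dX by (simp add: zero_power card_gt_0_iff)
    then have "emeasure (distr \<Omega> borel X) UNIV = 0" by (simp add: emeasure_density)
    moreover have "emeasure (distr \<Omega> borel X) UNIV = 1" using Xm by (simp add: emeasure_distr emeasure_space_1)
    ultimately show False by simp
  qed
  have "(\<Prod>k\<in>UNIV. f (column k X)) = ennreal (K0 ^ CARD('m) * exp (- (1/2) * (X \<bullet> X) + c * (v \<bullet> (gram X *v v))))" for X :: "real^'m^'n"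
  proof -
    have "(\<Prod>k\<in>UNIV. f (column k X)) = ennreal (\<Prod>k\<in>UNIV. K0 * exp (- (1/2) * (column k X \<bullet> column k X) + c * (v \<bullet> column k X)^2))"
      unfolding f using K0 by (intro prod_ennreal) (simp add: less_imp_le)
    also have "(\<Prod>k\<in>UNIV. K0 * exp (- (1/2) * (column k X \<bullet> column k X) + c * (v \<bullet> column k X)^2))
      = K0 ^ CARD('m) * exp (\<Sum>k\<in>UNIV. - (1/2) * (column k X \<bullet> column k X) + c * (v \<bullet> column k X)^2)"
      by (simp add: prod.distrib exp_sum)
    also have "(\<Sum>k\<in>UNIV. - (1/2) * (column k X \<bullet> column k X) + c * (v \<bullet> column k X)^2) = - (1/2) * (X \<bullet> X) + c * (v \<bullet> (gram X *v v))"
      unfolding sum.distrib sum_distrib_left[symmetric] sum_column_inner sum_column_spike ..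
    finally show ?thesis .
  qed
  then show ?thesis using that[of "K0 ^ CARD('m)"] K0 dX by simp
qed

lemma summable_spike_term:
  fixes x :: "real^'n" and c :: real and M h :: nat
  assumes "CARD('n) = 2 * h" "M > 0" "\<And>j. 0 \<le> x $ j"
  shows "summable (\<lambda>k. spike_term (M * \<bar>c\<bar>) (M * c) k x)"
proof -
  let ?A = "range (\<lambda>j. complex_of_real (c * x $ j))"
  obtain r where "?A \<subseteq> ball 0 r"
    using bounded_subset_ballD[of ?A 0] finite_imp_bounded[of ?A] by auto
  then show ?thesis by (rule contour_spike_terms(1)[OF assms encloses_ccw_circlepath])
qed

text \<open>The exponential is expanded, each power is averaged over the direction of the spike, and the sum is then a function of the spectrum.
All terms are nonnegative, so sums and integrals commute.\<close>
lemma spiked_eigenvalue_integral: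
  fixes F :: "real^'n::{finite,linorder} \<Rightarrow> ennreal" and v :: "real^'n::{finite,linorder}" and a :: real
  assumes MN: "CARD('m) > CARD('n)" and h: "CARD('n) = 2 * h" and v: "norm v = 1"
    and F[measurable]: "F \<in> borel_measurable borel" and sym: "\<And>\<sigma> x. bij \<sigma> \<Longrightarrow> F (\<chi> i. x $ \<sigma> i) = F x"
    and law: "\<forall>F :: real^'n::{finite,linorder} \<Rightarrow> ennreal. F \<in> borel_measurable borel \<longrightarrow> (\<forall>\<sigma> x. bij \<sigma> \<longrightarrow> F (\<chi> i. x $ \<sigma> i) = F x) \<longrightarrow>
     (\<integral>\<^sup>+ X. F (spectrum (gram (X::real^'m^'n::{finite,linorder}))) \<partial>lborel) = (\<integral>\<^sup>+ x. F x * ennreal (C * laguerre_weight a 0 x) \<partial>lborel)"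
    and C: "C > 0" and ab: "\<bar>\<beta>\<bar> \<le> \<alpha>"
  shows "(\<integral>\<^sup>+ Y. F (spectrum (gram (Y::real^'m^'n::{finite,linorder}))) * ennreal (exp (spike_form \<alpha> \<beta> Y v)) \<partial>lborel)
    = (\<integral>\<^sup>+ x. F x * (\<Sum>k. ennreal (spike_term \<alpha> \<beta> k x)) * ennreal (C * laguerre_weight a 0 x) \<partial>lborel)"
proof -
  let ?ev = "\<lambda>Y::real^'m^'n::{finite,linorder}. spectrum (gram Y)"
  have nn: "0 \<le> spike_form \<alpha> \<beta> Y u" for Y :: "real^'m^'n::{finite,linorder}" and u
    by (rule spike_form_nonneg[OF ab])
  have term_eq: "(\<integral>\<^sup>+ Y. F (?ev Y) * ennreal (spike_form \<alpha> \<beta> Y v ^ k / fact k) \<partial>lborel) =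
     (\<integral>\<^sup>+ Y. F (?ev Y) * ennreal (spike_term \<alpha> \<beta> k (?ev Y)) \<partial>lborel)" for k
  proof -
    let ?q = "diag_moment k (1::real^'n::{finite,linorder})"
    have q: "?q > 0" by (rule diag_moment_1_pos[OF h])
    have [measurable]: "(\<lambda>x::real^'n::{finite,linorder}. diag_moment k (spike_weights \<alpha> \<beta> x)) \<in> borel_measurable borel"
    proof -
      have "(\<lambda>x::real^'n::{finite,linorder}. spike_term \<alpha> \<beta> k x * (fact k * ?q)) \<in> borel_measurable borel" by measurable
      then show ?thesis using q by (simp add: spike_term_def)
    qed
    have "(\<integral>\<^sup>+ Y. F (?ev Y) * ennreal (spike_form \<alpha> \<beta> Y v ^ k / fact k) \<partial>lborel) =
      (\<integral>\<^sup>+ Y. F (?ev Y) * ennreal (spike_form \<alpha> \<beta> Y v ^ k) * ennreal (1 / fact k) \<partial>lborel)"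
      by (intro nn_integral_cong) (simp add: mult.assoc ennreal_mult[symmetric] nn)
    also have "\<dots> = (\<integral>\<^sup>+ Y. F (?ev Y) * ennreal (spike_form \<alpha> \<beta> Y v ^ k) \<partial>lborel) * ennreal (1 / fact k)"
      by (rule nn_integral_multc) measurable
    also have "ennreal (1 / fact k) = ennreal ?q * ennreal (1 / (fact k * ?q))"
      using q by (simp add: ennreal_mult[symmetric])
    also have "(\<integral>\<^sup>+ Y. F (?ev Y) * ennreal (spike_form \<alpha> \<beta> Y v ^ k) \<partial>lborel) * (ennreal ?q * ennreal (1 / (fact k * ?q)))
      = (\<integral>\<^sup>+ Y. F (?ev Y) * ennreal (diag_moment k (spike_weights \<alpha> \<beta> (?ev Y))) \<partial>lborel) * ennreal (1 / (fact k * ?q))"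
      unfolding mult.assoc[symmetric] spike_direction_average[OF F ab v] ..
    also have "\<dots> = (\<integral>\<^sup>+ Y. F (?ev Y) * ennreal (diag_moment k (spike_weights \<alpha> \<beta> (?ev Y))) * ennreal (1 / (fact k * ?q)) \<partial>lborel)"
      by (rule nn_integral_multc[symmetric]) measurable
    also have "\<dots> = (\<integral>\<^sup>+ Y. F (?ev Y) * ennreal (spike_term \<alpha> \<beta> k (?ev Y)) \<partial>lborel)"
    proof (rule nn_integral_cong)
      fix Y :: "real^'m^'n::{finite,linorder}"
      have "0 \<le> diag_moment k (spike_weights \<alpha> \<beta> (?ev Y))"
        by (intro diag_moment_nonneg spike_weights_nonneg ab spectrum_gram_nonneg)
      then show "F (?ev Y) * ennreal (diag_moment k (spike_weights \<alpha> \<beta> (?ev Y))) * ennreal (1 / (fact k * ?q)) = F (?ev Y) * ennreal (spike_term \<alpha> \<beta> k (?ev Y))"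
        using q by (simp add: mult.assoc ennreal_mult[symmetric] spike_term_def)
    qed
    finally show ?thesis .
  qed
  have "(\<integral>\<^sup>+ Y. F (?ev Y) * ennreal (exp (spike_form \<alpha> \<beta> Y v)) \<partial>lborel)
     = (\<integral>\<^sup>+ Y. (\<Sum>k. F (?ev Y) * ennreal (spike_form \<alpha> \<beta> Y v ^ k / fact k)) \<partial>lborel)"
  proof (rule nn_integral_cong)
    fix Y :: "real^'m^'n::{finite,linorder}"
    have "(\<lambda>k. spike_form \<alpha> \<beta> Y v ^ k / fact k) sums exp (spike_form \<alpha> \<beta> Y v)"
      using exp_converges[of "spike_form \<alpha> \<beta> Y v"] by (simp add: divide_inverse mult.commute)
    then have "(\<Sum>k. ennreal (spike_form \<alpha> \<beta> Y v ^ k / fact k)) = ennreal (exp (spike_form \<alpha> \<beta> Y v))"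
      by (intro suminf_ennreal_eq) (simp_all add: nn)
    then show "F (?ev Y) * ennreal (exp (spike_form \<alpha> \<beta> Y v)) = (\<Sum>k. F (?ev Y) * ennreal (spike_form \<alpha> \<beta> Y v ^ k / fact k))"
      by (simp add: ennreal_suminf_cmult)
  qed
  also have "\<dots> = (\<Sum>k. \<integral>\<^sup>+ Y. F (?ev Y) * ennreal (spike_form \<alpha> \<beta> Y v ^ k / fact k) \<partial>lborel)"
    by (rule nn_integral_suminf) measurable
  also have "\<dots> = (\<Sum>k. \<integral>\<^sup>+ Y. F (?ev Y) * ennreal (spike_term \<alpha> \<beta> k (?ev Y)) \<partial>lborel)"
    unfolding term_eq ..
  also have "\<dots> = (\<integral>\<^sup>+ Y. (\<Sum>k. F (?ev Y) * ennreal (spike_term \<alpha> \<beta> k (?ev Y))) \<partial>lborel)"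
    by (rule nn_integral_suminf[symmetric]) measurable
  also have "\<dots> = (\<integral>\<^sup>+ Y. F (?ev Y) * (\<Sum>k. ennreal (spike_term \<alpha> \<beta> k (?ev Y))) \<partial>lborel)"
    by (simp add: ennreal_suminf_cmult)
  also have "\<dots> = (\<integral>\<^sup>+ x. (F x * (\<Sum>k. ennreal (spike_term \<alpha> \<beta> k x))) * ennreal (C * laguerre_weight a 0 x) \<partial>lborel)"
    by (rule law[THEN spec[of _ "\<lambda>x. F x * (\<Sum>k. ennreal (spike_term \<alpha> \<beta> k x))"], THEN mp, THEN mp])
       (measurable, simp add: sym spike_term_permute)
  finally show ?thesis .
qed

theorem theorem1:
  fixes \<Omega> :: "'a measure"
    and \<Sigma> :: "real ^ 'n::{finite,linorder} ^ 'n::{finite,linorder}"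
    and X :: "'a \<Rightarrow> real ^ 'm ^ 'n::{finite,linorder}"
    and S :: "'a \<Rightarrow> real ^ 'n::{finite,linorder} ^ 'n::{finite,linorder}"
    and \<tau> :: real
  defines "N \<equiv> CARD('n)" and "M \<equiv> CARD('m)"
  assumes "even N"
    and "M > N"
    and "positive_definite \<Sigma>"
    and "eigenvalues \<Sigma> = add_mset (1 + \<tau>) (replicate_mset (N - 1) 1)"
    and "real_wishart \<Omega> \<Sigma> X S"
  shows "\<exists>(Z :: complex) P.
    Z \<noteq> 0 \<and>
    joint_eigenvalue_density \<Omega> S P \<and>
    (\<forall>x. \<not> (\<forall>j. x $ j > 0) \<longrightarrow> P x = 0) \<and>
    (\<forall>x \<Gamma>. (\<forall>j. x $ j > 0) \<longrightarrow>
       encloses_ccw \<Gamma> (range (\<lambda>j. complex_of_real (\<tau> / (2 * (1 + \<tau>)) * x $ j))) \<longrightarrow>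
       complex_of_real (P x) =
         inverse Z *
         contour_integral \<Gamma> (\<lambda>t.
           complex_of_real \<bar>vandermonde x\<bar> * exp (of_nat M * t) *
           (\<Prod>j\<in>UNIV.
              complex_of_real (exp (- real M / 2 * x $ j)) *
              complex_of_real (x $ j powr ((real M - real N - 1) / 2)) *
              (t - complex_of_real (\<tau> / (2 * (1 + \<tau>)) * x $ j)) powr (- 1 / 2))))"
proof -
  have MN: "CARD('m) > CARD('n)" and M0: "M > 0" using assms(4) by (auto simp: M_def N_def)
  obtain h where h: "CARD('n) = 2 * h" using assms(3) by (auto simp: N_def)
  define c where "c = \<tau> / (2 * (1 + \<tau>))"
  define a where "a = (real M - real N - 1) / 2"
  obtain v where v: "norm v = 1" and tau: "1 + \<tau> > 0"
    and prec: "\<And>x. x \<bullet> (matrix_inv \<Sigma> *v x) = x \<bullet> x - \<tau> / (1 + \<tau>) * (v \<bullet> x)^2"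
    using spiked_precision[OF assms(5) assms(6)[unfolded N_def]] by blast
  have "2 * c = \<tau> / (1 + \<tau>)" using tau by (simp add: c_def field_simps)
  then have prec': "\<And>x. x \<bullet> (matrix_inv \<Sigma> *v x) = x \<bullet> x - 2 * c * (v \<bullet> x)^2" using prec by simp
  obtain K where K: "K > 0" and dX: "distr \<Omega> borel X =
     density lborel (\<lambda>X. ennreal (K * exp (- (1/2) * (X \<bullet> X) + c * (v \<bullet> (gram X *v v)))))"
    using spiked_wishart_matrix_density[OF assms(7) prec'] by blast
  have "\<exists>C>0. \<forall>F :: real^'n::{finite,linorder} \<Rightarrow> ennreal. F \<in> borel_measurable borel \<longrightarrow>
     (\<forall>\<sigma> x. bij \<sigma> \<longrightarrow> F (\<chi> i. x $ \<sigma> i) = F x) \<longrightarrow>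
     (\<integral>\<^sup>+ X. F (spectrum (gram (X::real^'m^'n::{finite,linorder}))) \<partial>lborel) = (\<integral>\<^sup>+ x. F x * ennreal (C * laguerre_weight a 0 x) \<partial>lborel)"
    unfolding a_def M_def N_def by (rule gram_eigenvalue_law[OF MN])
  then obtain C where C: "C > 0" and law0: "\<forall>F :: real^'n::{finite,linorder} \<Rightarrow> ennreal. F \<in> borel_measurable borel \<longrightarrow>
     (\<forall>\<sigma> x. bij \<sigma> \<longrightarrow> F (\<chi> i. x $ \<sigma> i) = F x) \<longrightarrow>
     (\<integral>\<^sup>+ X. F (spectrum (gram (X::real^'m^'n::{finite,linorder}))) \<partial>lborel) = (\<integral>\<^sup>+ x. F x * ennreal (C * laguerre_weight a 0 x) \<partial>lborel)"
    by (elim exE conjE)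
  define \<alpha> where "\<alpha> = M * \<bar>c\<bar>"
  define \<beta> where "\<beta> = M * c"
  have ab: "\<bar>\<beta>\<bar> \<le> \<alpha>" by (simp add: \<alpha>_def \<beta>_def abs_mult)
  \<comment> \<open>Rescaling by \<open>r\<close> turns the factor \<open>1 / M\<close> in the definition of the Wishart matrix into a factor in the exponent.\<close>
  define r where "r = sqrt (real M)"
  have r: "r > 0" "r^2 = real M" using M0 by (auto simp: r_def)
  define L where "L = K * r ^ DIM(real^'m^'n::{finite,linorder})"
  have L: "L > 0" using K r by (simp add: L_def)
  define \<phi> where "\<phi> x = (\<Sum>k. spike_term \<alpha> \<beta> k x)" for x :: "real^'n::{finite,linorder}"
  define q where "q x = L * exp (- (real M / 2 + \<alpha>) * power_sum 1 x)" for x :: "real^'n::{finite,linorder}"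
  \<comment> \<open>This vanishes off the positive orthant because the Laguerre weight does.\<close>
  define P where "P x = q x * \<phi> x * (C * laguerre_weight a 0 x)" for x :: "real^'n::{finite,linorder}"
  have q0: "q x > 0" for x using L by (simp add: q_def)
  have st0: "0 \<le> spike_term \<alpha> \<beta> k x" if "\<And>j. 0 \<le> x $ j" for k and x :: "real^'n::{finite,linorder}"
    unfolding spike_term_def using that ab diag_moment_1_pos[OF h, of k]
    by (intro divide_nonneg_pos diag_moment_nonneg spike_weights_nonneg) auto
  have sm: "summable (\<lambda>k. spike_term \<alpha> \<beta> k x)" if "\<And>j. 0 \<le> x $ j" for x :: "real^'n::{finite,linorder}"
    unfolding \<alpha>_def \<beta>_def by (rule summable_spike_term[OF h M0 that])
  have eig0: "laguerre_weight a 0 x = 0 \<or> (\<forall>j. x $ j > 0)" for x :: "real^'n::{finite,linorder}"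
    using laguerre_weight_nonzero(1) by blast
  have ephi: "(\<Sum>k. ennreal (spike_term \<alpha> \<beta> k x)) = ennreal (\<phi> x)" and phi0: "0 \<le> \<phi> x" if "\<forall>j. x $ j > 0" for x :: "real^'n::{finite,linorder}"
  proof -
    have x: "0 \<le> x $ j" for j using that by (simp add: less_imp_le)
    show "(\<Sum>k. ennreal (spike_term \<alpha> \<beta> k x)) = ennreal (\<phi> x)"
      unfolding \<phi>_def by (intro suminf_ennreal_eq summable_sums sm st0 x)
    show "0 \<le> \<phi> x" unfolding \<phi>_def by (intro suminf_nonneg sm st0 x)
  qed
  have P0: "0 \<le> P x" for x
    using eig0[of x] phi0[of x] q0[of x] C laguerre_weight_nonneg[of a 0 x] by (auto simp: P_def)
  have power_sum1[measurable]: "(\<lambda>x::real^'n::{finite,linorder}. power_sum 1 x) \<in> borel_measurable borel"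
    by (intro borel_measurable_continuous_onI continuous_intros)
  have qm[measurable]: "q \<in> borel_measurable borel" unfolding q_def[abs_def] by measurable
  have Pm: "P \<in> borel_measurable borel" unfolding P_def[abs_def] \<phi>_def by measurable
  have qsym: "q (\<chi> i. x $ \<sigma> i) = q x" if "bij \<sigma>" for \<sigma> x
    by (simp add: q_def power_sum_permute[OF that] del: One_nat_def)
  have Psym: "P (\<chi> i. x $ \<sigma> i) = P x" if "bij \<sigma>" for \<sigma> x
    by (simp add: P_def \<phi>_def qsym[OF that] spike_term_permute[OF that] laguerre_weight_permute[OF that])
  have Sg: "S \<omega> = gram ((1 / r) *\<^sub>R X \<omega>)" if "\<omega> \<in> space \<Omega>" for \<omega>
  proof -
    have "S \<omega> = (1 / real M) *\<^sub>R gram (X \<omega>)"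
      using assms(7) that by (simp add: real_wishart_def M_def)
    also have "1 / real M = (1 / r) * (1 / r)" using r by (simp add: power2_eq_square)
    also have "((1 / r) * (1 / r)) *\<^sub>R gram (X \<omega>) = gram ((1 / r) *\<^sub>R X \<omega>)"
      by (simp add: vec_eq_iff matrix_matrix_mult_def transpose_def sum_distrib_left mult_ac)
    finally show ?thesis .
  qed
  have Xm[measurable]: "X \<in> borel_measurable \<Omega>" by (rule real_wishart_law(1)[OF assms(7)])
  have event: "{\<omega> \<in> space \<Omega>. \<exists>x\<in>A. eigenvalues (S \<omega>) = image_mset (\<lambda>i. x $ i) (mset_set UNIV)} \<in> sets \<Omega> \<and>
     emeasure \<Omega> {\<omega> \<in> space \<Omega>. \<exists>x\<in>A. eigenvalues (S \<omega>) = image_mset (\<lambda>i. x $ i) (mset_set UNIV)} = (\<integral>\<^sup>+ x\<in>A. ennreal (P x) \<partial>lborel)"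
    if A[measurable]: "A \<in> sets borel" and Asym: "\<forall>\<sigma> x. bij \<sigma> \<longrightarrow> x \<in> A \<longrightarrow> (\<chi> i. x $ \<sigma> i) \<in> A" for A
  proof -
    let ?\<psi> = "\<lambda>X::real^'m^'n::{finite,linorder}. spectrum (gram ((1 / r) *\<^sub>R X))"
    have [measurable]: "?\<psi> \<in> borel_measurable borel"
      by (rule measurable_compose[OF _ spectrum_gram_measurable]) measurable
    have iff: "(\<exists>x\<in>A. eigenvalues (gram Y) = entries x) \<longleftrightarrow> spectrum (gram Y) \<in> A" for Y :: "real^'m^'n::{finite,linorder}"
    proof
      assume "\<exists>x\<in>A. eigenvalues (gram Y) = entries x"
      then obtain x where x: "x \<in> A" "entries x = entries (spectrum (gram Y))" using spectrum(2)[OF transpose_gram, of Y] by auto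
      from x(2) obtain \<sigma> where "bij \<sigma>" "spectrum (gram Y) = (\<chi> i. x $ \<sigma> i)" by (rule entries_eq_permute)
      then show "spectrum (gram Y) \<in> A" using Asym x(1) by simp
    qed (use spectrum(2)[OF transpose_gram, of Y] in blast)
    have Eeq: "{\<omega> \<in> space \<Omega>. \<exists>x\<in>A. eigenvalues (S \<omega>) = image_mset (\<lambda>i. x $ i) (mset_set UNIV)} = X -` {X. ?\<psi> X \<in> A} \<inter> space \<Omega>"
      by (rule set_eqI) (simp add: Sg entries_def[symmetric] iff conj_commute cong: conj_cong)
    have Bm[measurable]: "{X. ?\<psi> X \<in> A} \<in> sets borel"
      using measurable_sets[OF \<open>?\<psi> \<in> borel_measurable borel\<close> A] by (simp add: vimage_def)
    have sp[measurable]: "(\<lambda>X::real^'m^'n::{finite,linorder}. v \<bullet> (gram X *v v)) \<in> borel_measurable borel"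
    proof -
      have "(\<lambda>X::real^'m^'n::{finite,linorder}. v \<bullet> (gram X *v v)) = (\<lambda>X. spike_form 0 1 X v)"
        by (simp add: spike_form_def)
      then show ?thesis by simp
    qed
    define F where "F x = indicator A x * ennreal (q x)" for x
    have Fm[measurable]: "F \<in> borel_measurable borel" unfolding F_def[abs_def] by measurable
    have Fsym: "F (\<chi> i. x $ \<sigma> i) = F x" if \<sigma>: "bij \<sigma>" for \<sigma> x
    proof -
      have "(\<chi> i. x $ \<sigma> i) \<in> A \<longleftrightarrow> x \<in> A"
      proof
        assume "(\<chi> i. x $ \<sigma> i) \<in> A"
        then have "(\<chi> j. (\<chi> i. x $ \<sigma> i) $ inv \<sigma> j) \<in> A" using Asym bij_imp_bij_inv[OF \<sigma>] by blast
        also have "(\<chi> j. (\<chi> i. x $ \<sigma> i) $ inv \<sigma> j) = x" using \<sigma> by (simp add: vec_eq_iff bij_is_surj surj_f_inv_f)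
        finally show "x \<in> A" .
      qed (use Asym \<sigma> in blast)
      then show ?thesis by (simp add: F_def qsym[OF \<sigma>] indicator_def)
    qed
    let ?G = "\<lambda>X::real^'m^'n::{finite,linorder}. ennreal (K * exp (- (1/2) * (X \<bullet> X) + c * (v \<bullet> (gram X *v v)))) * indicator {X. ?\<psi> X \<in> A} X"
    have "emeasure \<Omega> (X -` {X. ?\<psi> X \<in> A} \<inter> space \<Omega>) = emeasure (distr \<Omega> borel X) {X. ?\<psi> X \<in> A}"
      by (simp add: emeasure_distr)
    also have "\<dots> = (\<integral>\<^sup>+ X. ?G X \<partial>lborel)" unfolding dX by (subst emeasure_density) auto
    also have "\<dots> = ennreal (r ^ DIM(real^'m^'n::{finite,linorder})) * (\<integral>\<^sup>+ Y. ?G (r *\<^sub>R Y) \<partial>lborel)"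
      by (rule nn_integral_lborel_scale[OF r(1)]) measurable
    also have "\<dots> = (\<integral>\<^sup>+ Y. ennreal (r ^ DIM(real^'m^'n::{finite,linorder})) * ?G (r *\<^sub>R Y) \<partial>lborel)"
      by (rule nn_integral_cmult[symmetric]) measurable
    also have "\<dots> = (\<integral>\<^sup>+ Y. F (spectrum (gram (Y::real^'m^'n::{finite,linorder}))) * ennreal (exp (spike_form \<alpha> \<beta> Y v)) \<partial>lborel)"
    proof (rule nn_integral_cong)
      fix Y :: "real^'m^'n::{finite,linorder}"
      have g: "v \<bullet> (gram (r *\<^sub>R Y) *v v) = real M * (v \<bullet> (gram Y *v v))"
      proof -
        have "gram (r *\<^sub>R Y) = r^2 *\<^sub>R gram Y"
          by (simp add: vec_eq_iff matrix_matrix_mult_def transpose_def sum_distrib_left power2_eq_square mult_ac)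
        then show ?thesis by (simp add: r(2) scaleR_matrix_vector_assoc[symmetric])
      qed
      have n: "(r *\<^sub>R Y) \<bullet> (r *\<^sub>R Y) = real M * (Y \<bullet> Y)" using r(2) by (simp add: power2_eq_square mult.assoc[symmetric])
      have "v \<bullet> v = 1" using v by (simp add: norm_eq_1)
      then have "- (1/2) * (real M * (Y \<bullet> Y)) + c * (real M * (v \<bullet> (gram Y *v v))) =
         - (real M / 2 + \<alpha>) * (Y \<bullet> Y) + spike_form \<alpha> \<beta> Y v"
        by (simp add: spike_form_def \<beta>_def algebra_simps)
      then have e: "r ^ DIM(real^'m^'n::{finite,linorder}) * (K * exp (- (1/2) * ((r *\<^sub>R Y) \<bullet> (r *\<^sub>R Y)) + c * (v \<bullet> (gram (r *\<^sub>R Y) *v v)))) =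
         q (spectrum (gram Y)) * exp (spike_form \<alpha> \<beta> Y v)"
        unfolding g n q_def power_sum_1_gram by (simp only: exp_add L_def mult_ac)
      have "?\<psi> (r *\<^sub>R Y) = spectrum (gram Y)" using r(1) by simp
      then have "ennreal (r ^ DIM(real^'m^'n::{finite,linorder})) * ?G (r *\<^sub>R Y) =
         ennreal (r ^ DIM(real^'m^'n::{finite,linorder}) * (K * exp (- (1/2) * ((r *\<^sub>R Y) \<bullet> (r *\<^sub>R Y)) + c * (v \<bullet> (gram (r *\<^sub>R Y) *v v))))) * indicator A (spectrum (gram Y))"
        using K r(1) by (simp only: ennreal_mult less_imp_le mult_nonneg_nonneg exp_ge_zero zero_le_power mult.assoc) (simp add: indicator_def)
      also have "\<dots> = F (spectrum (gram Y)) * ennreal (exp (spike_form \<alpha> \<beta> Y v))"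
        unfolding e F_def using q0[of "spectrum (gram Y)"] by (simp add: ennreal_mult less_imp_le mult_ac)
      finally show "ennreal (r ^ DIM(real^'m^'n::{finite,linorder})) * ?G (r *\<^sub>R Y) = F (spectrum (gram Y)) * ennreal (exp (spike_form \<alpha> \<beta> Y v))" .
    qed
    also have "\<dots> = (\<integral>\<^sup>+ x. F x * (\<Sum>k. ennreal (spike_term \<alpha> \<beta> k x)) * ennreal (C * laguerre_weight a 0 x) \<partial>lborel)"
      by (rule spiked_eigenvalue_integral[OF MN h v Fm Fsym law0 C ab])
    also have "\<dots> = (\<integral>\<^sup>+ x\<in>A. ennreal (P x) \<partial>lborel)"
    proof (rule nn_integral_cong)
      fix x :: "real^'n::{finite,linorder}"
      show "F x * (\<Sum>k. ennreal (spike_term \<alpha> \<beta> k x)) * ennreal (C * laguerre_weight a 0 x) = ennreal (P x) * indicator A x"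
      proof (cases "laguerre_weight a 0 x = 0")
        case False
        then have x: "\<forall>j. x $ j > 0" using eig0 by blast
        have "ennreal (P x) = ennreal (q x) * ennreal (\<phi> x) * ennreal (C * laguerre_weight a 0 x)"
          unfolding P_def using q0[of x] phi0[OF x] C laguerre_weight_nonneg[of a 0 x] by (simp add: ennreal_mult less_imp_le)
        then show ?thesis unfolding ephi[OF x] F_def by (simp add: mult_ac)
      qed (simp add: P_def)
    qed
    finally show ?thesis using measurable_sets[OF Xm Bm] unfolding Eeq by simp
  qed
  define Z where "Z = (2 * pi * \<i> * of_real (M ^ (h - 1) / fact (h - 1))) / of_real (L * C)"
  show ?thesis
  proof (intro exI[of _ Z] exI[of _ P] conjI allI impI)
    show "Z \<noteq> 0" using M0 L C by (simp add: Z_def)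
    show "joint_eigenvalue_density \<Omega> S P"
      unfolding joint_eigenvalue_density_def Let_def using Pm P0 Psym event by blast
    show "P x = 0" if "\<not> (\<forall>j. x $ j > 0)" for x :: "real^'n::{finite,linorder}" using eig0[of x] that by (auto simp: P_def)
    fix x :: "real^'n::{finite,linorder}" and \<Gamma>
    assume x: "\<forall>j. x $ j > 0" and \<Gamma>: "encloses_ccw \<Gamma> (range (\<lambda>j. complex_of_real (\<tau> / (2 * (1 + \<tau>)) * x $ j)))"
    let ?A = "range (\<lambda>j. complex_of_real (c * x $ j))"
    have \<Gamma>': "encloses_ccw \<Gamma> ?A" using \<Gamma> by (simp only: c_def)
    have x0: "0 \<le> x $ j" for j using x by (simp add: less_imp_le)
    let ?f = "\<lambda>t. exp (of_nat M * t) * inv_sqrt_prod (c *\<^sub>R x) t"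
    define w where "w = \<bar>vandermonde x\<bar> * (exp (- real M / 2 * power_sum 1 x) * (\<Prod>j\<in>UNIV. x $ j powr a))"
    have integrand: "complex_of_real \<bar>vandermonde x\<bar> * exp (of_nat M * t) *
           (\<Prod>j\<in>UNIV.
              complex_of_real (exp (- real M / 2 * x $ j)) *
              complex_of_real (x $ j powr ((real M - real N - 1) / 2)) *
              (t - complex_of_real (\<tau> / (2 * (1 + \<tau>)) * x $ j)) powr (- 1 / 2)) = of_real w * ?f t" for t
    proof -
      have "(\<Prod>j\<in>UNIV. complex_of_real (exp (- real M / 2 * x $ j))) = of_real (exp (- real M / 2 * power_sum 1 x))"
        unfolding power_sum_def sum_distrib_left exp_sum[OF finite_class.finite_UNIV] of_real_prod by simp
      then show ?thesis
        unfolding prod.distrib a_def[symmetric] c_def[symmetric] w_def inv_sqrt_prod_def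
        by (simp add: mult_ac)
    qed
    have "?f holomorphic_on - (convex hull ?A)"
      using inv_sqrt_prod_holomorphic[of "c *\<^sub>R x"] h by (intro holomorphic_intros) simp_all
    moreover have "open (- (convex hull ?A))"
      by (intro open_Compl compact_imp_closed finite_imp_compact_convex_hull) simp
    ultimately have "?f contour_integrable_on \<Gamma>"
      using \<Gamma>' by (intro contour_integrable_holomorphic_simple[of _ "- (convex hull ?A)"]) (auto simp: encloses_ccw_def)
    then have "contour_integral \<Gamma> (\<lambda>t. of_real w * ?f t) = of_real w * contour_integral \<Gamma> ?f"
      by (rule contour_integral_lmul)
    also have "contour_integral \<Gamma> ?f = of_real (\<phi> x) *
      (2 * pi * \<i> * of_real (exp (- M * \<bar>c\<bar> * power_sum 1 x) * M ^ (h - 1) / fact (h - 1)))"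
      using contour_spike_terms(2)[OF h M0 x0 \<Gamma>'] by (simp add: \<phi>_def \<alpha>_def \<beta>_def)
    finally have ci: "contour_integral \<Gamma> (\<lambda>t. of_real w * ?f t) = of_real w * (of_real (\<phi> x) *
      (2 * pi * \<i> * of_real (exp (- M * \<bar>c\<bar> * power_sum 1 x) * M ^ (h - 1) / fact (h - 1))))" .
    have eig: "laguerre_weight a 0 x = \<bar>vandermonde x\<bar> * (\<Prod>j\<in>UNIV. x $ j powr a)"
      using x by (simp add: laguerre_weight_def laguerre_def)
    have qx: "q x = L * (exp (- real M / 2 * power_sum 1 x) * exp (- M * \<bar>c\<bar> * power_sum 1 x))"
      by (simp add: q_def \<alpha>_def exp_add[symmetric] algebra_simps)
    have "inverse Z * contour_integral \<Gamma> (\<lambda>t. of_real w * ?f t) = complex_of_real (P x)"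
      unfolding ci unfolding Z_def P_def eig qx w_def using M0 L C by (simp add: field_simps)
    then show "complex_of_real (P x) =
         inverse Z *
         contour_integral \<Gamma> (\<lambda>t.
           complex_of_real \<bar>vandermonde x\<bar> * exp (of_nat M * t) *
           (\<Prod>j\<in>UNIV.
              complex_of_real (exp (- real M / 2 * x $ j)) *
              complex_of_real (x $ j powr ((real M - real N - 1) / 2)) *
              (t - complex_of_real (\<tau> / (2 * (1 + \<tau>)) * x $ j)) powr (- 1 / 2)))"
      unfolding integrand by simp
  qed
qed

end
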